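(* Suppose $\alpha$ is a construction (on integral polytopes in $\mathbb{R}^{n+1}$) such that McMullen's formula holds and $\alpha$ is symmetric about the coordinates. Then all the values $\alpha(F,\Pi_n)$, $F$ a nonempty face of the regular permutohedron $\Pi_n$, are uniquely determined; that is, if $\alpha$ and $\alpha'$ are two such constructions, then $\alpha(F,\Pi_n)=\alpha'(F,\Pi_n)$ for every nonempty face $F$ of $\Pi_n$.
   Context: Regular permutohedron: $\Pi_n=\operatorname{conv}\{(\sigma(1),\dots,\sigma(n+1)) : \sigma\in\mathfrak{S}_{n+1}\}\subset\mathbb{R}^{n+1}$. Put $D=n+1$, with standard inner product on $\mathbb{R}^D$ (dual space identified with $\mathbb{R}^D$) and lattice $\mathbb{Z}^D$. A polytope is integral if its vertices lie in $\mathbb{Z}^D$. For a set $A$, $\operatorname{lin}(A)$ is the linear subspace parallel to its affine span; $\operatorname{nvol}(F)$ is the volume of $F$ in its affine span, normalized so that $\operatorname{lin}(F)\cap\mathbb{Z}^D$ has covolume $1$. For a nonempty face $F$ of a polytope $P$, $\operatorname{ncone}(F,P)=\{u: \langle u,p_1\rangle\ge\langle u,p_2\rangle\ \forall p_1\in F,\ p_2\in P\}$, and $(\operatorname{ncone}(F,P))^\circ=\{y\in\operatorname{span}(\operatorname{ncone}(F,P)) : \langle y,u\rangle\le 0\ \forall u\in\operatorname{ncone}(F,P)\}$. A construction $\alpha$ such that McMullen's formula holds is a real-valued function $\alpha(F,P)$, defined for all integral polytopes $P\subset\mathbb{R}^D$ and nonempty faces $F$ of $P$, such that $\alpha(F,P)$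 depends only on the normal cone $\operatorname{ncone}(F,P)$ and $|P\cap\mathbb{Z}^D|=\sum_{F}\alpha(F,P)\operatorname{nvol}(F)$ for every integral polytope $P$ (sum over all nonempty faces $F$ of $P$, including $P$). It is symmetric about the coordinates if $\alpha(F,P)=\alpha(G,Q)$ whenever $(\operatorname{ncone}(F,P))^\circ=\sigma\big((\operatorname{ncone}(G,Q))^\circ\big)$ for some $\sigma\in\mathfrak{S}_D$, where $\sigma(T)=\{(x_{\sigma(1)},\dots,x_{\sigma(D)}):(x_1,\dots,x_D)\in T\}$. *)

theory Defs
  imports "HOL-Analysis.Analysis"
begin

text \<open>
  The ambient space with \<open>D\<close> coordinates is \<open>real ^ 'd\<close>, with \<open>D = CARD('d)\<close> (so
  \<open>n = CARD('d) - 1\<close>). The coordinates are indexed by the elements of the finite type \<open>'d\<close>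
  instead of \<open>1, \<dots>, D\<close>.
\<close>

definition int_lattice :: "(real ^ 'd) set"
  where "int_lattice = {x. \<forall>i. x $ i \<in> \<int>}"

definition integral_polytope :: "(real ^ 'd) set \<Rightarrow> bool"
  where "integral_polytope P \<longleftrightarrow> polytope P \<and> {v. v extreme_point_of P} \<subseteq> int_lattice"

definition nonempty_face :: "(real ^ 'd) set \<Rightarrow> (real ^ 'd) set \<Rightarrow> bool"
  where "nonempty_face F P \<longleftrightarrow> F face_of P \<and> F \<noteq> {}"

definition lin :: "(real ^ 'd) set \<Rightarrow> (real ^ 'd) set"
  where "lin A = {x - y |x y. x \<in> affine hull A \<and> y \<in> affine hull A}"

definition is_lattice_basis :: "(real ^ 'd) set \<Rightarrow> (real ^ 'd) set \<Rightarrow> bool"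
  where "is_lattice_basis B S \<longleftrightarrow> independent B \<and> span B = S \<and>
    S \<inter> int_lattice = {\<Sum>b\<in>B. of_int (c b) *\<^sub>R b |c :: real ^ 'd \<Rightarrow> int. True}"

text \<open>
  Normalized volume: a basis \<open>B\<close> of the lattice \<open>lin F \<inter> int_lattice\<close> and a base point \<open>p\<close> of \<open>F\<close>
  identify the affine span of \<open>F\<close> with the space of functions \<open>B \<rightarrow> \<real>\<close>, the lattice becoming the
  functions with integer values; \<open>nvol F\<close> is the product Lebesgue measure of \<open>F\<close> in these
  coordinates. Two such bases differ by a unimodular transformation, so the choices do not matter.
  A basis exists whenever \<open>lin F\<close> is spanned by integer vectors, as it is for nonempty faces of
  integral polytopes. If \<open>F\<close> is a point then \<open>B = {}\<close> and \<open>nvol F = 1\<close>.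
\<close>

definition nvol :: "(real ^ 'd) set \<Rightarrow> real"
  where "nvol F =
    (let B = (SOME B. is_lattice_basis B (lin F)); p = (SOME p. p \<in> F)
     in measure (Pi\<^sub>M B (\<lambda>_. lborel))
          {c \<in> B \<rightarrow>\<^sub>E UNIV. p + (\<Sum>b\<in>B. c b *\<^sub>R b) \<in> F})"

definition ncone :: "(real ^ 'd) set \<Rightarrow> (real ^ 'd) set \<Rightarrow> (real ^ 'd) set"
  where "ncone F P = {u. \<forall>p1\<in>F. \<forall>p2\<in>P. u \<bullet> p1 \<ge> u \<bullet> p2}"

text \<open>The polar is taken inside the linear span of \<open>K\<close>, not in the whole space.\<close>

definition polar_in_span :: "(real ^ 'd) set \<Rightarrow> (real ^ 'd) set"
  where "polar_in_span K = {y \<in> span K. \<forall>u\<in>K. y \<bullet> u \<le> 0}"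

definition permute_coords :: "('d \<Rightarrow> 'd) \<Rightarrow> (real ^ 'd) set \<Rightarrow> (real ^ 'd) set"
  where "permute_coords \<sigma> T = {(\<chi> i. x $ \<sigma> i) |x. x \<in> T}"

text \<open>
  A construction is a total function of \<open>F\<close> and \<open>P\<close>, of which only the values at integral polytopes
  \<open>P\<close> and nonempty faces \<open>F\<close> of \<open>P\<close> are constrained or used.
\<close>

definition mcmullen_construction :: "((real ^ 'd) set \<Rightarrow> (real ^ 'd) set \<Rightarrow> real) \<Rightarrow> bool"
  where "mcmullen_construction \<alpha> \<longleftrightarrow>
    (\<forall>P Q F G. integral_polytope P \<and> integral_polytope Q \<and>
        nonempty_face F P \<and> nonempty_face G Q \<and> ncone F P = ncone G Q
        \<longrightarrow> \<alpha> F P = \<alpha> G Q) \<and>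
    (\<forall>P. integral_polytope P \<longrightarrow>
        real (card (P \<inter> int_lattice)) = (\<Sum>F\<in>{F. nonempty_face F P}. \<alpha> F P * nvol F))"

definition symmetric_about_coords :: "((real ^ 'd) set \<Rightarrow> (real ^ 'd) set \<Rightarrow> real) \<Rightarrow> bool"
  where "symmetric_about_coords \<alpha> \<longleftrightarrow>
    (\<forall>P Q F G \<sigma>. integral_polytope P \<and> integral_polytope Q \<and>
        nonempty_face F P \<and> nonempty_face G Q \<and> bij \<sigma> \<and>
        polar_in_span (ncone F P) = permute_coords \<sigma> (polar_in_span (ncone G Q))
        \<longrightarrow> \<alpha> F P = \<alpha> G Q)"

definition permutohedron :: "(real ^ 'd) set"
  where "permutohedron =
    convex hull {(\<chi> i. real (\<sigma> i)) |\<sigma> :: 'd \<Rightarrow> nat. bij_betw \<sigma> UNIV {1..CARD('d)}}"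

end

theory Submission
  imports Defs
begin

text \<open>
  For a strictly decreasing integer sequence \<open>x\<close>, the convex hull \<open>P x\<close> of the rearrangements of \<open>x\<close>
  has the normal fan of the permutohedron: its faces correspond to the weak orders on the coordinates,
  independently of \<open>x\<close>, and the symmetry of \<open>\<alpha>\<close> makes \<open>\<alpha>\<close> depend only on the ordered sequence
  of block sizes of the weak order, that is, on the set \<open>C\<close> of its cut positions. So McMullen's
  formulas for \<open>\<alpha>\<close> and \<open>\<alpha>'\<close> at all the \<open>P x\<close> subtract to a linear relation, with the differences
  \<open>\<alpha> - \<alpha>'\<close> as coefficients, between the functions \<open>V C\<close> of \<open>x\<close>, where \<open>V C x\<close> is the product of the
  volumes of the permutohedra of the segments of \<open>x\<close> between consecutive cuts.

  Now \<open>V C\<close> is unchanged when the gap \<open>x (i - 1) - x i\<close> is enlarged at a cut \<open>i\<close>, while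
  the iterated difference of \<open>V C\<close> over all gaps that are not cuts is positive. The latter
  holds because slicing a permutohedron by a hyperplane that fixes one coordinate gives permutohedra
  again, so that the volume is an integral of volumes in one dimension less, along linear functions
  of \<open>x\<close>. Taking this iterated difference of the relation, for a cut set \<open>C\<close> of minimal size with nonzero
  coefficient, leaves only the terms with cut set \<open>C\<close>: a contradiction.
\<close>

section \<open>Iterated differences and the volume recursion\<close>

text \<open>McMullen's formula speaks only about integer sequences, so the terms are separated by
  unit differences along the directions \<open>weight i\<close> instead of derivatives.
  Geometrically the polytope is a Minkowski sum of hypersimplices scaled by the gaps of
  \<open>x\<close>, and the iterated difference over all gaps plays the role of their mixed volume;
  its positivity is the crux. The obstacle is that the slicing recursion does not preserve these
  directions: \<open>squash k t\<close> sends \<open>weight (Suc k)\<close> to a sequence with the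
  intermediate entry \<open>1 - t\<close>. Hence nonnegativity is proved for differences along
  arbitrary nonincreasing directions, a cone that \<open>squash\<close> preserves, and strict
  positivity is then read off a single summand of the recursion. In the last step, a different cut
  set with nonzero coefficient is not contained in the minimal \<open>C\<close>, so it has a cut
  outside \<open>C\<close>, and the difference at that cut kills its term. The surviving terms
  cannot cancel: symmetry gives them the same coefficient difference, and they differ only by
  positive normalization factors.\<close>

definition squash :: "nat \<Rightarrow> real \<Rightarrow> (nat \<Rightarrow> real) \<Rightarrow> nat \<Rightarrow> real"
  where "squash k t x =
    (\<lambda>i. if i < k then x i else if i = k then (1 - t) * x k + t * x (Suc k) else x (Suc i))"

text \<open>
  \<open>perm_vol n x\<close> is the \<open>n\<close>-dimensional volume of the permutohedron of \<open>x 0 \<ge> \<dots> \<ge> x n\<close>, projected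
  along one coordinate. The slice at the value \<open>s = x (k + 1) + t (x k - x (k + 1))\<close> of another coordinate
  is the permutohedron of the sequence in which \<open>x k\<close> and \<open>x (k + 1)\<close> are replaced by
  \<open>x k + x (k + 1) - s\<close>.
\<close>

primrec perm_vol :: "nat \<Rightarrow> (nat \<Rightarrow> real) \<Rightarrow> real" where
  "perm_vol 0 = (\<lambda>x. 1)"
| "perm_vol (Suc n) =
    (\<lambda>x. \<Sum>k\<le>n. (x k - x (Suc k)) * integral {0..1} (\<lambda>t. perm_vol n (squash k t x)))"

primrec diffs :: "(nat \<Rightarrow> real) list \<Rightarrow> ((nat \<Rightarrow> real) \<Rightarrow> real) \<Rightarrow> (nat \<Rightarrow> real) \<Rightarrow> real" where
  "diffs [] f = f"
| "diffs (v # vs) f = diffs vs (\<lambda>x. f (\<lambda>i. x i + v i) - f x)"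

text \<open>Quantifying over all nonincreasing directions makes the property stable under
  \<open>squash\<close>, which is linear in the sequence and preserves \<open>antimono\<close>. The
  empty list is included, so \<open>f\<close> itself is nonnegative on nonincreasing
  sequences.\<close>

definition abs_mono :: "((nat \<Rightarrow> real) \<Rightarrow> real) \<Rightarrow> bool"
  where "abs_mono f \<longleftrightarrow>
    (\<forall>vs x. (\<forall>v\<in>set vs. antimono v) \<longrightarrow> antimono x \<longrightarrow> diffs vs f x \<ge> 0)"

text \<open>A fundamental weight of type A: for positive \<open>i\<close>, adding it raises the gap
  between positions \<open>i - 1\<close> and \<open>i\<close> by one and changes no other
  gap.\<close>

definition weight :: "nat \<Rightarrow> nat \<Rightarrow> real"
  where "weight i = (\<lambda>k. if k < i then 1 else 0)"

lemma antimono_weight: "antimono (weight i)"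
  by (auto simp: weight_def antimono_def)

lemma antimono_add: "antimono x \<Longrightarrow> antimono y \<Longrightarrow> antimono (\<lambda>i. x i + y i :: real)"
  by (auto simp: antimono_def intro: add_mono)

lemma antimono_squash:
  assumes "antimono x" "0 \<le> t" "t \<le> 1"
  shows "antimono (squash k t x)"
proof -
  have ge: "(1 - t) * x k + t * x (Suc k) \<ge> x (Suc k)" and le: "(1 - t) * x k + t * x (Suc k) \<le> x k"
  proof -
    have d: "x (Suc k) \<le> x k" using assms(1) by (auto simp: antimono_def)
    have "t * (x k - x (Suc k)) \<ge> 0" "(1 - t) * (x k - x (Suc k)) \<ge> 0" using d assms by simp_all
    then show "(1 - t) * x k + t * x (Suc k) \<ge> x (Suc k)" "(1 - t) * x k + t * x (Suc k) \<le> x k"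
      by (simp_all add: algebra_simps)
  qed
  have D: "x j \<le> x i" if "i \<le> j" for i j using assms(1) that by (auto simp: antimono_def)
  show ?thesis
    unfolding decseq_Suc_iff
  proof
    fix i
    show "squash k t x (Suc i) \<le> squash k t x i"
      using D[of i k] D[of i "Suc i"] D[of "Suc i" "Suc (Suc i)"] ge le D[of "Suc k" "Suc (Suc k)"]
      by (auto simp: squash_def)
  qed
qed

text \<open>Joint continuity, for the product topology on sequences, makes the integral over
  \<open>t\<close> continuous in \<open>x\<close> again, so that continuity passes through the
  recursion of \<open>perm_vol\<close>.\<close>

lemma continuous_on_comp_squash:
  assumes "continuous_on UNIV f"
  shows "continuous_on S (\<lambda>(x, t). f (squash k t x) :: real)"
proof -
  have "continuous_on S (\<lambda>p. squash k (snd p) (fst p))"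
  proof (rule continuous_on_coordinatewise_then_product)
    fix i
    have *: "continuous_on S (\<lambda>p::(nat \<Rightarrow> real) \<times> real. fst p j)" for j
      by (rule continuous_on_compose2[OF continuous_on_product_coordinates[where i=j]
            continuous_on_fst[OF continuous_on_id]]) auto
    show "continuous_on S (\<lambda>p. squash k (snd p) (fst p) i)"
      unfolding squash_def by (cases "i < k"; cases "i = k") (simp_all add: *, intro continuous_intros *)
  qed
  from continuous_on_compose2[OF assms this] show ?thesis
    by (simp add: case_prod_beta)
qed

lemma continuous_perm_vol: "continuous_on UNIV (perm_vol n)"
proof (induction n)
  case (Suc n)
  have "continuous_on UNIV (\<lambda>x. integral {0..1} (\<lambda>t. perm_vol n (squash k t x)))" for k
    using integral_continuous_on_param[of UNIV "0::real" 1 "\<lambda>x t. perm_vol n (squash k t x)"]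
      continuous_on_comp_squash[OF Suc] by simp
  then show ?case
    by (auto intro!: continuous_intros continuous_on_product_coordinates)
qed simp

lemma continuous_perm_vol_squash: "continuous_on S (\<lambda>t. perm_vol n (squash k t x))"
proof -
  have "continuous_on S (\<lambda>t. (x, t))" by (intro continuous_intros)
  from continuous_on_compose2[OF continuous_on_comp_squash[OF continuous_perm_vol, of UNIV n k] this]
  show ?thesis by simp
qed

text \<open>The domain \<open>S\<close> is carried along because the relation between volumes is
  known only at integer sequences. If \<open>S\<close> is closed under the directions, it contains
  every point at which the iterated difference evaluates its function.\<close>

lemma diffs_cong:
  assumes "\<And>x. S x \<Longrightarrow> f x = g x" "\<And>v x. v \<in> set vs \<Longrightarrow> S x \<Longrightarrow> S (\<lambda>i. x i + v i)" "S x"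
  shows "diffs vs f x = diffs vs g x"
  using assms
proof (induction vs arbitrary: f g x)
  case (Cons v vs)
  show ?case unfolding diffs.simps by (rule Cons.IH) (use Cons.prems in auto)
qed simp

lemma diffs_append: "diffs (us @ vs) f = diffs vs (diffs us f)"
  by (induction us arbitrary: f) auto

lemma diffs_add: "diffs vs (\<lambda>x. f x + g x) x = diffs vs f x + diffs vs g x"
proof (induction vs arbitrary: f g)
  case (Cons v vs)
  show ?case by (simp add: Cons[symmetric]) (simp add: algebra_simps)
qed simp

lemma diffs_cmult: "diffs vs (\<lambda>x. c * f x) x = c * diffs vs f x"
proof (induction vs arbitrary: f)
  case (Cons v vs)
  show ?case by (simp add: Cons[symmetric]) (simp add: algebra_simps)
qed simp

lemma diffs_zero: "diffs vs (\<lambda>x. 0) x = 0"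
  by (induction vs) auto

lemma diffs_sum: "diffs vs (\<lambda>x. \<Sum>k\<in>K. f k x) x = (\<Sum>k\<in>K. diffs vs (f k) x)"
  by (induction K rule: infinite_finite_induct) (auto simp: diffs_add diffs_zero)

text \<open>Additivity turns a step \<open>v\<close> of \<open>x\<close> into a step
  \<open>L v\<close> of \<open>L x\<close>. The maps in question are \<open>squash k t\<close> and
  the restriction to a segment.\<close>

lemma diffs_compose:
  assumes "\<And>x y. L (\<lambda>i. x i + y i) = (\<lambda>i. L x i + L y i)"
  shows "diffs vs (\<lambda>x. f (L x)) x = diffs (map L vs) f (L x)"
proof (induction vs arbitrary: f)
  case (Cons v vs)
  show ?case using Cons[of "\<lambda>y. f (\<lambda>i. y i + L v i) - f y"] by (simp add: assms)
qed simp

lemma diffs_shift: "diffs vs (\<lambda>x. f (\<lambda>i. x i + w i)) x = diffs vs f (\<lambda>i. x i + w i)"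
proof (induction vs arbitrary: f)
  case (Cons v vs)
  show ?case using Cons[of "\<lambda>y. f (\<lambda>i. y i + v i) - f y"] by (simp add: add_ac)
qed simp

lemma diffs_invariant:
  assumes "\<And>x. f (\<lambda>i. x i + w i) = f x"
  shows "diffs vs f (\<lambda>i. x i + w i) = diffs vs f x"
  using diffs_shift[of vs f w x] assms by simp

text \<open>Invariance under \<open>v\<close> survives the differences taken before
  \<open>v\<close>, so the difference along \<open>v\<close> gives the zero function.\<close>

lemma diffs_eq_0:
  assumes "v \<in> set vs" "\<And>x. f (\<lambda>i. x i + v i) = f x"
  shows "diffs vs f x = 0"
proof -
  obtain as bs where "vs = as @ v # bs" using assms(1) by (meson split_list)
  then show ?thesis using diffs_invariant[of f v as] assms(2) by (simp add: diffs_append diffs_zero)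
qed

lemma diffs_mult_left:
  assumes "\<And>v x. v \<in> set vs \<Longrightarrow> g (\<lambda>i. x i + v i) = g x"
  shows "diffs vs (\<lambda>x. g x * f x) x = g x * diffs vs f x"
  using assms
proof (induction vs arbitrary: f)
  case (Cons v vs)
  have "diffs vs (\<lambda>x. g (\<lambda>i. x i + v i) * f (\<lambda>i. x i + v i) - g x * f x) x =
        diffs vs (\<lambda>x. g x * (f (\<lambda>i. x i + v i) - f x)) x"
    by (simp add: Cons.prems right_diff_distrib)
  also have "\<dots> = g x * diffs vs (\<lambda>x. f (\<lambda>i. x i + v i) - f x) x"
    by (rule Cons.IH) (use Cons.prems in auto)
  finally show ?case by simp
qed simp

text \<open>An iterated difference is a finite combination of values, so linearity of the integral
  is enough; continuity supplies integrability at each step. Integrability of the result is recorded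
  for later comparison of integrals.\<close>

lemma diffs_integral:
  assumes "\<And>x. continuous_on {0..1} (\<lambda>t::real. g t x)"
  shows "(\<lambda>t. diffs vs (g t) x) integrable_on {0..1}"
    and "diffs vs (\<lambda>x. integral {0..1} (\<lambda>t. g t x)) x = integral {0..1} (\<lambda>t. diffs vs (g t) x)"
proof -
  have "(\<lambda>t. diffs vs (g t) x) integrable_on {0..1} \<and>
    diffs vs (\<lambda>x. integral {0..1} (\<lambda>t. g t x)) x = integral {0..1} (\<lambda>t. diffs vs (g t) x)"
    using assms
  proof (induction vs arbitrary: g x)
    case Nil
    then show ?case by (auto intro: integrable_continuous_real)
  next
    case (Cons v vs)
    have "integral {0..1} (\<lambda>t. g t (\<lambda>i. x i + v i)) - integral {0..1} (\<lambda>t. g t x) =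
        integral {0..1} (\<lambda>t. g t (\<lambda>i. x i + v i) - g t x)" for x
      by (rule integral_diff[symmetric]; rule integrable_continuous_real; rule Cons.prems)
    then show ?case
      using Cons.IH[of "\<lambda>t x. g t (\<lambda>i. x i + v i) - g t x" x] Cons.prems
      by (simp add: continuous_on_diff)
  qed
  then show "(\<lambda>t. diffs vs (g t) x) integrable_on {0..1}"
    "diffs vs (\<lambda>x. integral {0..1} (\<lambda>t. g t x)) x = integral {0..1} (\<lambda>t. diffs vs (g t) x)"
    by auto
qed

section \<open>Absolutely monotone functions of nonincreasing sequences\<close>

lemma abs_mono_shift:
  assumes "abs_mono f" "antimono v"
  shows "abs_mono (\<lambda>x. f (\<lambda>i. x i + v i))"
  using assms antimono_add unfolding abs_mono_def diffs_shift by blast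

lemma abs_mono_diff:
  assumes "abs_mono f" "antimono v"
  shows "abs_mono (\<lambda>x. f (\<lambda>i. x i + v i) - f x)"
  unfolding abs_mono_def
proof (intro allI impI)
  fix vs :: "(nat \<Rightarrow> real) list" and x assume "\<forall>v\<in>set vs. antimono v" "antimono (x :: nat \<Rightarrow> real)"
  then have "diffs (v # vs) f x \<ge> 0" using assms unfolding abs_mono_def by (metis set_ConsD)
  then show "diffs vs (\<lambda>x. f (\<lambda>i. x i + v i) - f x) x \<ge> 0" by simp
qed

text \<open>By the discrete product rule, a difference of \<open>l x * f x\<close> along
  \<open>v\<close> is \<open>l v\<close> times a shift of \<open>f\<close> plus \<open>l x\<close>
  times a difference of \<open>f\<close>. Shifts and differences of \<open>f\<close> are again
  \<open>abs_mono\<close>, so induction on the directions with \<open>f\<close> arbitrary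
  closes.\<close>

lemma abs_mono_linear_mult:
  assumes "abs_mono f"
    and add: "\<And>x y. l (\<lambda>i. x i + y i) = l x + l y" and nn: "\<And>x. antimono x \<Longrightarrow> l x \<ge> 0"
  shows "abs_mono (\<lambda>x. l x * f x)"
  unfolding abs_mono_def
proof (intro allI impI)
  fix vs :: "(nat \<Rightarrow> real) list" and x assume "\<forall>v\<in>set vs. antimono v" "antimono (x :: nat \<Rightarrow> real)"
  then show "diffs vs (\<lambda>x. l x * f x) x \<ge> 0" using assms(1)
  proof (induction vs arbitrary: f)
    case Nil
    then have "diffs [] f x \<ge> 0" unfolding abs_mono_def by blast
    then show ?case using Nil nn by simp
  next
    case (Cons v vs)
    have "l (\<lambda>i. x i + v i) * f (\<lambda>i. x i + v i) - l x * f x =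
      l v * f (\<lambda>i. x i + v i) + l x * (f (\<lambda>i. x i + v i) - f x)" for x
      by (simp add: add algebra_simps)
    then have "diffs (v # vs) (\<lambda>x. l x * f x) x = l v * diffs vs (\<lambda>x. f (\<lambda>i. x i + v i)) x
      + diffs vs (\<lambda>x. l x * (f (\<lambda>i. x i + v i) - f x)) x"
      by (simp add: diffs_add diffs_cmult)
    moreover have "diffs vs (\<lambda>x. f (\<lambda>i. x i + v i)) x \<ge> 0"
      using abs_mono_shift[of f v] Cons.prems unfolding abs_mono_def by simp
    moreover have "diffs vs (\<lambda>x. l x * (f (\<lambda>i. x i + v i) - f x)) x \<ge> 0"
      by (rule Cons.IH) (use Cons.prems abs_mono_diff in auto)
    ultimately show ?case using nn[of v] Cons.prems by simp
  qed
qed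

lemma squash_add: "squash k t (\<lambda>i. x i + y i) = (\<lambda>i. squash k t x i + squash k t y i)"
  by (auto simp: squash_def algebra_simps)

lemma diffs_perm_vol_integral:
  shows "(\<lambda>t. diffs (map (squash k t) vs) (perm_vol n) (squash k t x)) integrable_on {0..1}"
    and "diffs vs (\<lambda>x. integral {0..1} (\<lambda>t. perm_vol n (squash k t x))) x =
      integral {0..1} (\<lambda>t. diffs (map (squash k t) vs) (perm_vol n) (squash k t x))"
  using diffs_integral[of "\<lambda>t x. perm_vol n (squash k t x)" vs x, OF continuous_perm_vol_squash]
  unfolding diffs_compose[of "squash k t" for t, OF squash_add] by auto

text \<open>Under the integral the directions become \<open>squash k t v\<close>, which are still
  nonincreasing for \<open>t\<close> between 0 and 1, so the integrand is nonnegative.\<close>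

lemma abs_mono_perm_vol_term:
  assumes "abs_mono (perm_vol n)"
  shows "abs_mono (\<lambda>x. integral {0..1} (\<lambda>t. perm_vol n (squash k t x)))"
  unfolding abs_mono_def diffs_perm_vol_integral
proof (intro allI impI integral_nonneg diffs_perm_vol_integral)
  fix vs :: "(nat \<Rightarrow> real) list" and x t assume "\<forall>v\<in>set vs. antimono v" "antimono (x :: nat \<Rightarrow> real)" "t \<in> {0..1::real}"
  then show "diffs (map (squash k t) vs) (perm_vol n) (squash k t x) \<ge> 0"
    using assms unfolding abs_mono_def by (auto simp: antimono_squash)
qed

lemma antimono_diff_Suc: "antimono x \<Longrightarrow> x k - x (Suc k) \<ge> (0::real)"
  by (auto simp: antimono_def)

lemma abs_mono_perm_vol: "abs_mono (perm_vol n)"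
proof (induction n)
  case 0
  have "diffs vs (\<lambda>x. 1) x \<ge> 0" for vs x by (cases vs) (auto simp: diffs_zero)
  then show ?case by (simp add: abs_mono_def)
next
  case (Suc n)
  have *: "abs_mono (\<lambda>x. (x k - x (Suc k)) * integral {0..1} (\<lambda>t. perm_vol n (squash k t x)))" for k
    by (rule abs_mono_linear_mult) (use abs_mono_perm_vol_term[OF Suc] antimono_diff_Suc in auto)
  then show ?case
    by (auto simp: abs_mono_def diffs_sum intro!: sum_nonneg)
qed

text \<open>Every summand of the recursion contributes a nonnegative amount, and the summand
  \<open>k = 0\<close> alone contributes at least 1: the difference along \<open>weight 1\<close>
  consumes its factor \<open>x 0 - x (Suc 0)\<close>, and \<open>squash 0 t\<close> carries the
  other weights to the weights of one dimension less, for every \<open>t\<close>.\<close>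

lemma diffs_weights_perm_vol:
  assumes "antimono x"
  shows "diffs (map weight [1..<Suc n]) (perm_vol n) x \<ge> 1"
  using assms
proof (induction n arbitrary: x)
  case 0
  then show ?case by simp
next
  case (Suc n)
  define G where "G k x = integral {0..1} (\<lambda>t. perm_vol n (squash k t x))" for k x
  let ?vs = "map weight [1..<Suc (Suc n)]"
  define ws where "ws = map weight [2..<Suc (Suc n)]"
  have vs: "?vs = weight 1 # ws" unfolding ws_def
    by (subst upt_conv_Cons) (auto simp: numeral_2_eq_2)
  have anti: "\<forall>v\<in>set ?vs. antimono v" by (auto simp: antimono_weight)
  have termk: "diffs ?vs (\<lambda>x. (x k - x (Suc k)) * G k x) x \<ge> 0" for k
  proof -
    have "abs_mono (\<lambda>x. (x k - x (Suc k)) * G k x)" unfolding G_def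
      by (rule abs_mono_linear_mult) (use abs_mono_perm_vol_term abs_mono_perm_vol antimono_diff_Suc in auto)
    then show ?thesis using anti Suc.prems unfolding abs_mono_def by blast
  qed
  \<comment> \<open>For \<open>i > 0\<close> the first two entries of \<open>weight (Suc i)\<close>
    are both 1, so merging them gives 1 whatever \<open>t\<close> is.\<close>
  have sq: "squash 0 t (weight (Suc i)) = weight i" if "i > 0" for t i
    using that by (auto simp: squash_def weight_def)
  have "map (squash 0 t) ws = map weight [1..<Suc n]" for t
  proof -
    have "ws = map (\<lambda>i. weight (Suc i)) [1..<Suc n]"
      unfolding ws_def by (simp add: map_Suc_upt[symmetric] numeral_2_eq_2 del: upt_Suc)
    then show ?thesis using sq by auto
  qed
  then have lb: "diffs (map (squash 0 t) ws) (perm_vol n) (squash 0 t y) \<ge> 1"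
    if "antimono y" "t \<in> {0..1}" for t y
    using Suc.IH that by (simp add: antimono_squash)
  have G1: "diffs ws (G 0) y \<ge> 1" if "antimono y" for y
  proof -
    have "integral {0..1::real} (\<lambda>t. 1::real) \<le>
        integral {0..1} (\<lambda>t. diffs (map (squash 0 t) ws) (perm_vol n) (squash 0 t y))"
      by (rule integral_le) (use lb that diffs_perm_vol_integral(1) in auto)
    then show ?thesis unfolding G_def diffs_perm_vol_integral(2) by simp
  qed
  \<comment> \<open>Product rule for the first direction: \<open>weight 1\<close> raises
    \<open>x 0 - x (Suc 0)\<close> by exactly 1, which leaves one bare copy of the shifted
    \<open>G 0\<close>.\<close>
  have "diffs ?vs (\<lambda>x. (x 0 - x (Suc 0)) * G 0 x) x =
    diffs ws (\<lambda>x. G 0 (\<lambda>i. x i + weight 1 i)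
       + (x 0 - x (Suc 0)) * (G 0 (\<lambda>i. x i + weight 1 i) - G 0 x)) x"
    unfolding vs diffs.simps
    by (intro arg_cong2[where f="\<lambda>a b. diffs ws a b"]) (auto simp: weight_def algebra_simps)
  also have "\<dots> = diffs ws (G 0) (\<lambda>i. x i + weight 1 i)
      + diffs ws (\<lambda>x. (x 0 - x (Suc 0)) * (G 0 (\<lambda>i. x i + weight 1 i) - G 0 x)) x"
    by (simp only: diffs_add diffs_shift)
  also have "\<dots> \<ge> 1 + 0"
  proof (rule add_mono)
    show "1 \<le> diffs ws (G 0) (\<lambda>i. x i + weight 1 i)"
      by (intro G1 antimono_add Suc.prems antimono_weight)
    have "abs_mono (\<lambda>x. (x 0 - x (Suc 0)) * (G 0 (\<lambda>i. x i + weight 1 i) - G 0 x))"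
    proof (rule abs_mono_linear_mult)
      show "abs_mono (\<lambda>x. G 0 (\<lambda>i. x i + weight 1 i) - G 0 x)"
        unfolding G_def by (intro abs_mono_diff abs_mono_perm_vol_term abs_mono_perm_vol antimono_weight)
    qed (use antimono_diff_Suc in auto)
    then show "0 \<le> diffs ws (\<lambda>x. (x 0 - x (Suc 0)) * (G 0 (\<lambda>i. x i + weight 1 i) - G 0 x)) x"
      using anti Suc.prems unfolding abs_mono_def vs by simp
  qed
  finally have t0: "diffs ?vs (\<lambda>x. (x 0 - x (Suc 0)) * G 0 x) x \<ge> 1" by simp
  have "diffs ?vs (perm_vol (Suc n)) x = (\<Sum>k\<le>n. diffs ?vs (\<lambda>x. (x k - x (Suc k)) * G k x) x)"
    unfolding perm_vol.simps G_def by (rule diffs_sum)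
  also have "\<dots> \<ge> diffs ?vs (\<lambda>x. (x 0 - x (Suc 0)) * G 0 x) x"
    by (rule member_le_sum[of 0]) (use termk in auto)
  finally show ?case using t0 by simp
qed

lemma perm_vol_cong:
  assumes "\<And>i. i \<le> n \<Longrightarrow> x i = y i"
  shows "perm_vol n x = perm_vol n y"
  using assms
proof (induction n arbitrary: x y)
  case (Suc n)
  have "perm_vol n (squash k t x) = perm_vol n (squash k t y)" if "k \<le> n" for k t
    by (rule Suc.IH) (use Suc.prems that in \<open>auto simp: squash_def\<close>)
  then show ?case using Suc.prems by (auto intro!: sum.cong)
qed simp

lemma perm_vol_add_const: "perm_vol n (\<lambda>i. x i + c) = perm_vol n x"
proof (induction n arbitrary: x)
  case (Suc n)
  have "squash k t (\<lambda>i. x i + c) = (\<lambda>i. squash k t x i + c)" for k t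
    by (auto simp: squash_def algebra_simps)
  then show ?case by (simp add: Suc)
qed simp

lemma perm_vol_nonneg: "antimono x \<Longrightarrow> perm_vol n x \<ge> 0"
  using abs_mono_perm_vol[of n] unfolding abs_mono_def
  by (metis diffs.simps(1) empty_iff empty_set)

section \<open>Volumes of permutohedra\<close>

definition psum :: "(nat \<Rightarrow> real) \<Rightarrow> nat \<Rightarrow> real"
  where "psum x k = (\<Sum>i<k. x i)"

text \<open>
  The permutohedron of \<open>x 0, \<dots>, x n\<close> with \<open>n = card J\<close>, in the coordinates \<open>J\<close> that remain when one
  coordinate is eliminated by the condition on the total sum. The lower bounds are the upper bounds for
  the complementary sets, which contain the eliminated coordinate.
\<close>

definition perm_body :: "'a set \<Rightarrow> (nat \<Rightarrow> real) \<Rightarrow> ('a \<Rightarrow> real) set"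
  where "perm_body J x = {z \<in> J \<rightarrow>\<^sub>E UNIV. \<forall>A\<subseteq>J.
    psum x (Suc (card J)) - psum x (Suc (card J) - card A) \<le> sum z A \<and> sum z A \<le> psum x (card A)}"

text \<open>Fixing one coordinate at \<open>s\<close> leaves two upper bounds for a set of size
  \<open>k\<close> of the others: one for the set alone, one for the set with the fixed coordinate
  added. Their minimum is the new partial sum, and \<open>slice\<close> consists of its increments.
  One formula serves all gaps in which \<open>s\<close> may lie and is continuous in
  \<open>s\<close>.\<close>

definition slice :: "real \<Rightarrow> (nat \<Rightarrow> real) \<Rightarrow> nat \<Rightarrow> real"
  where "slice s x = (\<lambda>i. min (psum x (Suc i)) (psum x (Suc (Suc i)) - s) - min (psum x i) (psum x (Suc i) - s))"

lemma psum_Suc: "psum x (Suc k) = psum x k + x k"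
  by (simp add: psum_def)

lemma psum_0: "psum x 0 = 0"
  by (simp add: psum_def)

lemma psum_slice: "psum (slice s x) k = min (psum x k) (psum x (Suc k) - s) - min 0 (x 0 - s)"
  by (induction k) (auto simp: psum_Suc psum_0 slice_def)

text \<open>The two arguments of the minimum at index \<open>a\<close> differ by
  \<open>x a - s\<close>, so the minimum switches from one to the other between \<open>k\<close> and
  \<open>Suc k\<close>.\<close>

lemma slice_eq_squash:
  assumes "antimono x" "x (Suc k) \<le> s" "s \<le> x k" "s = x (Suc k) + t * (x k - x (Suc k))"
  shows "slice s x = squash k t x"
proof
  fix i
  have D: "x j \<le> x i" if "i \<le> j" for i j using assms(1) that by (auto simp: antimono_def)
  have lo: "min (psum x a) (psum x (Suc a) - s) = psum x a" if "a \<le> k" for a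
    using D[OF that] assms(3) by (simp add: psum_Suc)
  have hi: "min (psum x a) (psum x (Suc a) - s) = psum x (Suc a) - s" if "a \<ge> Suc k" for a
    using D[OF that] assms(2) by (simp add: psum_Suc)
  consider "i < k" | "i = k" | "i > k" by linarith
  then show "slice s x i = squash k t x i"
  proof cases
    case 1
    then show ?thesis unfolding slice_def using lo[of i] lo[of "Suc i"]
      by (simp add: squash_def) (simp add: psum_Suc)
  next
    case 2
    then show ?thesis unfolding slice_def using lo[of i] hi[of "Suc i"]
      by (simp add: squash_def) (simp add: psum_Suc assms(4) algebra_simps)
  next
    case 3
    then show ?thesis unfolding slice_def using hi[of i] hi[of "Suc i"]
      by (simp add: squash_def) (simp add: psum_Suc)
  qed
qed

lemma slice_antimono:
  assumes "antimono x" "x (Suc n) \<le> s" "s \<le> x 0"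
  shows "antimono (slice s x)"
proof -
  \<comment> \<open>The gap of \<open>x\<close> that contains \<open>s\<close>; the hypothesis at
    \<open>n\<close> shows that such an index exists.\<close>
  define k where "k = (LEAST k. x (Suc k) \<le> s)"
  have k: "x (Suc k) \<le> s" unfolding k_def by (rule LeastI) (rule assms(2))
  have k': "s \<le> x k"
  proof (cases k)
    case (Suc m)
    then have "\<not> x (Suc m) \<le> s" using not_less_Least[of m "\<lambda>k. x (Suc k) \<le> s"] by (simp add: k_def)
    then show ?thesis using Suc by simp
  qed (use assms in simp)
  show ?thesis
  \<comment> \<open>In a gap of length zero the quotient defining \<open>t\<close> is meaningless,
    but every \<open>t\<close> gives the same sequence, so 0 will do.\<close>
  proof (cases "x k = x (Suc k)")
    case True
    then have "slice s x = squash k 0 x" using k k' by (intro slice_eq_squash assms) auto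
    then show ?thesis using antimono_squash[OF assms(1), of 0] by simp
  next
    case False
    define t where "t = (s - x (Suc k)) / (x k - x (Suc k))"
    have "slice s x = squash k t x"
      using False by (intro slice_eq_squash assms k k') (simp add: t_def)
    moreover have "0 \<le> t" "t \<le> 1" using k k' False by (auto simp: t_def divide_simps)
    ultimately show ?thesis using antimono_squash[OF assms(1)] by simp
  qed
qed

lemma continuous_perm_vol_slice: "continuous_on S (\<lambda>s. perm_vol n (slice s x))"
proof -
  have "continuous_on S (\<lambda>s. slice s x)"
    unfolding slice_def by (intro continuous_on_coordinatewise_then_product continuous_intros)
  from continuous_on_compose2[OF continuous_perm_vol this] show ?thesis by simp
qed

text \<open>The interval is cut at the entries of \<open>x\<close>, and each gap is parametrized
  affinely by \<open>t\<close>; the length of the gap is the Jacobian. A gap of length zero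
  contributes 0 on both sides.\<close>

lemma integral_perm_vol_slice:
  assumes "antimono x"
  shows "integral {x m..x 0} (\<lambda>s. perm_vol n (slice s x)) =
    (\<Sum>k<m. (x k - x (Suc k)) * integral {0..1} (\<lambda>t. perm_vol n (squash k t x)))"
proof (induction m)
  case (Suc m)
  let ?h = "\<lambda>s. perm_vol n (slice s x)"
  have D: "x (Suc m) \<le> x m" "x m \<le> x 0" using assms by (auto simp: antimono_def)
  have int: "?h integrable_on {a..b}" for a b
    by (rule integrable_continuous_real[OF continuous_perm_vol_slice])
  have "integral {x (Suc m)..x m} ?h = (x m - x (Suc m)) * integral {0..1} (\<lambda>t. perm_vol n (squash m t x))"
  proof (cases "x m = x (Suc m)")
    case False
    define d where "d = x m - x (Suc m)"
    have d: "d > 0" using False D by (simp add: d_def)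
    have "((\<lambda>t. ?h (d *\<^sub>R t + x (Suc m))) has_integral (integral {x (Suc m)..x m} ?h /\<^sub>R d ^ DIM(real)))
        (cbox ((x (Suc m) - x (Suc m)) /\<^sub>R d) ((x m - x (Suc m)) /\<^sub>R d))"
      by (rule has_integral_affinity') (use int d in \<open>auto intro: integrable_integral\<close>)
    then have "((\<lambda>t. ?h (d * t + x (Suc m))) has_integral (integral {x (Suc m)..x m} ?h / d)) {0..1}"
      using d by (simp add: d_def[symmetric] divide_inverse_commute)
    then have "integral {0..1} (\<lambda>t. ?h (d * t + x (Suc m))) = integral {x (Suc m)..x m} ?h / d"
      by (rule integral_unique)
    moreover have "integral {0..1} (\<lambda>t. ?h (d * t + x (Suc m))) = integral {0..1} (\<lambda>t. perm_vol n (squash m t x))"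
    proof (rule integral_cong)
      fix t :: real assume t: "t \<in> {0..1}"
      then have "d * t \<ge> 0" "d * t \<le> d" using d by (auto simp: mult_left_le)
      then show "?h (d * t + x (Suc m)) = perm_vol n (squash m t x)"
        by (intro arg_cong[where f="perm_vol n"] slice_eq_squash assms) (auto simp: d_def algebra_simps)
    qed
    ultimately show ?thesis using d by (simp add: d_def field_simps)
  qed simp
  moreover have "integral {x (Suc m)..x 0} ?h = integral {x (Suc m)..x m} ?h + integral {x m..x 0} ?h"
    using Henstock_Kurzweil_Integration.integral_combine[OF D int] by simp
  ultimately show ?case using Suc by simp
qed simp

lemma sets_perm_body: "finite J \<Longrightarrow> perm_body J x \<in> sets (PiM J (\<lambda>_. lborel))"
proof -
  assume J: "finite J"
  have "perm_body J x = {z \<in> space (PiM J (\<lambda>_. lborel)). \<forall>A\<in>Pow J.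
    psum x (Suc (card J)) - psum x (Suc (card J) - card A) \<le> sum z A \<and> sum z A \<le> psum x (card A)}"
    by (auto simp: perm_body_def space_PiM)
  also have "\<dots> \<in> sets (PiM J (\<lambda>_. lborel))"
  proof (rule sets.sets_Collect_finite_All)
    fix A assume "A \<in> Pow J"
    then have "(\<lambda>z. sum z A) \<in> borel_measurable (PiM J (\<lambda>_. lborel))"
      by (intro borel_measurable_sum) (auto intro: measurable_component_singleton)
    then show "{z \<in> space (PiM J (\<lambda>_. lborel)). psum x (Suc (card J)) - psum x (Suc (card J) - card A) \<le> sum z A
        \<and> sum z A \<le> psum x (card A)} \<in> sets (PiM J (\<lambda>_. lborel))"
      by measurable
  qed (use J in auto)
  finally show ?thesis .
qed

text \<open>Subsets of \<open>insert j J\<close> come in pairs \<open>A\<close>,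
  \<open>insert j A\<close>. The two upper bounds that a pair puts on the sum over \<open>A\<close>
  merge into a partial sum of \<open>slice s x\<close>, and likewise the lower ones; the pair with
  \<open>A\<close> empty gives the range of \<open>s\<close>.\<close>

lemma perm_body_insert:
  assumes "finite J" "j \<notin> J" "z \<in> J \<rightarrow>\<^sub>E UNIV"
  shows "z(j := s) \<in> perm_body (insert j J) x \<longleftrightarrow>
    x (Suc (card J)) \<le> s \<and> s \<le> x 0 \<and> z \<in> perm_body J (slice s x)" (is "?L \<longleftrightarrow> ?R")
proof -
  let ?n = "card J"
  have fin: "finite A" if "A \<subseteq> J" for A using that assms(1) finite_subset by blast
  have cn: "card A \<le> ?n" if "A \<subseteq> J" for A using that assms(1) card_mono by blast
  have s1: "sum (z(j := s)) A = sum z A" if "A \<subseteq> J" for A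
    using that assms(2) by (intro sum.cong) auto
  have s2: "sum (z(j := s)) (insert j A) = s + sum z A" "card (insert j A) = Suc (card A)" if "A \<subseteq> J" for A
  proof -
    have "j \<notin> A" using assms(2) that by auto
    then show "sum (z(j := s)) (insert j A) = s + sum z A" "card (insert j A) = Suc (card A)"
      using fin[OF that] s1[OF that] by (simp_all del: fun_upd_apply, simp)
  qed
  have Pinsert: "(\<forall>A\<subseteq>insert j J. P A) \<longleftrightarrow> (\<forall>A\<subseteq>J. P A \<and> P (insert j A))" for P
  proof (intro iffI allI impI)
    fix A assume *: "\<forall>A\<subseteq>J. P A \<and> P (insert j A)" and "A \<subseteq> insert j J"
    then have "A - {j} \<subseteq> J" by auto
    with * have "P (A - {j})" "P (insert j (A - {j}))" by blast+
    moreover have "A = A - {j} \<or> A = insert j (A - {j})" by auto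
    ultimately show "P A" by metis
  next
    fix A assume *: "\<forall>A\<subseteq>insert j J. P A" and A: "A \<subseteq> J"
    then have "A \<subseteq> insert j J" "insert j A \<subseteq> insert j J" by auto
    with * show "P A \<and> P (insert j A)" by blast
  qed
  have PiE: "z(j := s) \<in> insert j J \<rightarrow>\<^sub>E UNIV" using assms(3) by (auto simp: PiE_def extensional_def)
  have L: "?L \<longleftrightarrow> (\<forall>A\<subseteq>J. (psum x (Suc (Suc ?n)) - psum x (Suc (Suc ?n) - card A) \<le> sum z A \<and> sum z A \<le> psum x (card A))
     \<and> (psum x (Suc (Suc ?n)) - psum x (Suc ?n - card A) \<le> s + sum z A \<and> s + sum z A \<le> psum x (Suc (card A))))"
    using PiE assms(1,2) unfolding perm_body_def by (simp add: Pinsert s1 s2 cong: conj_cong del: fun_upd_apply)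
  have R: "z \<in> perm_body J (slice s x) \<longleftrightarrow> (\<forall>A\<subseteq>J. (psum x (Suc (Suc ?n)) - psum x (Suc (Suc ?n) - card A) \<le> sum z A \<and> sum z A \<le> psum x (card A))
     \<and> (psum x (Suc (Suc ?n)) - psum x (Suc ?n - card A) \<le> s + sum z A \<and> s + sum z A \<le> psum x (Suc (card A))))"
    if "x (Suc ?n) \<le> s" "s \<le> x 0"
  proof -
    have 1: "min (psum x (Suc ?n)) (psum x (Suc (Suc ?n)) - s) = psum x (Suc (Suc ?n)) - s"
      using that by (simp add: psum_Suc)
    have "(psum (slice s x) (Suc ?n) - psum (slice s x) (Suc ?n - card A) \<le> sum z A \<and> sum z A \<le> psum (slice s x) (card A))
      \<longleftrightarrow> (psum x (Suc (Suc ?n)) - psum x (Suc (Suc ?n) - card A) \<le> sum z A \<and> sum z A \<le> psum x (card A))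
     \<and> (psum x (Suc (Suc ?n)) - psum x (Suc ?n - card A) \<le> s + sum z A \<and> s + sum z A \<le> psum x (Suc (card A)))"
      if "A \<subseteq> J" for A
    proof -
      have "Suc (Suc ?n) - card A = Suc (Suc ?n - card A)" using cn[OF that] by simp
      then show ?thesis using \<open>s \<le> x 0\<close> by (simp only: psum_slice 1) (auto simp: min_def)
    qed
    then show ?thesis using assms(3) unfolding perm_body_def by auto
  qed
  show ?thesis
  proof (cases "x (Suc ?n) \<le> s \<and> s \<le> x 0")
    case True
    then show ?thesis using L R by simp
  next
    case False
    have "\<not> ?L"
    proof
      assume ?L
      then have "psum x (Suc (Suc ?n)) - psum x (Suc ?n) \<le> s \<and> s \<le> psum x (Suc 0)"
        unfolding L by (metis card.empty diff_zero empty_subsetI sum.empty add.right_neutral)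
      then show False using False by (simp add: psum_Suc psum_0)
    qed
    then show ?thesis using False by blast
  qed
qed

text \<open>Fubini in the inserted coordinate identifies the recursion with Lebesgue measure;
  outside the interval from \<open>x (Suc n)\<close> to \<open>x 0\<close>, with
  \<open>n = card J\<close>, the slice is empty.\<close>

lemma emeasure_perm_body:
  assumes "finite J" "antimono x"
  shows "emeasure (PiM J (\<lambda>_. lborel)) (perm_body J x) = ennreal (perm_vol (card J) x)"
  using assms
proof (induction J arbitrary: x rule: finite_induct)
  case empty
  have "perm_body {} x = {\<lambda>_::'a. undefined :: real}" by (auto simp: perm_body_def psum_0)
  then show ?case by (simp add: PiM_empty)
next
  case (insert j J)
  interpret product_sigma_finite "\<lambda>_. lborel :: real measure" ..
  let ?n = "card J" and ?M = "\<lambda>J. PiM J (\<lambda>_. lborel :: real measure)"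
  have [measurable]: "perm_body (insert j J) x \<in> sets (?M (insert j J))" using insert by (intro sets_perm_body) auto
  have "emeasure (?M (insert j J)) (perm_body (insert j J) x) =
      (\<integral>\<^sup>+z. indicator (perm_body (insert j J) x) z \<partial>?M (insert j J))"
    by simp
  also have "\<dots> = (\<integral>\<^sup>+s. (\<integral>\<^sup>+z. indicator (perm_body (insert j J) x) (z(j := s)) \<partial>?M J) \<partial>lborel)"
    using insert by (intro product_nn_integral_insert_rev) auto
  also have "\<dots> = (\<integral>\<^sup>+s. ennreal (perm_vol ?n (slice s x)) * indicator {x (Suc ?n)..x 0} s \<partial>lborel)"
  proof (rule nn_integral_cong)
    fix s
    show "(\<integral>\<^sup>+z. indicator (perm_body (insert j J) x) (z(j := s)) \<partial>?M J) =
        ennreal (perm_vol ?n (slice s x)) * indicator {x (Suc ?n)..x 0} s"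
    proof (cases "s \<in> {x (Suc ?n)..x 0}")
      case True
      have "(\<integral>\<^sup>+z. indicator (perm_body (insert j J) x) (z(j := s)) \<partial>?M J) =
          (\<integral>\<^sup>+z. indicator (perm_body J (slice s x)) z \<partial>?M J)"
        using True perm_body_insert[OF insert(1,2)]
        by (intro nn_integral_cong) (auto simp: space_PiM indicator_def)
      also have "\<dots> = emeasure (?M J) (perm_body J (slice s x))"
        using sets_perm_body[OF insert(1)] by simp
      also have "\<dots> = ennreal (perm_vol ?n (slice s x))"
        using True insert by (intro insert.IH slice_antimono[where n="?n"]) auto
      finally show ?thesis using True by simp
    next
      case False
      have "(\<integral>\<^sup>+z. indicator (perm_body (insert j J) x) (z(j := s)) \<partial>?M J) = (\<integral>\<^sup>+z. 0 \<partial>?M J)"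
        using False perm_body_insert[OF insert(1,2)]
        by (intro nn_integral_cong) (auto simp: space_PiM indicator_def)
      then show ?thesis using False by simp
    qed
  qed
  also have "\<dots> = ennreal (integral {x (Suc ?n)..x 0} (\<lambda>s. perm_vol ?n (slice s x)))"
    using insert.prems slice_antimono
    by (intro nn_integral_has_integral_lebesgue' integrable_integral
      integrable_continuous_real continuous_perm_vol_slice perm_vol_nonneg) auto
  also have "\<dots> = ennreal (perm_vol (card (insert j J)) x)"
    using insert by (simp add: integral_perm_vol_slice lessThan_Suc_atMost)
  finally show ?case .
qed

section \<open>Lebesgue measure on finite products\<close>

text \<open>To be applied to a face, which is a product of smaller permutohedra. One block at a time
  is split off by \<open>merge\<close>; measurability is part of the claim because the induction
  step uses it for the remaining blocks.\<close>

lemma emeasure_PiM_blocks: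
  fixes J :: "'c \<Rightarrow> 'a set"
  assumes "finite K" "\<And>c. c \<in> K \<Longrightarrow> finite (J c)" "disjoint_family_on J K"
    and "\<And>c. c \<in> K \<Longrightarrow> X c \<in> sets (PiM (J c) (\<lambda>_. lborel :: real measure))"
  shows "{z \<in> (\<Union>c\<in>K. J c) \<rightarrow>\<^sub>E UNIV. \<forall>c\<in>K. restrict z (J c) \<in> X c} \<in> sets (PiM (\<Union>c\<in>K. J c) (\<lambda>_. lborel))
    \<and> emeasure (PiM (\<Union>c\<in>K. J c) (\<lambda>_. lborel))
      {z \<in> (\<Union>c\<in>K. J c) \<rightarrow>\<^sub>E UNIV. \<forall>c\<in>K. restrict z (J c) \<in> X c} =
    (\<Prod>c\<in>K. emeasure (PiM (J c) (\<lambda>_. lborel)) (X c))"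
  using assms
proof (induction K rule: finite_induct)
  case empty
  have "{z \<in> {} \<rightarrow>\<^sub>E UNIV. True} = {\<lambda>_::'a. undefined :: real}" by auto
  then show ?case by (simp add: PiM_empty)
next
  case (insert c K)
  interpret product_sigma_finite "\<lambda>_. lborel :: real measure" ..
  let ?M = "\<lambda>I. PiM I (\<lambda>_. lborel :: real measure)"
  define U where "U = (\<Union>c\<in>K. J c)"
  define Y where "Y = {z \<in> U \<rightarrow>\<^sub>E UNIV. \<forall>c\<in>K. restrict z (J c) \<in> X c}"
  define S where "S = {z \<in> (J c \<union> U) \<rightarrow>\<^sub>E UNIV. \<forall>c\<in>insert c K. restrict z (J c) \<in> X c}"
  have fin: "finite (J c)" "finite U" using insert.prems insert.hyps by (auto simp: U_def)
  have disj: "J c \<inter> U = {}" using insert.prems(2) insert.hyps by (auto simp: U_def disjoint_family_on_def)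
  have IH: "Y \<in> sets (?M U)" "emeasure (?M U) Y = (\<Prod>c\<in>K. emeasure (?M (J c)) (X c))"
  proof -
    have "disjoint_family_on J K" using insert.prems(2) by (auto simp: disjoint_family_on_def)
    from insert.IH[OF insert.prems(1) this insert.prems(3)]
    show "Y \<in> sets (?M U)" "emeasure (?M U) Y = (\<Prod>c\<in>K. emeasure (?M (J c)) (X c))"
      unfolding Y_def U_def by (simp_all only: insertI2 simp_thms)
  qed
  have Xc: "X c \<in> sets (?M (J c))" using insert.prems by auto
  have Smeas: "S \<in> sets (?M (J c \<union> U))"
  proof -
    have "S = {z \<in> space (?M (J c \<union> U)). \<forall>c\<in>insert c K. restrict z (J c) \<in> X c}"
      by (auto simp: S_def space_PiM)
    also have "\<dots> \<in> sets (?M (J c \<union> U))"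
    proof (rule sets.sets_Collect_finite_All)
      fix d assume d: "d \<in> insert c K"
      have "(\<lambda>z. restrict z (J d)) \<in> measurable (?M (J c \<union> U)) (?M (J d))"
        using d by (intro measurable_restrict_subset) (auto simp: U_def)
      moreover have "X d \<in> sets (?M (J d))" using d insert.prems by auto
      ultimately show "{z \<in> space (?M (J c \<union> U)). restrict z (J d) \<in> X d} \<in> sets (?M (J c \<union> U))"
        using measurable_sets[of "\<lambda>z. restrict z (J d)" "?M (J c \<union> U)" "?M (J d)" "X d"]
        by (simp add: vimage_def Int_def conj_commute)
    qed (use insert in auto)
    finally show ?thesis .
  qed
  have 1: "(merge (J c) U :: ('a \<Rightarrow> real) \<times> ('a \<Rightarrow> real) \<Rightarrow> 'a \<Rightarrow> real) -` S \<inter> space (?M (J c) \<Otimes>\<^sub>M ?M U) = X c \<times> Y"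
  proof -
    have r1: "restrict (merge (J c) U (a, b)) (J c) = a" if "a \<in> J c \<rightarrow>\<^sub>E UNIV" for a b :: "'a \<Rightarrow> real"
      using disj by (simp only: restrict_merge PiE_restrict[OF that])
    have r2: "restrict (merge (J c) U (a, b)) (J d) = restrict b (J d)" if "d \<in> K" for a b :: "'a \<Rightarrow> real" and d
    proof -
      have "i \<notin> J c \<and> i \<in> U" if "i \<in> J d" for i using disj \<open>d \<in> K\<close> that unfolding U_def by blast
      then show ?thesis by (intro restrict_ext) (simp add: merge_def)
    qed
    have sub: "X c \<subseteq> J c \<rightarrow>\<^sub>E UNIV" using sets.sets_into_space[OF Xc] by (auto simp: space_PiM)
    have m: "merge (J c) U (a, b) \<in> (J c \<union> U) \<rightarrow>\<^sub>E UNIV" for a b :: "'a \<Rightarrow> real"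
      by (auto simp: merge_def PiE_def extensional_def)
    have "merge (J c) U (a, b) \<in> S \<longleftrightarrow> a \<in> X c \<and> b \<in> Y"
      if "a \<in> J c \<rightarrow>\<^sub>E UNIV" "b \<in> U \<rightarrow>\<^sub>E UNIV" for a b
      using that m[of a b] unfolding S_def Y_def by (simp only: mem_Collect_eq ball_simps r1 r2 cong: ball_cong) simp
    moreover have "Y \<subseteq> U \<rightarrow>\<^sub>E UNIV" unfolding Y_def by blast
    ultimately show ?thesis using sub by (force simp: space_pair_measure space_PiM)
  qed
  have "emeasure (?M (J c \<union> U)) S = emeasure (distr (?M (J c) \<Otimes>\<^sub>M ?M U) (?M (J c \<union> U)) (merge (J c) U)) S"
    using distr_merge[OF disj fin] by simp
  also have "\<dots> = emeasure (?M (J c) \<Otimes>\<^sub>M ?M U) (X c \<times> Y)"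
    using Smeas by (subst emeasure_distr) (auto simp: 1)
  also have "\<dots> = emeasure (?M (J c)) (X c) * emeasure (?M U) Y"
    using sigma_finite_measure.emeasure_pair_measure_Times[OF sigma_finite[OF fin(2)] Xc IH(1)] by simp
  also have "\<dots> = (\<Prod>d\<in>insert c K. emeasure (?M (J d)) (X d))"
    using insert.hyps by (simp only: IH(2) prod.insert not_False_eq_True)
  finally show ?case using Smeas unfolding S_def U_def UN_insert by blast
qed

text \<open>Covers translations and reflections at once. It suffices to compare the measures of
  boxes, where both sides factor over the coordinates.\<close>

lemma distr_PiM_lborel:
  fixes g :: "'a \<Rightarrow> real \<Rightarrow> real"
  assumes "finite I" and g: "\<And>i. i \<in> I \<Longrightarrow> g i \<in> borel_measurable borel \<and> distr lborel borel (g i) = lborel"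
  shows "(\<lambda>z. \<lambda>i\<in>I. g i (z i)) \<in> measurable (PiM I (\<lambda>_. lborel)) (PiM I (\<lambda>_. lborel))"
    and "distr (PiM I (\<lambda>_. lborel)) (PiM I (\<lambda>_. lborel)) (\<lambda>z. \<lambda>i\<in>I. g i (z i)) = PiM I (\<lambda>_. lborel :: real measure)"
proof -
  interpret product_sigma_finite "\<lambda>_. lborel :: real measure" ..
  let ?M = "PiM I (\<lambda>_. lborel :: real measure)" and ?T = "\<lambda>z. \<lambda>i\<in>I. g i (z i)"
  show T: "?T \<in> measurable ?M ?M"
  proof (rule measurable_restrict)
    fix i assume "i \<in> I"
    then show "(\<lambda>z. g i (z i)) \<in> measurable ?M lborel"
      using g measurable_compose[OF measurable_component_singleton[of i I "\<lambda>_. lborel"], of "g i" lborel] by auto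
  qed
  show "distr ?M ?M ?T = ?M"
  proof (rule PiM_eqI)
    fix A :: "'a \<Rightarrow> real set" assume A: "\<And>i. i \<in> I \<Longrightarrow> A i \<in> sets lborel"
    have "emeasure (distr ?M ?M ?T) (Pi\<^sub>E I A) = emeasure ?M (?T -` Pi\<^sub>E I A \<inter> space ?M)"
      using A assms(1) by (intro emeasure_distr T sets_PiM_I_finite) auto
    also have "?T -` Pi\<^sub>E I A \<inter> space ?M = Pi\<^sub>E I (\<lambda>i. g i -` A i)"
      by (auto simp: space_PiM PiE_def Pi_def)
    also have "emeasure ?M \<dots> = (\<Prod>i\<in>I. emeasure lborel (g i -` A i))"
      using A g assms(1) by (intro emeasure_PiM) (auto intro: measurable_sets_borel)
    also have "\<dots> = (\<Prod>i\<in>I. emeasure lborel (A i))"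
    proof (rule prod.cong)
      fix i assume i: "i \<in> I"
      have "emeasure lborel (A i) = emeasure (distr lborel borel (g i)) (A i)" using g i by simp
      also have "\<dots> = emeasure lborel (g i -` A i)" using A g i by (subst emeasure_distr) auto
      finally show "emeasure lborel (g i -` A i) = emeasure lborel (A i)" by simp
    qed simp
    finally show "emeasure (distr ?M ?M ?T) (Pi\<^sub>E I A) = (\<Prod>i\<in>I. emeasure lborel (A i))" .
  qed (use assms in auto)
qed

lemma nn_integral_PiM_translate:
  assumes "finite I" "f \<in> borel_measurable (PiM I (\<lambda>_. lborel :: real measure))"
  shows "(\<integral>\<^sup>+z. f (\<lambda>i\<in>I. z i + w i) \<partial>PiM I (\<lambda>_. lborel)) = (\<integral>\<^sup>+z. f z \<partial>PiM I (\<lambda>_. lborel))"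
proof -
  have g: "(\<lambda>t. t + w i) \<in> borel_measurable borel \<and> distr lborel borel (\<lambda>t. t + w i) = lborel" for i
  proof -
    have "(\<lambda>t. t + w i) = (+) (w i)" by auto
    then show ?thesis using lborel_distr_plus[of "w i"] by simp
  qed
  note T = distr_PiM_lborel[OF assms(1), of "\<lambda>i t. t + w i", OF g]
  show ?thesis using nn_integral_distr[OF T(1), of f] assms(2) by (simp add: T(2))
qed

lemma nn_integral_PiM_reflect:
  assumes "finite I" "f \<in> borel_measurable (PiM I (\<lambda>_. lborel :: real measure))"
  shows "(\<integral>\<^sup>+z. f (\<lambda>i\<in>I. w i - z i) \<partial>PiM I (\<lambda>_. lborel)) = (\<integral>\<^sup>+z. f z \<partial>PiM I (\<lambda>_. lborel))"
proof -
  have g: "(\<lambda>t. w i - t) \<in> borel_measurable borel \<and> distr lborel borel (\<lambda>t. w i - t) = lborel" for i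
    using lborel_real_affine[of "-1" "w i", symmetric] by (simp add: density_1)
  note T = distr_PiM_lborel[OF assms(1), of "\<lambda>i t. w i - t", OF g]
  show ?thesis using nn_integral_distr[OF T(1), of f] assms(2) by (simp add: T(2))
qed

text \<open>
  This is the uniqueness of Haar measure: both sides of \<open>key\<close> in the proof are the integral over
  \<open>(c, z)\<close> of the indicator of \<open>T c \<in> A\<close> and \<open>z \<in> Q\<close>, by the translation \<open>z \<mapsto> z + T c\<close>, then
  \<open>c \<mapsto> c - S z\<close>, and a reflection.
\<close>

lemma PiM_linear_image:
  assumes fin: "finite B" "finite E"
    and T: "T \<in> measurable (PiM B (\<lambda>_. lborel :: real measure)) (PiM E (\<lambda>_. lborel :: real measure))"
    and S: "S \<in> measurable (PiM E (\<lambda>_. lborel :: real measure)) (PiM B (\<lambda>_. lborel :: real measure))"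
    and ST: "\<And>c. c \<in> B \<rightarrow>\<^sub>E UNIV \<Longrightarrow> S (T c) = c" and TS: "\<And>z. z \<in> E \<rightarrow>\<^sub>E UNIV \<Longrightarrow> T (S z) = z"
    and add: "\<And>c w. c \<in> B \<rightarrow>\<^sub>E UNIV \<Longrightarrow> w \<in> B \<rightarrow>\<^sub>E UNIV \<Longrightarrow>
      T (\<lambda>i\<in>B. c i + w i) = (\<lambda>i\<in>E. T c i + T w i)"
  obtains \<kappa> :: real where "\<kappa> > 0"
    "\<And>A. A \<in> sets (PiM E (\<lambda>_. lborel)) \<Longrightarrow>
      measure (PiM B (\<lambda>_. lborel)) (T -` A \<inter> (B \<rightarrow>\<^sub>E UNIV)) = \<kappa> * measure (PiM E (\<lambda>_. lborel)) A"
proof -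
  interpret product_sigma_finite "\<lambda>_. lborel :: real measure" ..
  let ?B = "PiM B (\<lambda>_. lborel :: real measure)" and ?E = "PiM E (\<lambda>_. lborel :: real measure)"
  interpret B: sigma_finite_measure ?B by (rule sigma_finite[OF fin(1)])
  interpret E: sigma_finite_measure ?E by (rule sigma_finite[OF fin(2)])
  interpret BE: pair_sigma_finite ?B ?E ..
  note T[measurable]
  have TE: "T c \<in> E \<rightarrow>\<^sub>E UNIV" if "c \<in> B \<rightarrow>\<^sub>E UNIV" for c
    using measurable_space[OF T] that by (simp add: space_PiM)
  have SB: "S z \<in> B \<rightarrow>\<^sub>E UNIV" if "z \<in> E \<rightarrow>\<^sub>E UNIV" for z
    using measurable_space[OF S] that by (simp add: space_PiM)
  define P where "P A = T -` A \<inter> (B \<rightarrow>\<^sub>E UNIV)" for A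
  have PB: "P A = T -` A \<inter> space ?B" for A by (simp add: P_def space_PiM)
  have Pm: "P A \<in> sets ?B" if "A \<in> sets ?E" for A unfolding PB using that T by measurable
  have [measurable]: "(\<lambda>p. T (fst p) i) \<in> borel_measurable (?B \<Otimes>\<^sub>M ?E)" "(\<lambda>c. T c i) \<in> borel_measurable ?B"
    if "i \<in> E" for i
  proof -
    show *: "(\<lambda>c. T c i) \<in> borel_measurable ?B"
      using measurable_compose[OF T measurable_component_singleton[OF that]] by simp
    show "(\<lambda>p. T (fst p) i) \<in> borel_measurable (?B \<Otimes>\<^sub>M ?E)"
      by (rule measurable_compose[OF measurable_fst *])
  qed
  have plus[measurable]: "(\<lambda>p. \<lambda>i\<in>E. snd p i + T (fst p) i) \<in> measurable (?B \<Otimes>\<^sub>M ?E) ?E"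
    by (rule measurable_restrict) measurable
  have minus[measurable]: "(\<lambda>p. \<lambda>i\<in>E. T (fst p) i - snd p i) \<in> measurable (?B \<Otimes>\<^sub>M ?E) ?E"
    by (rule measurable_restrict) measurable
  have key: "emeasure ?B (P A) * emeasure ?E Q = emeasure ?B (P Q) * emeasure ?E A"
    if [measurable]: "A \<in> sets ?E" "Q \<in> sets ?E" for A Q
  proof -
    have "emeasure ?B (P A) * emeasure ?E Q = (\<integral>\<^sup>+c. indicator A (T c) * emeasure ?E Q \<partial>?B)"
    proof -
      have "emeasure ?B (P A) = (\<integral>\<^sup>+c. indicator (P A) c \<partial>?B)" using Pm[of A] by simp
      also have "\<dots> = (\<integral>\<^sup>+c. indicator A (T c) \<partial>?B)"
        by (intro nn_integral_cong) (auto simp: PB indicator_def)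
      finally show ?thesis by (simp add: nn_integral_multc)
    qed
    also have "\<dots> = (\<integral>\<^sup>+c. \<integral>\<^sup>+z. indicator A (T c) * indicator Q (\<lambda>i\<in>E. z i + T c i) \<partial>?E \<partial>?B)"
    proof (rule nn_integral_cong)
      fix c assume c: "c \<in> space ?B"
      have [measurable]: "(\<lambda>z. \<lambda>i\<in>E. z i + T c i) \<in> measurable ?E ?E"
        by (rule measurable_restrict) measurable
      have "(\<integral>\<^sup>+z. indicator Q (\<lambda>i\<in>E. z i + T c i) \<partial>?E) = emeasure ?E Q"
        by (subst nn_integral_PiM_translate[OF fin(2)]) auto
      then show "indicator A (T c) * emeasure ?E Q =
          (\<integral>\<^sup>+z. indicator A (T c) * indicator Q (\<lambda>i\<in>E. z i + T c i) \<partial>?E)"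
        by (subst nn_integral_cmult) auto
    qed
    also have "\<dots> = (\<integral>\<^sup>+z. \<integral>\<^sup>+c. indicator A (T c) * indicator Q (\<lambda>i\<in>E. z i + T c i) \<partial>?B \<partial>?E)"
      by (rule BE.Fubini'[symmetric]) measurable
    also have "\<dots> = (\<integral>\<^sup>+z. \<integral>\<^sup>+c. indicator A (\<lambda>i\<in>E. T c i - z i) * indicator Q (T c) \<partial>?B \<partial>?E)"
    proof (rule nn_integral_cong)
      fix z assume "z \<in> space ?E"
      then have z: "z \<in> E \<rightarrow>\<^sub>E UNIV" by (simp add: space_PiM)
      then obtain w where w: "w \<in> B \<rightarrow>\<^sub>E UNIV" "T w = z" using SB TS by blast
      have [measurable]: "(\<lambda>c. \<lambda>i\<in>E. T c i - z i) \<in> measurable ?B ?E"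
        by (rule measurable_restrict) measurable
      have "(\<integral>\<^sup>+c. indicator A (\<lambda>i\<in>E. T c i - z i) * indicator Q (T c) \<partial>?B) =
        (\<integral>\<^sup>+c. indicator A (\<lambda>i\<in>E. T (\<lambda>i\<in>B. c i + w i) i - z i) * indicator Q (T (\<lambda>i\<in>B. c i + w i)) \<partial>?B)"
        by (subst nn_integral_PiM_translate[OF fin(1), of "\<lambda>c. indicator A (\<lambda>i\<in>E. T c i - z i) * indicator Q (T c)"]) auto
      also have "\<dots> = (\<integral>\<^sup>+c. indicator A (T c) * indicator Q (\<lambda>i\<in>E. z i + T c i) \<partial>?B)"
      proof (rule nn_integral_cong)
        fix c assume "c \<in> space ?B"
        then have c: "c \<in> B \<rightarrow>\<^sub>E UNIV" by (simp add: space_PiM)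
        have 1: "T (\<lambda>i\<in>B. c i + w i) = (\<lambda>i\<in>E. z i + T c i)" using add[OF c w(1)] w(2) by (simp add: add.commute)
        have 2: "(\<lambda>i\<in>E. (\<lambda>i\<in>E. z i + T c i) i - z i) = T c"
          using TE[OF c] by (auto simp: fun_eq_iff PiE_def extensional_def)
        show "indicator A (\<lambda>i\<in>E. T (\<lambda>i\<in>B. c i + w i) i - z i) * indicator Q (T (\<lambda>i\<in>B. c i + w i)) =
            (indicator A (T c) * indicator Q (\<lambda>i\<in>E. z i + T c i) :: ennreal)"
          unfolding 1 2 ..
      qed
      finally show "(\<integral>\<^sup>+c. indicator A (T c) * indicator Q (\<lambda>i\<in>E. z i + T c i) \<partial>?B) =
        (\<integral>\<^sup>+c. indicator A (\<lambda>i\<in>E. T c i - z i) * indicator Q (T c) \<partial>?B)" by simp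
    qed
    also have "\<dots> = (\<integral>\<^sup>+c. \<integral>\<^sup>+z. indicator A (\<lambda>i\<in>E. T c i - z i) * indicator Q (T c) \<partial>?E \<partial>?B)"
      by (rule BE.Fubini') measurable
    also have "\<dots> = (\<integral>\<^sup>+c. indicator Q (T c) * emeasure ?E A \<partial>?B)"
    proof (rule nn_integral_cong)
      fix c assume c: "c \<in> space ?B"
      have [measurable]: "(\<lambda>z. \<lambda>i\<in>E. T c i - z i) \<in> measurable ?E ?E"
        by (rule measurable_restrict) measurable
      have "(\<integral>\<^sup>+z. indicator A (\<lambda>i\<in>E. T c i - z i) \<partial>?E) = emeasure ?E A"
        by (subst nn_integral_PiM_reflect[OF fin(2)]) auto
      then show "(\<integral>\<^sup>+z. indicator A (\<lambda>i\<in>E. T c i - z i) * indicator Q (T c) \<partial>?E) =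
          indicator Q (T c) * emeasure ?E A"
        by (subst nn_integral_multc) (auto simp: mult.commute)
    qed
    also have "\<dots> = emeasure ?B (P Q) * emeasure ?E A"
    proof -
      have "emeasure ?B (P Q) = (\<integral>\<^sup>+c. indicator (P Q) c \<partial>?B)" using Pm[of Q] by simp
      also have "\<dots> = (\<integral>\<^sup>+c. indicator Q (T c) \<partial>?B)"
        by (intro nn_integral_cong) (auto simp: PB indicator_def)
      finally show ?thesis by (simp add: nn_integral_multc)
    qed
    finally show ?thesis .
  qed
  \<comment> \<open>Both cubes have measure one. Taking \<open>cubeE\<close> for \<open>Q\<close> in
    \<open>key\<close> exhibits the constant; \<open>cubeB\<close> will show that it is neither 0
    nor infinite.\<close>
  define cubeE where "cubeE = Pi\<^sub>E E (\<lambda>_. {0..1::real})"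
  define cubeB where "cubeB = Pi\<^sub>E B (\<lambda>_. {0..1::real})"
  have E1: "emeasure ?E cubeE = 1" "cubeE \<in> sets ?E"
    using fin emeasure_PiM[OF fin(2), of "\<lambda>_. {0..1}"] by (auto simp: cubeE_def intro!: sets_PiM_I_finite)
  have B1: "emeasure ?B cubeB = 1" "cubeB \<in> sets ?B"
    using fin emeasure_PiM[OF fin(1), of "\<lambda>_. {0..1}"] by (auto simp: cubeB_def intro!: sets_PiM_I_finite)
  have *: "emeasure ?B (P A) = emeasure ?B (P cubeE) * emeasure ?E A" if "A \<in> sets ?E" for A
    using key[OF that E1(2)] E1(1) by simp
  define k where "k = emeasure ?B (P cubeE)"
  have Psp: "P (space ?E) = space ?B" using TE by (auto simp: P_def space_PiM)
  have "k \<noteq> 0"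
  proof
    assume "k = 0"
    then have "emeasure ?B (space ?B) = 0" using *[of "space ?E"] Psp by (simp add: k_def)
    moreover have "emeasure ?B cubeB \<le> emeasure ?B (space ?B)" by (rule emeasure_space)
    ultimately show False using B1 by simp
  qed
  \<comment> \<open>The preimage of this set under \<open>T\<close> is \<open>cubeB\<close>, of
    measure one, which excludes an infinite constant.\<close>
  define A where "A = S -` cubeB \<inter> space ?E"
  have A: "A \<in> sets ?E" unfolding A_def using S B1(2) by (rule measurable_sets)
  have "cubeB \<subseteq> B \<rightarrow>\<^sub>E UNIV" by (auto simp: cubeB_def)
  then have "P A = cubeB" using TE ST by (auto simp: P_def A_def space_PiM)
  then have "k * emeasure ?E A = 1" using *[OF A] B1 by (simp add: k_def)
  then have "k \<noteq> \<infinity>" by (auto simp: ennreal_top_mult split: if_splits)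
  show ?thesis
  proof (rule that[of "enn2real k"])
    show "enn2real k > 0" using \<open>k \<noteq> 0\<close> \<open>k \<noteq> \<infinity>\<close> by (simp add: enn2real_positive_iff less_top zero_less_iff_neq_zero)
    fix A assume "A \<in> sets ?E"
    then show "measure ?B (T -` A \<inter> (B \<rightarrow>\<^sub>E UNIV)) = enn2real k * measure ?E A"
      using * by (simp add: measure_def P_def[symmetric] k_def[symmetric] enn2real_mult)
  qed
qed

section \<open>Faces and normal cones of permutohedra\<close>

definition arrangement :: "(nat \<Rightarrow> real) \<Rightarrow> ('d \<Rightarrow> nat) \<Rightarrow> real ^ 'd"
  where "arrangement x \<sigma> = (\<chi> i. x (\<sigma> i))"

definition perm_polytope :: "(nat \<Rightarrow> real) \<Rightarrow> (real ^ 'd) set"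
  where "perm_polytope x = convex hull {arrangement x \<sigma> |\<sigma>. bij_betw \<sigma> UNIV {..<CARD('d)}}"

text \<open>Rado's description of the permutohedron by inequalities.\<close>

definition majorized :: "(nat \<Rightarrow> real) \<Rightarrow> (real ^ 'd) set"
  where "majorized x = {z. (\<Sum>i\<in>UNIV. z $ i) = psum x CARD('d) \<and> (\<forall>A. (\<Sum>i\<in>A. z $ i) \<le> psum x (card A))}"

text \<open>An ordered partition of the coordinates, encoded as a total preorder. The image of
  \<open>{j}\<close> is an up-set: all coordinates on which \<open>v\<close> is at least as large as
  at \<open>j\<close>.\<close>

definition weak_order :: "real ^ 'd \<Rightarrow> ('d \<times> 'd) set"
  where "weak_order v = {(i, j). v $ i \<le> v $ j}"

definition perm_face :: "(nat \<Rightarrow> real) \<Rightarrow> ('d \<times> 'd) set \<Rightarrow> (real ^ 'd) set"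
  where "perm_face x R = {z \<in> majorized x. \<forall>j. (\<Sum>i\<in>R `` {j}. z $ i) = psum x (card (R `` {j}))}"

text \<open>\<open>\<sigma> i\<close> is the position of \<open>i\<close>, counted from 0, when the
  coordinates are listed by decreasing values of \<open>v\<close> with ties broken somehow.\<close>

definition sorts :: "real ^ 'd \<Rightarrow> ('d \<Rightarrow> nat) \<Rightarrow> bool"
  where "sorts v \<sigma> \<longleftrightarrow> bij_betw \<sigma> UNIV {..<CARD('d)} \<and> (\<forall>i j. \<sigma> i \<le> \<sigma> j \<longrightarrow> v $ j \<le> v $ i)"

text \<open>The position of \<open>i\<close> is the number of its predecessors in the lexicographic
  order by decreasing \<open>v\<close>, then increasing \<open>\<pi>\<close>. Control over ties is
  what the computation of normal cones requires.\<close>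

lemma ex_sorts_tie:
  fixes v :: "real ^ 'd" and \<pi> :: "'d \<Rightarrow> nat"
  assumes "inj \<pi>"
  obtains \<sigma> where "sorts v \<sigma>" "\<And>i j. v $ i = v $ j \<Longrightarrow> \<pi> i < \<pi> j \<Longrightarrow> \<sigma> i < \<sigma> j"
proof -
  define L where "L i j \<longleftrightarrow> v $ i > v $ j \<or> (v $ i = v $ j \<and> \<pi> i < \<pi> j)" for i j
  have total: "L i j \<or> L j i" if "i \<noteq> j" for i j
    using assms that unfolding L_def by (meson injD linorder_neqE_linordered_idom linorder_neqE_nat)
  have trans: "L i k" if "L i j" "L j k" for i j k using that unfolding L_def by auto
  have irrefl: "\<not> L i i" for i unfolding L_def by auto
  define \<sigma> where "\<sigma> i = card {k. L k i}" for i
  have less: "\<sigma> i < \<sigma> j" if "L i j" for i j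
    unfolding \<sigma>_def
  proof (rule psubset_card_mono)
    show "{k. L k i} \<subset> {k. L k j}" using that irrefl trans by blast
  qed simp
  have inj: "inj \<sigma>"
  proof (rule injI)
    fix i j assume "\<sigma> i = \<sigma> j"
    then show "i = j" using total[of i j] less[of i j] less[of j i] by auto
  qed
  have "\<sigma> i < CARD('d)" for i
  proof -
    have "card {k. L k i} < card (UNIV :: 'd set)"
      by (rule psubset_card_mono) (use irrefl in auto)
    then show ?thesis by (simp add: \<sigma>_def)
  qed
  then have "\<sigma> ` UNIV \<subseteq> {..<CARD('d)}" by auto
  moreover have "card (\<sigma> ` UNIV) = CARD('d)" using inj by (rule card_image)
  ultimately have "\<sigma> ` UNIV = {..<CARD('d)}" by (intro card_subset_eq) auto
  then have "bij_betw \<sigma> UNIV {..<CARD('d)}" using inj by (simp add: bij_betw_def)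
  moreover have "v $ j \<le> v $ i" if "\<sigma> i \<le> \<sigma> j" for i j
  proof (rule ccontr)
    assume "\<not> v $ j \<le> v $ i"
    then have "L j i" by (simp add: L_def)
    then show False using less that by fastforce
  qed
  ultimately have "sorts v \<sigma>" unfolding sorts_def by blast
  then show thesis using that less unfolding L_def by blast
qed

lemma ex_sorts:
  fixes v :: "real ^ 'd"
  obtains \<sigma> where "sorts v \<sigma>"
proof -
  obtain \<pi> :: "'d \<Rightarrow> nat" where "inj \<pi>" using finite_imp_inj_to_nat_seg[of "UNIV :: 'd set"] by auto
  then show ?thesis using ex_sorts_tie that by metis
qed

lemma ex_sorts_before:
  fixes v :: "real ^ 'd"
  assumes "v $ i \<le> v $ j" "i \<noteq> j"
  obtains \<sigma> where "sorts v \<sigma>" "\<sigma> j < \<sigma> i"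
proof -
  obtain \<pi> :: "'d \<Rightarrow> nat" where \<pi>: "inj \<pi>" using finite_imp_inj_to_nat_seg[of "UNIV :: 'd set"] by auto
  \<comment> \<open>The smallest key goes to \<open>j\<close>, so that \<open>j\<close> wins a tie
    with \<open>i\<close>.\<close>
  define \<rho> where "\<rho> k = (if k = j then 0 else Suc (\<pi> k))" for k
  have "inj \<rho>" using \<pi> by (auto simp: inj_def \<rho>_def)
  then obtain \<sigma> where \<sigma>: "sorts v \<sigma>" "\<And>i j. v $ i = v $ j \<Longrightarrow> \<rho> i < \<rho> j \<Longrightarrow> \<sigma> i < \<sigma> j"
    using ex_sorts_tie by metis
  show ?thesis
  proof (cases "v $ i = v $ j")
    case True
    then have "\<sigma> j < \<sigma> i" using assms(2) \<sigma>(2)[of j i] by (simp add: \<rho>_def)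
    then show ?thesis using that \<sigma>(1) by blast
  next
    case False
    then have "\<sigma> j < \<sigma> i" using \<sigma>(1) assms(1) unfolding sorts_def by (meson antisym not_less)
    then show ?thesis using that \<sigma>(1) by blast
  qed
qed

lemma sum_by_parts:
  fixes a b :: "nat \<Rightarrow> real"
  shows "(\<Sum>k<Suc n. a k * b k) = a n * (\<Sum>k<Suc n. b k) + (\<Sum>k<n. (a k - a (Suc k)) * (\<Sum>i<Suc k. b i))"
proof (induction n)
  case (Suc n)
  have "(\<Sum>k<Suc (Suc n). a k * b k) = a (Suc n) * b (Suc n) + a n * (\<Sum>k<Suc n. b k)
      + (\<Sum>k<n. (a k - a (Suc k)) * (\<Sum>i<Suc k. b i))"
    using Suc by simp
  also have "\<dots> = a (Suc n) * (b (Suc n) + (\<Sum>k<Suc n. b k)) + ((a n - a (Suc n)) * (\<Sum>k<Suc n. b k)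
      + (\<Sum>k<n. (a k - a (Suc k)) * (\<Sum>i<Suc k. b i)))"
    by (simp only: algebra_simps)
  also have "\<dots> = a (Suc n) * (\<Sum>k<Suc (Suc n). b k) + (\<Sum>k<Suc n. (a k - a (Suc k)) * (\<Sum>i<Suc k. b i))"
    by simp
  finally show ?case .
qed simp

text \<open>Summation by parts; the boundary term vanishes because \<open>z\<close> has the same
  total as \<open>x\<close>. If \<open>\<sigma>\<close> sorts \<open>v\<close> and \<open>z\<close>
  is majorized, each summand is a descent of \<open>v\<close> times a slack of an inequality, both
  nonnegative, so maximality and its equality case can be read off termwise.\<close>

lemma arrangement_gap:
  fixes v z :: "real ^ 'd"
  assumes "bij_betw \<sigma> UNIV {..<CARD('d)}" "(\<Sum>i\<in>UNIV. z $ i) = psum x CARD('d)"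
  defines "\<tau> \<equiv> the_inv \<sigma>"
  shows "v \<bullet> arrangement x \<sigma> - v \<bullet> z = (\<Sum>k<CARD('d) - 1. (v $ \<tau> k - v $ \<tau> (Suc k)) *
      (psum x (Suc k) - (\<Sum>i | \<sigma> i < Suc k. z $ i)))"
proof -
  obtain M where M: "CARD('d) = Suc M" using zero_less_card_finite[where 'a='d] by (metis gr0_implies_Suc)
  have inj: "inj \<sigma>" and im: "range \<sigma> = {..<CARD('d)}" using assms(1) by (auto simp: bij_betw_def)
  have \<tau>\<sigma>: "\<tau> (\<sigma> i) = i" for i unfolding \<tau>_def by (rule the_inv_f_f[OF inj])
  have ux: "\<And>m. m < CARD('d) \<Longrightarrow> \<sigma> (\<tau> m) = m" using im \<tau>\<sigma> by (metis lessThan_iff rangeE)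
  have reindex: "(\<Sum>i | \<sigma> i < k. g i) = (\<Sum>m<k. g (\<tau> m))" if "k \<le> CARD('d)" for g :: "'d \<Rightarrow> real" and k
  proof -
    have "m \<in> \<sigma> ` {i. \<sigma> i < k}" if "m < k" for m
      using ux[of m] that \<open>k \<le> CARD('d)\<close> by (intro image_eqI[of _ _ "\<tau> m"]) auto
    then have "\<sigma> ` {i. \<sigma> i < k} = {..<k}" by auto
    then have "(\<Sum>m<k. g (\<tau> m)) = (\<Sum>m\<in>\<sigma> ` {i. \<sigma> i < k}. g (\<tau> m))" by simp
    also have "\<dots> = (\<Sum>i | \<sigma> i < k. g i)"
      using inj by (subst sum.reindex) (auto simp: \<tau>\<sigma> inj_on_def)
    finally show ?thesis by simp
  qed
  have full: "{i. \<sigma> i < CARD('d)} = UNIV" using im by auto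
  define b where "b m = x m - z $ \<tau> m" for m
  have "v \<bullet> arrangement x \<sigma> - v \<bullet> z = (\<Sum>i\<in>UNIV. v $ i * (x (\<sigma> i) - z $ i))"
    by (simp add: inner_vec_def arrangement_def sum_subtractf right_diff_distrib)
  also have "\<dots> = (\<Sum>m<Suc M. v $ \<tau> m * b m)"
    using reindex[of "CARD('d)" "\<lambda>i. v $ i * (x (\<sigma> i) - z $ i)"] ux unfolding full M[symmetric] b_def
    by simp
  also have "\<dots> = v $ \<tau> M * (\<Sum>k<Suc M. b k)
      + (\<Sum>k<M. (v $ \<tau> k - v $ \<tau> (Suc k)) * (\<Sum>i<Suc k. b i))"
    by (rule sum_by_parts)
  also have "(\<Sum>k<Suc M. b k) = 0"
    using assms(2) reindex[of "CARD('d)" "\<lambda>i. z $ i"] unfolding full M[symmetric] b_def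
    by (simp add: sum_subtractf psum_def)
  also have "(\<Sum>k<M. (v $ \<tau> k - v $ \<tau> (Suc k)) * (\<Sum>i<Suc k. b i)) =
      (\<Sum>k<M. (v $ \<tau> k - v $ \<tau> (Suc k)) * (psum x (Suc k) - (\<Sum>i | \<sigma> i < Suc k. z $ i)))"
  proof (rule sum.cong)
    fix k assume "k \<in> {..<M}"
    then have "Suc k \<le> CARD('d)" using M by simp
    then show "(v $ \<tau> k - v $ \<tau> (Suc k)) * (\<Sum>i<Suc k. b i) =
        (v $ \<tau> k - v $ \<tau> (Suc k)) * (psum x (Suc k) - (\<Sum>i | \<sigma> i < Suc k. z $ i))"
      by (simp only: reindex) (simp add: b_def sum_subtractf psum_def)
  qed simp
  finally show ?thesis using M by simp
qed

lemma the_inv_bij: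
  fixes \<sigma> :: "'d::finite \<Rightarrow> nat"
  assumes "bij_betw \<sigma> UNIV {..<CARD('d)}" "k < CARD('d)"
  shows "\<sigma> (the_inv \<sigma> k) = k"
  using assms by (metis bij_betw_def f_the_inv_into_f lessThan_iff)

lemma card_initial:
  fixes \<sigma> :: "'d::finite \<Rightarrow> nat"
  assumes "bij_betw \<sigma> UNIV {..<CARD('d)}" "k \<le> CARD('d)"
  shows "card {i. \<sigma> i < k} = k"
proof -
  have "m \<in> \<sigma> ` {i. \<sigma> i < k}" if "m < k" for m
    using the_inv_bij[OF assms(1), of m] that assms(2) by (intro image_eqI[of _ _ "the_inv \<sigma> m"]) auto
  then have "\<sigma> ` {i. \<sigma> i < k} = {..<k}" by auto
  moreover have "inj_on \<sigma> {i. \<sigma> i < k}" using assms(1) by (auto simp: bij_betw_def inj_on_def)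
  ultimately show ?thesis by (metis card_image card_lessThan)
qed

lemma sorts_gap_nonneg:
  fixes v :: "real ^ 'd"
  assumes "sorts v \<sigma>" "Suc k < CARD('d)"
  shows "v $ the_inv \<sigma> (Suc k) \<le> v $ the_inv \<sigma> k"
  using assms the_inv_bij[of \<sigma>] unfolding sorts_def by (metis Suc_lessD lessI less_imp_le_nat)

lemma sorts_maximal:
  fixes v z :: "real ^ 'd"
  assumes "sorts v \<sigma>" "z \<in> majorized x"
  shows "v \<bullet> z \<le> v \<bullet> arrangement x \<sigma>"
proof -
  have \<sigma>: "bij_betw \<sigma> UNIV {..<CARD('d)}" using assms(1) by (simp add: sorts_def)
  have "v \<bullet> arrangement x \<sigma> - v \<bullet> z \<ge> 0"
    unfolding arrangement_gap[OF \<sigma>, of z x, OF assms(2)[unfolded majorized_def, THEN CollectD, THEN conjunct1]]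
  proof (intro sum_nonneg mult_nonneg_nonneg)
    fix k assume "k \<in> {..<CARD('d) - 1}"
    then have k: "Suc k < CARD('d)" by simp
    show "0 \<le> v $ the_inv \<sigma> k - v $ the_inv \<sigma> (Suc k)" using sorts_gap_nonneg[OF assms(1) k] by simp
    show "0 \<le> psum x (Suc k) - (\<Sum>i | \<sigma> i < Suc k. z $ i)"
      using assms(2) card_initial[OF \<sigma>, of "Suc k"] k unfolding majorized_def by (metis (no_types, lifting) diff_ge_0_iff_ge mem_Collect_eq less_imp_le_nat)
  qed
  then show ?thesis by simp
qed

text \<open>Each summand of \<open>arrangement_gap\<close> vanishes: where \<open>u\<close> ties at
  consecutive positions, so does the coarser \<open>v\<close>; where \<open>u\<close> drops, the
  initial segment is an up-set of \<open>u\<close>, whose inequality is tight on the face.\<close>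

lemma perm_face_maximal:
  fixes u v z :: "real ^ 'd"
  assumes "z \<in> perm_face x (weak_order u)" "sorts u \<sigma>" "weak_order u \<subseteq> weak_order v"
  shows "v \<bullet> z = v \<bullet> arrangement x \<sigma>"
proof -
  have \<sigma>: "bij_betw \<sigma> UNIV {..<CARD('d)}" using assms(2) by (simp add: sorts_def)
  have tot: "(\<Sum>i\<in>UNIV. z $ i) = psum x CARD('d)" using assms(1) by (simp add: perm_face_def majorized_def)
  let ?\<tau> = "the_inv \<sigma>"
  have "v \<bullet> arrangement x \<sigma> - v \<bullet> z = 0"
    unfolding arrangement_gap[OF \<sigma> tot]
  proof (intro sum.neutral ballI)
    fix k assume "k \<in> {..<CARD('d) - 1}"
    then have k: "Suc k < CARD('d)" by simp
    have inv: "\<sigma> (?\<tau> k) = k" "\<sigma> (?\<tau> (Suc k)) = Suc k" using the_inv_bij[OF \<sigma>] k by auto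
    show "(v $ ?\<tau> k - v $ ?\<tau> (Suc k)) * (psum x (Suc k) - (\<Sum>i | \<sigma> i < Suc k. z $ i)) = 0"
    proof (cases "u $ ?\<tau> k \<le> u $ ?\<tau> (Suc k)")
      case True
      moreover have "u $ ?\<tau> (Suc k) \<le> u $ ?\<tau> k" by (rule sorts_gap_nonneg[OF assms(2) k])
      ultimately have "(?\<tau> k, ?\<tau> (Suc k)) \<in> weak_order u" "(?\<tau> (Suc k), ?\<tau> k) \<in> weak_order u"
        by (simp_all add: weak_order_def)
      then have "(?\<tau> k, ?\<tau> (Suc k)) \<in> weak_order v" "(?\<tau> (Suc k), ?\<tau> k) \<in> weak_order v"
        using assms(3) by blast+
      then have "v $ ?\<tau> k = v $ ?\<tau> (Suc k)" by (simp add: weak_order_def)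
      then show ?thesis by simp
    next
      case False
      have eq: "weak_order u `` {?\<tau> k} = {i. \<sigma> i < Suc k}"
      proof (intro set_eqI iffI)
        fix i assume "i \<in> weak_order u `` {?\<tau> k}"
        then have "u $ ?\<tau> k \<le> u $ i" by (simp add: weak_order_def)
        then have "\<not> Suc k \<le> \<sigma> i" using False assms(2) inv(2) unfolding sorts_def by (metis order_trans)
        then show "i \<in> {i. \<sigma> i < Suc k}" by simp
      next
        fix i assume "i \<in> {i. \<sigma> i < Suc k}"
        then have "\<sigma> i \<le> \<sigma> (?\<tau> k)" using inv by simp
        then show "i \<in> weak_order u `` {?\<tau> k}" using assms(2) by (simp add: weak_order_def sorts_def)
      qed
      have "(\<Sum>i\<in>weak_order u `` {?\<tau> k}. z $ i) = psum x (card (weak_order u `` {?\<tau> k}))"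
        using assms(1) by (simp add: perm_face_def)
      then have "(\<Sum>i | \<sigma> i < Suc k. z $ i) = psum x (Suc k)"
        using card_initial[OF \<sigma>, of "Suc k"] k unfolding eq by simp
      then show ?thesis by simp
    qed
  qed
  then show ?thesis by simp
qed

lemma initial_segment:
  fixes S :: "nat set"
  assumes "finite S" "\<And>i j. j \<in> S \<Longrightarrow> i \<le> j \<Longrightarrow> i \<in> S"
  shows "S = {..<card S}"
proof (cases "S = {}")
  case False
  then have "S = {..Max S}" using assms by (auto intro: Max_ge dest: Max_in)
  then show ?thesis by (metis card_atMost lessThan_Suc_atMost)
qed simp

lemma up_set_eq:
  fixes v :: "real ^ 'd"
  assumes "sorts v \<sigma>"
  shows "weak_order v `` {j} = {i. \<sigma> i < card (weak_order v `` {j})}"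
proof -
  let ?U = "weak_order v `` {j}"
  have inj: "inj \<sigma>" and im: "range \<sigma> = {..<CARD('d)}" using assms by (auto simp: sorts_def bij_betw_def)
  have "\<sigma> ` ?U = {..<card (\<sigma> ` ?U)}"
  proof (rule initial_segment)
    fix a b assume "b \<in> \<sigma> ` ?U" "a \<le> b"
    then obtain i where i: "v $ j \<le> v $ i" "b = \<sigma> i" by (auto simp: weak_order_def)
    have "b < CARD('d)" using im i(2) by auto
    then have "a \<in> range \<sigma>" using im \<open>a \<le> b\<close> by auto
    then obtain k where k: "a = \<sigma> k" by auto
    then have "v $ i \<le> v $ k" using assms i \<open>a \<le> b\<close> by (auto simp: sorts_def)
    then show "a \<in> \<sigma> ` ?U" using k i by (auto simp: weak_order_def)
  qed simp
  moreover have "card (\<sigma> ` ?U) = card ?U" using inj by (simp add: card_image inj_on_subset)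
  ultimately have "\<sigma> ` ?U = {..<card ?U}" by simp
  then show ?thesis using inj by (auto simp: set_eq_iff image_iff inj_def) (metis+)?
qed

text \<open>For the converse, a vanishing sum of nonnegative products forces slack zero at each
  strict descent of \<open>v\<close>, and every up-set other than the whole space ends at such a
  descent.\<close>

lemma perm_face_iff:
  fixes v z :: "real ^ 'd"
  assumes "sorts v \<sigma>" "z \<in> majorized x"
  shows "z \<in> perm_face x (weak_order v) \<longleftrightarrow> v \<bullet> z = v \<bullet> arrangement x \<sigma>"
proof
  assume eq: "v \<bullet> z = v \<bullet> arrangement x \<sigma>"
  have \<sigma>: "bij_betw \<sigma> UNIV {..<CARD('d)}" using assms(1) by (simp add: sorts_def)
  have tot: "(\<Sum>i\<in>UNIV. z $ i) = psum x CARD('d)" using assms(2) by (simp add: majorized_def)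
  let ?\<tau> = "the_inv \<sigma>"
  let ?g = "\<lambda>k. (v $ ?\<tau> k - v $ ?\<tau> (Suc k)) * (psum x (Suc k) - (\<Sum>i | \<sigma> i < Suc k. z $ i))"
  have "(\<Sum>k<CARD('d) - 1. ?g k) = 0" using arrangement_gap[OF \<sigma> tot, of v] eq by simp
  moreover have "?g k \<ge> 0" if "Suc k < CARD('d)" for k
  proof (rule mult_nonneg_nonneg)
    show "0 \<le> v $ ?\<tau> k - v $ ?\<tau> (Suc k)" using sorts_gap_nonneg[OF assms(1) that] by simp
    show "0 \<le> psum x (Suc k) - (\<Sum>i | \<sigma> i < Suc k. z $ i)"
      using assms(2) card_initial[OF \<sigma>, of "Suc k"] that unfolding majorized_def by (metis (no_types, lifting) diff_ge_0_iff_ge mem_Collect_eq less_imp_le_nat)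
  qed
  ultimately have zero: "?g k = 0" if "Suc k < CARD('d)" for k
    using sum_nonneg_eq_0_iff[of "{..<CARD('d) - 1}" ?g] that by auto
  have "(\<Sum>i\<in>weak_order v `` {j}. z $ i) = psum x (card (weak_order v `` {j}))" for j
  proof -
    define m where "m = card (weak_order v `` {j})"
    have U: "weak_order v `` {j} = {i. \<sigma> i < m}" unfolding m_def by (rule up_set_eq[OF assms(1)])
    have mle: "m \<le> CARD('d)" unfolding m_def by (simp add: card_mono)
    have "j \<in> weak_order v `` {j}" by (simp add: weak_order_def)
    then have "m > 0" using U by auto
    then obtain k where k: "m = Suc k" by (metis gr0_implies_Suc)
    show ?thesis
    proof (cases "m = CARD('d)")
      case True
      then have "weak_order v `` {j} = UNIV" using U \<sigma> by (auto simp: bij_betw_def)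
      then show ?thesis using tot by simp
    next
      case False
      then have k': "Suc k < CARD('d)" using mle k by simp
      have inv: "\<sigma> (?\<tau> k) = k" "\<sigma> (?\<tau> (Suc k)) = Suc k" using the_inv_bij[OF \<sigma>] k' by auto
      have "?\<tau> k \<in> weak_order v `` {j}" "?\<tau> (Suc k) \<notin> weak_order v `` {j}" unfolding U using inv k by auto
      then have "v $ ?\<tau> (Suc k) < v $ ?\<tau> k" by (simp add: weak_order_def)
      then have "(\<Sum>i | \<sigma> i < Suc k. z $ i) = psum x (Suc k)" using zero[OF k'] by simp
      then have "(\<Sum>i\<in>weak_order v `` {j}. z $ i) = psum x m" unfolding U k .
      then show ?thesis by (simp only: m_def)
    qed
  qed
  then show "z \<in> perm_face x (weak_order v)" using assms(2) by (simp add: perm_face_def)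
qed (use perm_face_maximal[OF _ assms(1)] in blast)

text \<open>When the elements are added in increasing order, a new index \<open>m\<close> is at
  least the number of earlier ones, so its entry is at most the next entry of the partial
  sum.\<close>

lemma sum_le_psum:
  assumes "antimono x" "finite S"
  shows "sum x S \<le> psum x (card S)"
  using assms(2)
proof (induction S rule: finite_linorder_max_induct)
  case (insert m S)
  have "S \<subseteq> {..<m}" using insert by auto
  then have "card S \<le> m" using card_mono[of "{..<m}" S] by simp
  then have "x m \<le> x (card S)" using assms(1) by (auto simp: antimono_def)
  moreover have "m \<notin> S" using insert by auto
  ultimately show ?case using insert by (simp add: psum_Suc)
qed (simp add: psum_0)

lemma arrangement_majorized:
  fixes \<sigma> :: "'d::finite \<Rightarrow> nat"
  assumes "antimono x" "bij_betw \<sigma> UNIV {..<CARD('d)}"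
  shows "arrangement x \<sigma> \<in> majorized x"
proof -
  have inj: "inj_on \<sigma> A" for A using assms(2) by (auto simp: bij_betw_def inj_on_def)
  have "(\<Sum>i\<in>A. arrangement x \<sigma> $ i) = sum x (\<sigma> ` A)" for A
    by (simp add: arrangement_def sum.reindex[OF inj])
  moreover have "sum x (\<sigma> ` A) \<le> psum x (card A)" for A
    using sum_le_psum[OF assms(1), of "\<sigma> ` A"] by (simp add: card_image[OF inj])
  moreover have "sum x (\<sigma> ` UNIV) = psum x CARD('d)" using assms(2) by (simp add: bij_betw_def psum_def)
  ultimately show ?thesis by (simp add: majorized_def)
qed

lemma finite_arrangements: "finite {arrangement x \<sigma> :: real ^ 'd |\<sigma>. bij_betw \<sigma> UNIV {..<CARD('d)}}"
proof -
  have "finite {\<sigma> :: 'd \<Rightarrow> nat. bij_betw \<sigma> UNIV {..<CARD('d)}}"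
    by (rule finite_subset[OF _ finite_PiE[of UNIV "\<lambda>_. {..<CARD('d)}"]])
       (auto simp: bij_betw_def PiE_def Pi_def)
  then show ?thesis by simp
qed

text \<open>Rado's theorem. A majorized point outside the hull would be strictly separated by some
  \<open>a\<close> from all arrangements, but the arrangement that sorts \<open>- a\<close>
  minimizes \<open>a\<close> over all majorized points.\<close>

lemma perm_polytope_eq_majorized:
  assumes "antimono x"
  shows "perm_polytope x = (majorized x :: (real ^ 'd) set)"
proof
  have "convex (majorized x :: (real ^ 'd) set)"
    unfolding convex_alt
  proof (intro ballI allI impI)
    fix y z :: "real ^ 'd" and t :: real
    assume *: "y \<in> majorized x" "z \<in> majorized x" "0 \<le> t \<and> t \<le> 1"
    have s: "(\<Sum>i\<in>A. ((1 - t) *\<^sub>R y + t *\<^sub>R z) $ i) = (1 - t) * (\<Sum>i\<in>A. y $ i) + t * (\<Sum>i\<in>A. z $ i)" for A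
      by (simp add: sum.distrib sum_distrib_left)
    have "(1 - t) * (\<Sum>i\<in>A. y $ i) + t * (\<Sum>i\<in>A. z $ i) \<le> psum x (card A)" for A
    proof (rule convex_bound_le)
      show "(\<Sum>i\<in>A. y $ i) \<le> psum x (card A)" "(\<Sum>i\<in>A. z $ i) \<le> psum x (card A)"
        using * by (auto simp: majorized_def)
    qed (use * in auto)
    moreover have "(1 - t) * psum x CARD('d) + t * psum x CARD('d) = psum x CARD('d)"
      by (simp add: algebra_simps)
    ultimately show "(1 - t) *\<^sub>R y + t *\<^sub>R z \<in> majorized x"
      using * unfolding majorized_def mem_Collect_eq s by simp
  qed
  then show "perm_polytope x \<subseteq> (majorized x :: (real ^ 'd) set)"
    unfolding perm_polytope_def using arrangement_majorized[OF assms] by (intro hull_minimal) auto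
  show "majorized x \<subseteq> (perm_polytope x :: (real ^ 'd) set)"
  proof (rule ccontr)
    assume "\<not> ?thesis"
    then obtain z :: "real ^ 'd" where z: "z \<in> majorized x" "z \<notin> perm_polytope x" by auto
    have "closed (perm_polytope x :: (real ^ 'd) set)" unfolding perm_polytope_def
      by (intro compact_imp_closed finite_imp_compact_convex_hull finite_arrangements)
    moreover have "convex (perm_polytope x :: (real ^ 'd) set)" unfolding perm_polytope_def by simp
    ultimately obtain a b where ab: "a \<bullet> z < b" "\<forall>p\<in>perm_polytope x. b < a \<bullet> p"
      using separating_hyperplane_closed_point[OF _ _ z(2)] by metis
    obtain \<sigma> where \<sigma>: "sorts (- a) \<sigma>" by (rule ex_sorts)
    then have "arrangement x \<sigma> \<in> perm_polytope x"
      unfolding perm_polytope_def by (auto simp: sorts_def intro: hull_inc)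
    then show False using ab sorts_maximal[OF \<sigma> z(1)] by fastforce
  qed
qed

lemma polytope_perm_polytope: "polytope (perm_polytope x)"
  unfolding perm_polytope_def by (intro polytope_convex_hull finite_arrangements)

lemma arrangement_in_perm_polytope: "sorts v \<sigma> \<Longrightarrow> arrangement x \<sigma> \<in> perm_polytope x"
  unfolding perm_polytope_def by (auto simp: sorts_def intro: hull_inc)

lemma integral_perm_polytope:
  assumes "\<And>k. x k \<in> \<int>"
  shows "integral_polytope (perm_polytope x)"
proof -
  have "v \<in> int_lattice" if "v extreme_point_of perm_polytope x" for v :: "real ^ 'd"
    using extreme_point_of_convex_hull[OF that[unfolded perm_polytope_def]] assms
    by (auto simp: arrangement_def int_lattice_def)
  then show ?thesis using polytope_perm_polytope by (auto simp: integral_polytope_def)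
qed

lemma arrangement_in_perm_face:
  assumes "antimono x" "sorts v \<sigma>"
  shows "arrangement x \<sigma> \<in> perm_face x (weak_order v)"
  using perm_face_iff[OF assms(2) arrangement_majorized[OF assms(1)]] assms(2) by (simp add: sorts_def)

lemma perm_face_eq_exposed:
  assumes "antimono x" "sorts v \<sigma>"
  shows "perm_face x (weak_order v) = perm_polytope x \<inter> {z. v \<bullet> z = v \<bullet> arrangement x \<sigma>}"
  using perm_face_iff[OF assms(2), of _ x] perm_polytope_eq_majorized[OF assms(1)]
  by (auto simp: perm_face_def)

text \<open>Faces of a polytope are exposed, hence sets of maximizers of a functional, and
  \<open>perm_face_iff\<close> shows that the maximizers depend only on the weak order of the
  functional.\<close>

lemma nonempty_face_perm_polytope_iff:
  fixes F :: "(real ^ 'd) set"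
  assumes "antimono x"
  shows "nonempty_face F (perm_polytope x) \<longleftrightarrow> F \<in> perm_face x ` range weak_order"
proof
  assume "F \<in> perm_face x ` range weak_order"
  then obtain v :: "real ^ 'd" where F: "F = perm_face x (weak_order v)" by auto
  obtain \<sigma> where \<sigma>: "sorts v \<sigma>" by (rule ex_sorts)
  have "F face_of perm_polytope x" unfolding F perm_face_eq_exposed[OF assms \<sigma>]
  proof (rule face_of_Int_supporting_hyperplane_le)
    show "convex (perm_polytope x)" by (simp add: perm_polytope_def)
    show "v \<bullet> z \<le> v \<bullet> arrangement x \<sigma>" if "z \<in> perm_polytope x" for z
      using sorts_maximal[OF \<sigma>] that perm_polytope_eq_majorized[OF assms] by blast
  qed
  then show "nonempty_face F (perm_polytope x)"
    using arrangement_in_perm_face[OF assms \<sigma>] F by (auto simp: nonempty_face_def)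
next
  assume "nonempty_face F (perm_polytope x)"
  then have "F face_of perm_polytope x" "F \<noteq> {}" by (auto simp: nonempty_face_def)
  then have "F exposed_face_of perm_polytope x"
    using exposed_face_of_polyhedron polytope_imp_polyhedron polytope_perm_polytope by blast
  then obtain a b where ab: "perm_polytope x \<subseteq> {p. a \<bullet> p \<le> b}" "F = perm_polytope x \<inter> {p. a \<bullet> p = b}"
    unfolding exposed_face_of_def by blast
  obtain \<sigma> where \<sigma>: "sorts a \<sigma>" by (rule ex_sorts)
  obtain f where f: "f \<in> F" using \<open>F \<noteq> {}\<close> by auto
  have "a \<bullet> arrangement x \<sigma> \<le> b" using ab(1) arrangement_in_perm_polytope[OF \<sigma>] by auto
  moreover have "b \<le> a \<bullet> arrangement x \<sigma>"
    using f ab(2) sorts_maximal[OF \<sigma>] perm_polytope_eq_majorized[OF assms] by blast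
  ultimately have "F = perm_face x (weak_order a)"
    using ab(2) perm_face_eq_exposed[OF assms \<sigma>] by simp
  then show "F \<in> perm_face x ` range weak_order" by blast
qed

text \<open>The right side does not involve \<open>x\<close>, which is what allows values of a
  construction to be compared between different sequences.\<close>

lemma ncone_perm_face:
  fixes u :: "real ^ 'd"
  assumes "\<And>k. x (Suc k) < x k"
  shows "ncone (perm_face x (weak_order u)) (perm_polytope x) = {v. weak_order u \<subseteq> weak_order v}"
proof (intro set_eqI iffI)
  have anti: "antimono x" using assms by (simp add: decseq_Suc_iff less_imp_le)
  fix v
  {
    assume v: "v \<in> ncone (perm_face x (weak_order u)) (perm_polytope x)"
    have "v $ i \<le> v $ j" if ij: "u $ i \<le> u $ j" for i j
    proof (rule ccontr)
      assume gt: "\<not> v $ i \<le> v $ j"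
      then have ne: "i \<noteq> j" by auto
      \<comment> \<open>With \<open>j\<close> placed before \<open>i\<close>, the transposition
        moves the larger entry to \<open>i\<close>. If \<open>v\<close> were larger at
        \<open>i\<close> than at \<open>j\<close>, this would increase \<open>v\<close> beyond its
        value on the face.\<close>
      obtain \<sigma> where \<sigma>: "sorts u \<sigma>" "\<sigma> j < \<sigma> i" by (rule ex_sorts_before[OF ij ne])
      define \<rho> where "\<rho> = \<sigma> \<circ> Transposition.transpose i j"
      have "bij_betw \<rho> UNIV {..<CARD('d)}" unfolding \<rho>_def
        using \<sigma>(1) by (intro bij_betw_trans[of _ UNIV UNIV]) (auto simp: sorts_def)
      then have "arrangement x \<rho> \<in> perm_polytope x" unfolding perm_polytope_def by (auto intro: hull_inc)
      then have "v \<bullet> arrangement x \<rho> \<le> v \<bullet> arrangement x \<sigma>"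
        using v arrangement_in_perm_face[OF anti \<sigma>(1)] by (auto simp: ncone_def)
      moreover have "v \<bullet> arrangement x \<rho> - v \<bullet> arrangement x \<sigma> =
          (\<Sum>k\<in>UNIV. v $ k * (x (\<rho> k) - x (\<sigma> k)))"
        by (simp add: inner_vec_def arrangement_def sum_subtractf right_diff_distrib)
      moreover have "\<dots> = (\<Sum>k\<in>{i, j}. v $ k * (x (\<rho> k) - x (\<sigma> k)))"
        by (rule sum.mono_neutral_right) (auto simp: \<rho>_def transpose_apply_other)
      moreover have "\<dots> = (v $ i - v $ j) * (x (\<sigma> j) - x (\<sigma> i))"
        using ne by (simp add: \<rho>_def algebra_simps)
      moreover have "x (\<sigma> i) < x (\<sigma> j)"
        using \<sigma>(2) assms lift_Suc_mono_less[of "\<lambda>k. - x k"] by fastforce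
      ultimately show False using gt mult_pos_pos[of "v $ i - v $ j" "x (\<sigma> j) - x (\<sigma> i)"] by linarith
    qed
    then show "v \<in> {v. weak_order u \<subseteq> weak_order v}" by (auto simp: weak_order_def)
  next
    assume "v \<in> {v. weak_order u \<subseteq> weak_order v}"
    then have v: "weak_order u \<subseteq> weak_order v" by simp
    obtain \<sigma> where \<sigma>: "sorts u \<sigma>" by (rule ex_sorts)
    have "sorts v \<sigma>" using \<sigma> v by (auto simp: sorts_def weak_order_def)
    then show "v \<in> ncone (perm_face x (weak_order u)) (perm_polytope x)"
      using perm_face_maximal[OF _ \<sigma> v, of _ x] sorts_maximal[of v \<sigma> _ x]
      unfolding ncone_def perm_polytope_eq_majorized[OF anti] by simp
  }
qed

text \<open>The normal cone determines the weak order. This permits the sum over faces in McMullen's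
  formula to be reindexed by weak orders.\<close>

lemma inj_on_perm_face:
  assumes "\<And>k. x (Suc k) < x k"
  shows "inj_on (perm_face x) (range (weak_order :: real ^ 'd \<Rightarrow> _))"
proof (rule inj_onI, clarify)
  fix u v :: "real ^ 'd" assume "perm_face x (weak_order u) = perm_face x (weak_order v)"
  then have "{w. weak_order u \<subseteq> weak_order w} = {w. weak_order v \<subseteq> weak_order w}"
    using ncone_perm_face[of x, OF assms] by metis
  then show "weak_order u = weak_order v" by blast
qed

lemma permutohedron_eq_perm_polytope:
  "(permutohedron :: (real ^ 'd) set) = perm_polytope (\<lambda>k. real CARD('d) - real k)"
proof -
  let ?N = "CARD('d)"
  have r: "bij_betw (\<lambda>k. ?N - k) {..<?N} {1..?N}" "bij_betw (\<lambda>k. ?N - k) {1..?N} {..<?N}"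
    by (rule bij_betw_byWitness[where f'="\<lambda>k. ?N - k"]; auto)+
  have "{(\<chi> i. real (\<sigma> i)) :: real ^ 'd |\<sigma>. bij_betw \<sigma> UNIV {1..?N}} =
      {arrangement (\<lambda>k. real ?N - real k) \<sigma> |\<sigma>. bij_betw \<sigma> UNIV {..<?N}}" (is "?A = ?B")
  proof safe
    fix \<sigma> :: "'d \<Rightarrow> nat" assume \<sigma>: "bij_betw \<sigma> UNIV {1..?N}"
    then have le: "\<sigma> i \<le> ?N" for i using bij_betw_apply[OF \<sigma>, of i] by auto
    have "bij_betw ((\<lambda>k. ?N - k) \<circ> \<sigma>) UNIV {..<?N}" using bij_betw_trans[OF \<sigma> r(2)] .
    moreover have "(\<chi> i. real (\<sigma> i)) = arrangement (\<lambda>k. real ?N - real k) ((\<lambda>k. ?N - k) \<circ> \<sigma>)"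
      using le by (simp add: arrangement_def of_nat_diff)
    ultimately show "\<exists>\<sigma>'. (\<chi> i. real (\<sigma> i)) = arrangement (\<lambda>k. real ?N - real k) \<sigma>' \<and> bij_betw \<sigma>' UNIV {..<?N}"
      by blast
  next
    fix \<sigma> :: "'d \<Rightarrow> nat" assume \<sigma>: "bij_betw \<sigma> UNIV {..<?N}"
    then have le: "\<sigma> i \<le> ?N" for i using bij_betw_apply[OF \<sigma>, of i] by auto
    have "bij_betw ((\<lambda>k. ?N - k) \<circ> \<sigma>) UNIV {1..?N}" using bij_betw_trans[OF \<sigma> r(1)] .
    moreover have "arrangement (\<lambda>k. real ?N - real k) \<sigma> = (\<chi> i. real (((\<lambda>k. ?N - k) \<circ> \<sigma>) i))"
      using le by (simp add: arrangement_def of_nat_diff)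
    ultimately show "\<exists>\<sigma>'. arrangement (\<lambda>k. real ?N - real k) \<sigma> = (\<chi> i. real (\<sigma>' i)) \<and> bij_betw \<sigma>' UNIV {1..?N}"
      by blast
  qed
  then show ?thesis by (simp add: permutohedron_def perm_polytope_def)
qed

section \<open>Normalized volumes of faces\<close>

lemma psum_shift: "psum (\<lambda>i. x (N + i)) k = psum x (N + k) - psum x N"
  by (induction k) (auto simp: psum_Suc psum_0)

lemma psum_shift_mono:
  assumes "antimono x" "M \<le> N"
  shows "psum (\<lambda>i. x (N + i)) k \<le> psum (\<lambda>i. x (M + i)) k"
  unfolding psum_def using assms by (intro sum_mono) (auto simp: antimono_def)

definition level :: "real ^ 'd \<Rightarrow> real \<Rightarrow> 'd set"
  where "level u c = {i. u $ i = c}"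

definition above :: "real ^ 'd \<Rightarrow> real \<Rightarrow> 'd set"
  where "above u c = {i. c < u $ i}"

abbreviation level_values :: "real ^ 'd \<Rightarrow> real set"
  where "level_values u \<equiv> range (($) u)"

text \<open>The entries of \<open>x\<close> distributed over the level \<open>c\<close>: the
  coordinates above it have taken the first ones.\<close>

abbreviation segment :: "(nat \<Rightarrow> real) \<Rightarrow> real ^ 'd \<Rightarrow> real \<Rightarrow> nat \<Rightarrow> real"
  where "segment x u c \<equiv> (\<lambda>i. x (card (above u c) + i))"

lemma disjoint_level_above: "level u c \<inter> above u c = {}"
  by (auto simp: level_def above_def)

lemma up_set_level:
  fixes u :: "real ^ 'd"
  shows "weak_order u `` {j} = above u (u $ j) \<union> level u (u $ j)"
    and "card (weak_order u `` {j}) = card (above u (u $ j)) + card (level u (u $ j))"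
proof -
  show 1: "weak_order u `` {j} = above u (u $ j) \<union> level u (u $ j)"
    by (auto simp: weak_order_def level_def above_def)
  show "card (weak_order u `` {j}) = card (above u (u $ j)) + card (level u (u $ j))"
    unfolding 1 using disjoint_level_above[of u] by (intro card_Un_disjoint) auto
qed

lemma above_empty_or_up_set:
  fixes u :: "real ^ 'd"
  shows "above u c = {} \<or> (\<exists>j. above u c = weak_order u `` {j})"
proof (cases "above u c = {}")
  case False
  then have "Min (($) u ` above u c) \<in> ($) u ` above u c" by (intro Min_in) auto
  then obtain j where j: "j \<in> above u c" "u $ j = Min (($) u ` above u c)" by auto
  have "above u c = weak_order u `` {j}"
  proof (intro set_eqI iffI)
    fix i assume "i \<in> above u c"
    then have "u $ j \<le> u $ i" using j(2) by simp
    then show "i \<in> weak_order u `` {j}" by (simp add: weak_order_def)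
  next
    fix i assume "i \<in> weak_order u `` {j}"
    then have "u $ j \<le> u $ i" by (simp add: weak_order_def)
    then show "i \<in> above u c" using j(1) unfolding above_def by simp
  qed
  then show ?thesis by blast
qed simp

text \<open>The face is a product of permutohedra, one for each level. To recover the inequality for
  an arbitrary \<open>A\<close>, its lowest level is split off: the rest lies above that level,
  hence is no larger than \<open>above u c\<close>, and an earlier segment of a nonincreasing
  \<open>x\<close> has larger partial sums.\<close>

lemma perm_face_iff_levels:
  fixes u z :: "real ^ 'd"
  assumes "antimono x"
  shows "z \<in> perm_face x (weak_order u) \<longleftrightarrow>
    (\<forall>c\<in>level_values u. (\<Sum>i\<in>level u c. z $ i) = psum (segment x u c) (card (level u c)) \<and>
      (\<forall>A\<subseteq>level u c. (\<Sum>i\<in>A. z $ i) \<le> psum (segment x u c) (card A)))"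
    (is "?L \<longleftrightarrow> (\<forall>c\<in>level_values u. ?E c \<and> (\<forall>A\<subseteq>level u c. ?I c A))")
proof
  assume L: ?L
  have le: "(\<Sum>i\<in>A. z $ i) \<le> psum x (card A)" for A using L by (simp add: perm_face_def majorized_def)
  have up: "(\<Sum>i\<in>weak_order u `` {j}. z $ i) = psum x (card (weak_order u `` {j}))" for j
    using L by (simp add: perm_face_def)
  have ab: "(\<Sum>i\<in>above u c. z $ i) = psum x (card (above u c))" for c
    using above_empty_or_up_set[of u c] up by (auto simp: psum_0)
  have dis: "(\<Sum>i\<in>above u c \<union> A. z $ i) = (\<Sum>i\<in>above u c. z $ i) + (\<Sum>i\<in>A. z $ i)"
    "card (above u c \<union> A) = card (above u c) + card A" if "A \<subseteq> level u c" for A c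
  proof -
    have "above u c \<inter> A = {}" using that disjoint_level_above[of u c] by blast
    then show "(\<Sum>i\<in>above u c \<union> A. z $ i) = (\<Sum>i\<in>above u c. z $ i) + (\<Sum>i\<in>A. z $ i)"
      "card (above u c \<union> A) = card (above u c) + card A"
      by (auto intro: sum.union_disjoint card_Un_disjoint)
  qed
  show "\<forall>c\<in>level_values u. ?E c \<and> (\<forall>A\<subseteq>level u c. ?I c A)"
  proof (intro ballI conjI allI impI)
    fix c assume "c \<in> level_values u"
    then obtain j where j: "c = u $ j" by auto
    show "?E c" unfolding psum_shift
      using up[of j] ab[of c] dis[of "level u c" c] up_set_level[of u j] j by simp
    show "?I c A" if "A \<subseteq> level u c" for A unfolding psum_shift
      using le[of "above u c \<union> A"] ab[of c] dis[OF that] by simp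
  qed
next
  assume R: "\<forall>c\<in>level_values u. ?E c \<and> (\<forall>A\<subseteq>level u c. ?I c A)"
  have min: "\<exists>c\<in>level_values u. A \<inter> level u c \<noteq> {} \<and> A - level u c \<subseteq> above u c" if "A \<noteq> {}" for A
  proof -
    have "Min (($) u ` A) \<in> ($) u ` A" using that by (intro Min_in) auto
    then obtain j where j: "j \<in> A" "u $ j = Min (($) u ` A)" by auto
    then have "u $ j \<le> u $ i" if "i \<in> A" for i using that by simp
    then have "A - level u (u $ j) \<subseteq> above u (u $ j)" by (force simp: above_def level_def)
    moreover have "j \<in> A \<inter> level u (u $ j)" using j by (simp add: level_def)
    ultimately show ?thesis by blast
  qed
  have le: "(\<Sum>i\<in>A. z $ i) \<le> psum x (card A)" for A
  proof (induction "card A" arbitrary: A rule: less_induct)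
    case less
    show ?case
    proof (cases "A = {}")
      case False
      obtain c where "c \<in> level_values u" and "A \<inter> level u c \<noteq> {} \<and> A - level u c \<subseteq> above u c"
        using min[OF False] by (rule bexE)
      then have c: "c \<in> level_values u" "A \<inter> level u c \<noteq> {}" "A - level u c \<subseteq> above u c"
        by simp_all
      let ?A = "A - level u c"
      have lt: "card ?A < card A" using c(2) by (intro psubset_card_mono) auto
      have split: "A = ?A \<union> (A \<inter> level u c)" by auto
      have cs: "card A = card ?A + card (A \<inter> level u c)"
        by (subst split, rule card_Un_disjoint) auto
      have "(\<Sum>i\<in>A. z $ i) = (\<Sum>i\<in>?A. z $ i) + (\<Sum>i\<in>A \<inter> level u c. z $ i)"
        by (subst split, rule sum.union_disjoint) auto
      also have "\<dots> \<le> psum x (card ?A) + psum (segment x u c) (card (A \<inter> level u c))"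
        using less[OF lt] R c(1) by (intro add_mono) auto
      also have "\<dots> \<le> psum x (card ?A) + psum (\<lambda>i. x (card ?A + i)) (card (A \<inter> level u c))"
        using psum_shift_mono[OF assms, of "card ?A" "card (above u c)"] card_mono[OF _ c(3)] by simp
      also have "\<dots> = psum x (card A)" unfolding psum_shift cs by simp
      finally show ?thesis .
    qed (simp add: psum_0)
  qed
  have eq: "(\<Sum>i\<in>A. z $ i) = psum x (card A)" if "\<And>i k. i \<in> A \<Longrightarrow> u $ i \<le> u $ k \<Longrightarrow> k \<in> A" for A
    using that
  proof (induction "card A" arbitrary: A rule: less_induct)
    case less
    show ?case
    proof (cases "A = {}")
      case False
      obtain c where "c \<in> level_values u" and "A \<inter> level u c \<noteq> {} \<and> A - level u c \<subseteq> above u c"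
        using min[OF False] by (rule bexE)
      then have c: "c \<in> level_values u" "A \<inter> level u c \<noteq> {}" "A - level u c \<subseteq> above u c"
        by simp_all
      then obtain j where j: "j \<in> A" "u $ j = c" by (auto simp: level_def)
      have "above u c \<subseteq> A" "level u c \<subseteq> A"
        using less.prems[OF j(1)] j(2) by (auto simp: above_def level_def)
      then have A: "A = above u c \<union> level u c" using c(3) by auto
      have lt: "card (above u c) < card A"
        unfolding A using j disjoint_level_above[of u c] by (intro psubset_card_mono) (auto simp: level_def)
      have IH: "(\<Sum>i\<in>above u c. z $ i) = psum x (card (above u c))"
        by (rule less.hyps[OF lt]) (auto simp: above_def)
      have cs: "card A = card (above u c) + card (level u c)"
        unfolding A using disjoint_level_above[of u c] by (intro card_Un_disjoint) auto
      have "(\<Sum>i\<in>A. z $ i) = (\<Sum>i\<in>above u c. z $ i) + (\<Sum>i\<in>level u c. z $ i)"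
        unfolding A using disjoint_level_above[of u c] by (intro sum.union_disjoint) auto
      then show ?thesis using IH R c(1) cs by (simp add: psum_shift)
    qed (simp add: psum_0)
  qed
  have "(\<Sum>i\<in>weak_order u `` {j}. z $ i) = psum x (card (weak_order u `` {j}))" for j
    by (rule eq) (auto simp: weak_order_def)
  moreover have "(\<Sum>i\<in>UNIV. z $ i) = psum x CARD('d)" by (rule eq) auto
  ultimately show ?L using le by (simp add: perm_face_def majorized_def)
qed

section \<open>Direction space and lattice of a face\<close>

definition zero_sum :: "real ^ 'd \<Rightarrow> (real ^ 'd) set"
  where "zero_sum u = {w. \<forall>c. (\<Sum>i\<in>level u c. w $ i) = 0}"

text \<open>On each level the coordinate \<open>rep\<close> is eliminated by the fixed level sum;
  the other coordinates are \<open>free\<close>.\<close>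

definition rep :: "real ^ 'd \<Rightarrow> real \<Rightarrow> 'd"
  where "rep u c = (SOME i. u $ i = c)"

definition free :: "real ^ 'd \<Rightarrow> 'd set"
  where "free u = {i. rep u (u $ i) \<noteq> i}"

definition edge :: "real ^ 'd \<Rightarrow> 'd \<Rightarrow> real ^ 'd"
  where "edge u i = axis i 1 - axis (rep u (u $ i)) 1"

lemma rep_level: "u $ (rep u (u $ i)) = u $ i"
  unfolding rep_def by (rule someI[of "\<lambda>k. u $ k = u $ i" i]) simp

lemma level_eq_insert_rep:
  fixes u :: "real ^ 'd"
  shows "c \<in> level_values u \<Longrightarrow> level u c = insert (rep u c) (level u c \<inter> free u)"
    and "rep u c \<notin> level u c \<inter> free u"
  using rep_level by (auto simp: level_def free_def)

lemma edge_zero_sum: "edge u i \<in> zero_sum u"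
proof -
  have "(\<Sum>k\<in>level u c. edge u i $ k) = (if i \<in> level u c then 1 else 0) - (if rep u (u $ i) \<in> level u c then 1 else 0)" for c
    by (simp add: edge_def axis_def sum_subtractf if_distrib[of "\<lambda>a. a = _"] sum.delta)
  moreover have "i \<in> level u c \<longleftrightarrow> rep u (u $ i) \<in> level u c" for c
    by (simp add: level_def rep_level)
  ultimately show ?thesis by (simp add: zero_sum_def)
qed

lemma subspace_zero_sum: "subspace (zero_sum u)"
  by (auto simp: subspace_def zero_sum_def sum.distrib sum_distrib_left[symmetric])

lemma edge_nth_free:
  assumes "i \<in> free u" "k \<in> free u"
  shows "edge u i $ k = (if i = k then 1 else 0)"
proof -
  have "rep u (u $ i) \<noteq> k" using assms rep_level[of u i] by (auto simp: free_def)
  then show ?thesis by (auto simp: edge_def axis_def)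
qed

lemma sum_edge_nth:
  assumes "k \<in> free u"
  shows "(\<Sum>i\<in>free u. a i *\<^sub>R edge u i) $ k = a k"
proof -
  have "(\<Sum>i\<in>free u. a i *\<^sub>R edge u i) $ k = (\<Sum>i\<in>free u. if i = k then a i else 0)"
    unfolding sum_component vector_scaleR_component using assms
    by (intro sum.cong) (simp_all add: edge_nth_free)
  then show ?thesis using assms by (simp add: sum.delta)
qed

lemma zero_sum_eqI:
  assumes "v \<in> zero_sum u" "w \<in> zero_sum u" "\<And>i. i \<in> free u \<Longrightarrow> v $ i = w $ i"
  shows "v = w"
proof -
  have "v $ rep u c = w $ rep u c" if "c \<in> level_values u" for c
  proof -
    have split: "(\<Sum>i\<in>level u c. v $ i) = v $ rep u c + (\<Sum>i\<in>level u c \<inter> free u. v $ i)" for v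
      by (subst level_eq_insert_rep(1)[OF that], rule sum.insert) (use level_eq_insert_rep(2)[of u c] in auto)
    have "(\<Sum>i\<in>level u c \<inter> free u. v $ i) = (\<Sum>i\<in>level u c \<inter> free u. w $ i)"
      using assms(3) by (intro sum.cong) auto
    then show ?thesis using assms(1,2) split[of v] split[of w] unfolding zero_sum_def by simp
  qed
  then have "v $ i = w $ i" for i
    using assms(3)[of i] unfolding free_def by (metis (mono_tags) mem_Collect_eq rangeI)
  then show ?thesis by (simp add: vec_eq_iff)
qed

lemma sum_edge_zero_sum: "(\<Sum>i\<in>free u. a i *\<^sub>R edge u i) \<in> zero_sum u"
  by (intro subspace_sum subspace_scale subspace_zero_sum edge_zero_sum)

lemma zero_sum_expand:
  assumes "w \<in> zero_sum u"
  shows "w = (\<Sum>i\<in>free u. w $ i *\<^sub>R edge u i)"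
  using assms by (intro zero_sum_eqI[of w u]) (simp_all add: sum_edge_nth sum_edge_zero_sum del: sum_component)

text \<open>The coefficient of \<open>edge u i\<close> in a vector of \<open>zero_sum u\<close> is
  the coordinate of the vector at \<open>i\<close>, so integer vectors have integer
  coefficients.\<close>

lemma ex_lattice_basis_zero_sum:
  fixes u :: "real ^ 'd"
  shows "is_lattice_basis (edge u ` free u) (zero_sum u)"
proof -
  have inj: "inj_on (edge u) (free u)"
    by (rule inj_onI) (metis edge_nth_free zero_neq_one)
  have sum_edges: "(\<Sum>b\<in>edge u ` free u. g b *\<^sub>R b) = (\<Sum>i\<in>free u. g (edge u i) *\<^sub>R edge u i)" for g
    by (subst sum.reindex[OF inj]) simp
  have "independent (edge u ` free u)"
  proof (rule independent_if_scalars_zero)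
    fix g b assume *: "(\<Sum>b\<in>edge u ` free u. g b *\<^sub>R b) = 0" "b \<in> edge u ` free u"
    then obtain k where k: "k \<in> free u" "b = edge u k" by auto
    have "(\<Sum>i\<in>free u. g (edge u i) *\<^sub>R edge u i) $ k = 0" using *(1) unfolding sum_edges by simp
    then show "g b = 0" using k sum_edge_nth[OF k(1), of "\<lambda>i. g (edge u i)"] by simp
  qed simp
  moreover have "span (edge u ` free u) = zero_sum u"
  proof
    show "span (edge u ` free u) \<subseteq> zero_sum u"
      by (intro span_minimal subspace_zero_sum) (auto simp: edge_zero_sum)
    show "zero_sum u \<subseteq> span (edge u ` free u)"
    proof
      fix w assume "w \<in> zero_sum u"
      from zero_sum_expand[OF this] show "w \<in> span (edge u ` free u)"
        by (metis (no_types, lifting) image_eqI span_base span_scale span_sum)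
    qed
  qed
  moreover have "zero_sum u \<inter> int_lattice = {\<Sum>b\<in>edge u ` free u. of_int (c b) *\<^sub>R b |c :: real ^ 'd \<Rightarrow> int. True}"
  proof (intro set_eqI iffI)
    fix w assume w: "w \<in> zero_sum u \<inter> int_lattice"
    define c where "c b = \<lfloor>w $ the_inv_into (free u) (edge u) b\<rfloor>" for b
    have "of_int (c (edge u i)) = w $ i" if "i \<in> free u" for i
      using w unfolding c_def the_inv_into_f_f[OF inj that] by (simp add: int_lattice_def)
    then have "w = (\<Sum>b\<in>edge u ` free u. of_int (c b) *\<^sub>R b)"
      unfolding sum_edges using zero_sum_expand[of w u] w by simp
    then show "w \<in> {\<Sum>b\<in>edge u ` free u. of_int (c b) *\<^sub>R b |c :: real ^ 'd \<Rightarrow> int. True}" by blast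
  next
    fix w assume "w \<in> {\<Sum>b\<in>edge u ` free u. of_int (c b) *\<^sub>R b |c :: real ^ 'd \<Rightarrow> int. True}"
    then obtain c :: "real ^ 'd \<Rightarrow> int" where w: "w = (\<Sum>i\<in>free u. of_int (c (edge u i)) *\<^sub>R edge u i)"
      unfolding sum_edges by blast
    have "edge u i $ k \<in> \<int>" for i k by (auto simp: edge_def axis_def)
    then have "w $ k \<in> \<int>" for k unfolding w sum_component vector_scaleR_component by (intro Ints_sum) simp
    then show "w \<in> zero_sum u \<inter> int_lattice" using sum_edge_zero_sum w by (auto simp: int_lattice_def)
  qed
  ultimately show ?thesis by (simp add: is_lattice_basis_def)
qed

lemma subspace_lin:
  fixes A :: "(real ^ 'd) set"
  assumes "A \<noteq> {}"
  shows "subspace (lin A)"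
proof -
  obtain p where "p \<in> A" using assms by auto
  then have p: "p \<in> affine hull A" by (rule hull_inc)
  have "lin A = (\<lambda>x. x - p) ` (affine hull A)"
  proof (intro set_eqI iffI)
    fix w assume "w \<in> lin A"
    then obtain x y where xy: "w = x - y" "x \<in> affine hull A" "y \<in> affine hull A" by (auto simp: lin_def)
    have "p + 1 *\<^sub>R (x - y) \<in> affine hull A"
      by (rule mem_affine_3_minus) (use p xy in auto)
    then show "w \<in> (\<lambda>x. x - p) ` (affine hull A)" using xy(1) by (intro image_eqI[of _ _ "p + w"]) auto
  qed (use p in \<open>auto simp: lin_def\<close>)
  then show ?thesis using affine_diffs_subspace_subtract[OF affine_affine_hull p] by simp
qed

lemma sorts_transpose:
  fixes u :: "real ^ 'd"
  assumes "sorts u \<sigma>" "u $ i = u $ j"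
  shows "sorts u (\<sigma> \<circ> Transposition.transpose i j)"
proof -
  have "bij_betw (\<sigma> \<circ> Transposition.transpose i j) UNIV {..<CARD('d)}"
    using assms(1) by (intro bij_betw_trans[of _ UNIV UNIV]) (auto simp: sorts_def)
  moreover have "u $ Transposition.transpose i j k = u $ k" for k
    using assms(2) by (simp add: Transposition.transpose_def)
  ultimately show ?thesis using assms(1) unfolding sorts_def comp_def by metis
qed

text \<open>Level sums are constant on the face, which gives one inclusion. For the other,
  exchanging the entries at \<open>i\<close> and at the representative of its level stays in the
  face and moves by a multiple of \<open>edge u i\<close>, nonzero because \<open>x\<close> is
  strictly decreasing.\<close>

lemma lin_perm_face:
  fixes u :: "real ^ 'd"
  assumes x: "\<And>k. x (Suc k) < x k"
  shows "lin (perm_face x (weak_order u)) = zero_sum u"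
proof
  have anti: "antimono x" using x by (simp add: decseq_Suc_iff less_imp_le)
  let ?F = "perm_face x (weak_order u)"
  obtain \<sigma> where \<sigma>: "sorts u \<sigma>" by (rule ex_sorts)
  define p where "p = arrangement x \<sigma>"
  have p: "p \<in> ?F" unfolding p_def by (rule arrangement_in_perm_face[OF anti \<sigma>])
  have sub: "?F \<subseteq> (\<lambda>w. p + w) ` zero_sum u"
  proof
    fix z assume z: "z \<in> ?F"
    have "(\<Sum>i\<in>level u c. (z - p) $ i) = 0" for c
    proof (cases "c \<in> level_values u")
      case True
      have "(\<Sum>i\<in>level u c. q $ i) = psum (segment x u c) (card (level u c))" if "q \<in> ?F" for q
        using that True unfolding perm_face_iff_levels[OF anti] by blast
      from this[OF z] this[OF p] show ?thesis by (simp add: sum_subtractf)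
    next
      case False
      then have "level u c = {}" by (auto simp: level_def)
      then show ?thesis by simp
    qed
    then have "z - p \<in> zero_sum u" by (simp add: zero_sum_def)
    then show "z \<in> (\<lambda>w. p + w) ` zero_sum u" by (intro image_eqI[of _ _ "z - p"]) auto
  qed
  have "affine ((\<lambda>w. p + w) ` zero_sum u)"
    using subspace_imp_affine[OF subspace_zero_sum[of u]] affine_translation[of "zero_sum u" p] by simp
  then have hull: "affine hull ?F \<subseteq> (\<lambda>w. p + w) ` zero_sum u" using sub by (simp add: hull_minimal)
  show "lin ?F \<subseteq> zero_sum u"
  proof
    fix w assume "w \<in> lin ?F"
    then obtain a b where "w = a - b" "a \<in> affine hull ?F" "b \<in> affine hull ?F" unfolding lin_def by blast
    then obtain a' b' where ab: "a' \<in> zero_sum u" "b' \<in> zero_sum u" "w = (p + a') - (p + b')"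
      using hull by blast
    then show "w \<in> zero_sum u" using subspace_diff[OF subspace_zero_sum ab(1,2)] by simp
  qed
  have sp: "subspace (lin ?F)" using p by (intro subspace_lin) auto
  have edge: "edge u i \<in> lin ?F" for i
  proof (cases "rep u (u $ i) = i")
    case True
    then show ?thesis using subspace_0[OF sp] by (simp add: edge_def)
  next
    case False
    define j where "j = rep u (u $ i)"
    have j: "i \<noteq> j" "u $ i = u $ j" using False rep_level[of u i] by (auto simp: j_def)
    define \<rho> where "\<rho> = \<sigma> \<circ> Transposition.transpose i j"
    have q: "arrangement x \<rho> \<in> ?F" unfolding \<rho>_def by (intro arrangement_in_perm_face anti sorts_transpose \<sigma> j)
    have "p - arrangement x \<rho> = (x (\<sigma> i) - x (\<sigma> j)) *\<^sub>R edge u i"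
    proof (intro vec_eq_iff[THEN iffD2] allI)
      fix k
      show "(p - arrangement x \<rho>) $ k = ((x (\<sigma> i) - x (\<sigma> j)) *\<^sub>R edge u i) $ k"
        using j(1) unfolding p_def \<rho>_def edge_def j_def[symmetric]
        by (cases "k = i"; cases "k = j") (auto simp: arrangement_def axis_def transpose_apply_other)
    qed
    moreover have "p - arrangement x \<rho> \<in> lin ?F"
      using p q unfolding lin_def by (blast intro: hull_inc)
    moreover have "x (\<sigma> i) \<noteq> x (\<sigma> j)"
    proof -
      have "inj \<sigma>" using \<sigma> by (auto simp: sorts_def bij_betw_def)
      then have ne: "\<sigma> i \<noteq> \<sigma> j" using j(1) by (auto dest: injD)
      have "x b < x a" if "a < b" for a b
        using lift_Suc_mono_less[of "\<lambda>k. - x k" a b] x that by simp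
      then show ?thesis using ne by (metis less_irrefl linorder_neqE_nat)
    qed
    ultimately show ?thesis
      using subspace_scale[OF sp, of "(x (\<sigma> i) - x (\<sigma> j)) *\<^sub>R edge u i" "1 / (x (\<sigma> i) - x (\<sigma> j))"] by simp
  qed
  show "zero_sum u \<subseteq> lin ?F"
  proof
    fix w assume "w \<in> zero_sum u"
    then have "w = (\<Sum>i\<in>free u. w $ i *\<^sub>R edge u i)" by (rule zero_sum_expand)
    moreover have "(\<Sum>i\<in>free u. w $ i *\<^sub>R edge u i) \<in> lin ?F"
      by (intro subspace_sum subspace_scale sp edge)
    ultimately show "w \<in> lin ?F" by simp
  qed
qed

text \<open>The projection of the face to the free coordinates, a product of one
  \<open>perm_body\<close> for each level.\<close>

definition face_coords :: "(nat \<Rightarrow> real) \<Rightarrow> real ^ 'd \<Rightarrow> ('d \<Rightarrow> real) set"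
  where "face_coords x u = {z \<in> free u \<rightarrow>\<^sub>E UNIV.
    \<forall>c\<in>level_values u. restrict z (level u c \<inter> free u) \<in> perm_body (level u c \<inter> free u) (segment x u c)}"

text \<open>Once the total is known, an upper bound for a set containing \<open>r\<close> is a lower
  bound for its complement, which lies in \<open>J\<close>.\<close>

lemma perm_body_restrict_iff:
  fixes q :: "'a \<Rightarrow> real"
  assumes "finite J" "r \<notin> J" "sum q (insert r J) = psum s (Suc (card J))"
  shows "restrict q J \<in> perm_body J s \<longleftrightarrow> (\<forall>A\<subseteq>insert r J. sum q A \<le> psum s (card A))"
proof -
  let ?L = "insert r J"
  have fin: "finite A" if "A \<subseteq> ?L" for A using that assms(1) finite_subset by blast
  have compl: "sum q (?L - A) = psum s (Suc (card J)) - sum q A" "card (?L - A) = Suc (card J) - card A"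
    if "A \<subseteq> ?L" for A
    using that assms fin[OF that] by (simp_all add: sum_diff card_Diff_subset)
  have "restrict q J \<in> perm_body J s \<longleftrightarrow>
      (\<forall>A\<subseteq>J. psum s (Suc (card J)) - psum s (Suc (card J) - card A) \<le> sum q A \<and> sum q A \<le> psum s (card A))"
  proof -
    have "sum (restrict q J) A = sum q A" if "A \<subseteq> J" for A using that by (intro sum.cong) auto
    then show ?thesis by (auto simp: perm_body_def)
  qed
  also have "\<dots> \<longleftrightarrow> (\<forall>A\<subseteq>?L. sum q A \<le> psum s (card A))"
  proof (intro iffI allI impI)
    fix A assume *: "\<forall>A\<subseteq>J. psum s (Suc (card J)) - psum s (Suc (card J) - card A) \<le> sum q A \<and> sum q A \<le> psum s (card A)"
      and A: "A \<subseteq> ?L"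
    show "sum q A \<le> psum s (card A)"
    proof (cases "r \<in> A")
      case True
      then have J: "?L - A \<subseteq> J" by auto
      have "card A \<le> card ?L" using A assms(1) by (intro card_mono) auto
      then have "Suc (card J) - card (?L - A) = card A" using compl(2)[OF A] assms by simp
      moreover have "psum s (Suc (card J)) - psum s (Suc (card J) - card (?L - A)) \<le> sum q (?L - A)"
        using * J by blast
      ultimately show ?thesis using compl(1)[OF A] by simp
    next
      case False
      then have "A \<subseteq> J" using A by auto
      then show ?thesis using * by blast
    qed
  next
    fix A assume *: "\<forall>A\<subseteq>?L. sum q A \<le> psum s (card A)" and A: "A \<subseteq> J"
    then have AL: "A \<subseteq> ?L" by auto
    have "sum q (?L - A) \<le> psum s (card (?L - A))" "sum q A \<le> psum s (card A)" using *[rule_format, OF AL] *[rule_format, of "?L - A"] by auto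
    then show "psum s (Suc (card J)) - psum s (Suc (card J) - card A) \<le> sum q A \<and> sum q A \<le> psum s (card A)"
      unfolding compl[OF AL] by simp
  qed
  finally show ?thesis .
qed

lemma perm_face_iff_coords:
  fixes u q :: "real ^ 'd"
  assumes "antimono x"
    and "\<And>c. c \<in> level_values u \<Longrightarrow> (\<Sum>i\<in>level u c. q $ i) = psum (segment x u c) (card (level u c))"
  shows "q \<in> perm_face x (weak_order u) \<longleftrightarrow> restrict (($) q) (free u) \<in> face_coords x u"
proof -
  have "restrict (restrict (($) q) (free u)) (level u c \<inter> free u) \<in> perm_body (level u c \<inter> free u) (segment x u c)
      \<longleftrightarrow> (\<forall>A\<subseteq>level u c. (\<Sum>i\<in>A. q $ i) \<le> psum (segment x u c) (card A))"
    if c: "c \<in> level_values u" for c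
  proof -
    let ?J = "level u c \<inter> free u"
    have L: "level u c = insert (rep u c) ?J" and r: "rep u c \<notin> ?J"
      using level_eq_insert_rep(1)[OF c] level_eq_insert_rep(2)[of u c] by auto
    have card: "card (level u c) = Suc (card ?J)" by (subst L) (use r in simp)
    have "sum (($) q) (insert (rep u c) ?J) = psum (segment x u c) (Suc (card ?J))"
      using assms(2)[OF c] card L by simp
    from perm_body_restrict_iff[OF _ r this]
    have "restrict (($) q) ?J \<in> perm_body ?J (segment x u c) \<longleftrightarrow>
      (\<forall>A\<subseteq>level u c. (\<Sum>i\<in>A. q $ i) \<le> psum (segment x u c) (card A))" using L by simp
    moreover have "restrict (restrict (($) q) (free u)) ?J = restrict (($) q) ?J"
      by (simp add: Int_absorb1 Int_commute)
    ultimately show ?thesis by simp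
  qed
  then show ?thesis
    using assms(2) by (simp add: perm_face_iff_levels[OF assms(1)] face_coords_def)
qed

lemma face_coords_measure:
  fixes u :: "real ^ 'd"
  assumes "antimono x"
  shows "face_coords x u \<in> sets (PiM (free u) (\<lambda>_. lborel))"
    and "measure (PiM (free u) (\<lambda>_. lborel)) (face_coords x u) =
      (\<Prod>c\<in>level_values u. perm_vol (card (level u c) - 1) (segment x u c))"
proof -
  let ?J = "\<lambda>c. level u c \<inter> free u"
  have UN: "(\<Union>c\<in>level_values u. ?J c) = free u" by (auto simp: level_def)
  have card: "card (?J c) = card (level u c) - 1" if "c \<in> level_values u" for c
    by (subst (2) level_eq_insert_rep(1)[OF that]) (use level_eq_insert_rep(2)[of u c] in simp)
  have seg: "antimono (segment x u c)" for c using assms by (auto simp: antimono_def)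
  have blocks: "{z \<in> (\<Union>c\<in>level_values u. ?J c) \<rightarrow>\<^sub>E UNIV. \<forall>c\<in>level_values u. restrict z (?J c) \<in> perm_body (?J c) (segment x u c)}
        \<in> sets (PiM (\<Union>c\<in>level_values u. ?J c) (\<lambda>_. lborel))
      \<and> emeasure (PiM (\<Union>c\<in>level_values u. ?J c) (\<lambda>_. lborel))
      {z \<in> (\<Union>c\<in>level_values u. ?J c) \<rightarrow>\<^sub>E UNIV. \<forall>c\<in>level_values u. restrict z (?J c) \<in> perm_body (?J c) (segment x u c)} =
      (\<Prod>c\<in>level_values u. emeasure (PiM (?J c) (\<lambda>_. lborel)) (perm_body (?J c) (segment x u c)))"
    by (rule emeasure_PiM_blocks) (auto simp: disjoint_family_on_def level_def intro: sets_perm_body)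
  show "face_coords x u \<in> sets (PiM (free u) (\<lambda>_. lborel))"
    using blocks unfolding UN face_coords_def[symmetric] by simp
  have "emeasure (PiM (free u) (\<lambda>_. lborel)) (face_coords x u) =
      (\<Prod>c\<in>level_values u. ennreal (perm_vol (card (level u c) - 1) (segment x u c)))"
    using blocks unfolding UN face_coords_def[symmetric] by (simp add: emeasure_perm_body seg card)
  also have "\<dots> = ennreal (\<Prod>c\<in>level_values u. perm_vol (card (level u c) - 1) (segment x u c))"
    by (intro prod_ennreal perm_vol_nonneg seg)
  finally show "measure (PiM (free u) (\<lambda>_. lborel)) (face_coords x u) =
      (\<Prod>c\<in>level_values u. perm_vol (card (level u c) - 1) (segment x u c))"
    by (simp add: measure_def prod_nonneg perm_vol_nonneg seg)
qed

lemma measure_PiM_translate: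
  assumes "finite I" "A \<in> sets (PiM I (\<lambda>_. lborel :: real measure))"
  shows "{z \<in> I \<rightarrow>\<^sub>E UNIV. (\<lambda>i\<in>I. z i + w i) \<in> A} \<in> sets (PiM I (\<lambda>_. lborel))"
    and "measure (PiM I (\<lambda>_. lborel)) {z \<in> I \<rightarrow>\<^sub>E UNIV. (\<lambda>i\<in>I. z i + w i) \<in> A} = measure (PiM I (\<lambda>_. lborel)) A"
proof -
  let ?M = "PiM I (\<lambda>_. lborel :: real measure)"
  have [measurable]: "(\<lambda>z. \<lambda>i\<in>I. z i + w i) \<in> measurable ?M ?M"
    by (rule measurable_restrict) measurable
  have eq: "{z \<in> I \<rightarrow>\<^sub>E UNIV. (\<lambda>i\<in>I. z i + w i) \<in> A} = (\<lambda>z. \<lambda>i\<in>I. z i + w i) -` A \<inter> space ?M"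
    by (auto simp: space_PiM)
  show *: "{z \<in> I \<rightarrow>\<^sub>E UNIV. (\<lambda>i\<in>I. z i + w i) \<in> A} \<in> sets ?M"
    unfolding eq using assms(2) by measurable
  have "emeasure ?M {z \<in> I \<rightarrow>\<^sub>E UNIV. (\<lambda>i\<in>I. z i + w i) \<in> A} =
      (\<integral>\<^sup>+z. indicator {z \<in> I \<rightarrow>\<^sub>E UNIV. (\<lambda>i\<in>I. z i + w i) \<in> A} z \<partial>?M)" using * by simp
  also have "\<dots> = (\<integral>\<^sup>+z. indicator A (\<lambda>i\<in>I. z i + w i) \<partial>?M)"
    by (intro nn_integral_cong) (auto simp: space_PiM indicator_def)
  also have "\<dots> = emeasure ?M A"
    using assms by (subst nn_integral_PiM_translate) auto
  finally show "measure ?M {z \<in> I \<rightarrow>\<^sub>E UNIV. (\<lambda>i\<in>I. z i + w i) \<in> A} = measure ?M A"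
    by (simp add: measure_def)
qed

text \<open>\<open>nvol\<close> picks its basis by \<open>SOME\<close>, so it is compared with the
  free coordinates through a linear bijection, up to a factor. The factor is obtained before
  \<open>x\<close>, since \<open>lin\<close> of the face, and with it the chosen basis, depends only
  on \<open>u\<close>.\<close>

lemma nvol_perm_face:
  fixes u :: "real ^ 'd"
  obtains \<kappa> where "\<kappa> > 0"
    "\<And>x. (\<And>k. x (Suc k) < x k) \<Longrightarrow> nvol (perm_face x (weak_order u)) =
      \<kappa> * (\<Prod>c\<in>level_values u. perm_vol (card (level u c) - 1) (segment x u c))"
proof -
  define B where "B = (SOME B. is_lattice_basis B (zero_sum u))"
  have "is_lattice_basis B (zero_sum u)" unfolding B_def
    by (rule someI[of "\<lambda>B. is_lattice_basis B (zero_sum u)", OF ex_lattice_basis_zero_sum])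
  then have ind: "independent B" and span: "span B = zero_sum u" by (auto simp: is_lattice_basis_def)
  have fin: "finite B" using ind by (rule independent_imp_finite)
  let ?E = "free u" and ?MB = "PiM B (\<lambda>_. lborel :: real measure)" and ?ME = "PiM (free u) (\<lambda>_. lborel :: real measure)"
  \<comment> \<open>\<open>T\<close> reads off the free coordinates of a combination of
    \<open>B\<close>; \<open>S\<close> expands the corresponding combination of edges in
    \<open>B\<close> again.\<close>
  define T where "T = (\<lambda>c. \<lambda>i\<in>?E. \<Sum>b\<in>B. c b * b $ i)"
  define S where "S = (\<lambda>z. \<lambda>b\<in>B. \<Sum>i\<in>?E. z i * representation B (edge u i) b)"
  have zs: "(\<Sum>b\<in>B. c b *\<^sub>R b) \<in> zero_sum u" for c
    unfolding span[symmetric] by (intro span_sum span_scale span_base)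
  have rep_sum: "representation B (\<Sum>i\<in>?E. z i *\<^sub>R edge u i) = (\<lambda>b. \<Sum>i\<in>?E. z i * representation B (edge u i) b)" for z
  proof -
    have e: "edge u i \<in> span B" for i unfolding span by (rule edge_zero_sum)
    show ?thesis by (simp add: representation_sum[OF ind] representation_scale[OF ind] span_scale e)
  qed
  have T: "T \<in> measurable ?MB ?ME" unfolding T_def
    by (rule measurable_restrict) (auto intro!: borel_measurable_sum borel_measurable_times measurable_component_singleton)
  have S: "S \<in> measurable ?ME ?MB" unfolding S_def
    by (rule measurable_restrict) (auto intro!: borel_measurable_sum borel_measurable_times measurable_component_singleton)
  have ST: "S (T c) = c" if c: "c \<in> B \<rightarrow>\<^sub>E UNIV" for c
  proof -
    let ?w = "\<Sum>b\<in>B. c b *\<^sub>R b"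
    have "?w = (\<Sum>i\<in>?E. ?w $ i *\<^sub>R edge u i)" by (rule zero_sum_expand[OF zs])
    also have "\<dots> = (\<Sum>i\<in>?E. T c i *\<^sub>R edge u i)" by (simp add: T_def)
    finally have w: "?w = (\<Sum>i\<in>?E. T c i *\<^sub>R edge u i)" .
    have "representation B ?w b = c b" if "b \<in> B" for b
    proof -
      have "representation B ?w b = (\<Sum>b'\<in>B. representation B (c b' *\<^sub>R b') b)"
        using ind by (simp add: representation_sum span_base span_scale)
      also have "\<dots> = (\<Sum>b'\<in>B. if b' = b then c b' else 0)"
        using ind by (intro sum.cong) (auto simp: representation_scale span_base representation_basis)
      finally show ?thesis using that fin by simp
    qed
    then show ?thesis using c unfolding S_def rep_sum[symmetric] w[symmetric]
      by (auto simp: fun_eq_iff PiE_def extensional_def)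
  qed
  have TS: "T (S z) = z" if z: "z \<in> ?E \<rightarrow>\<^sub>E UNIV" for z
  proof -
    let ?w = "\<Sum>i\<in>?E. z i *\<^sub>R edge u i"
    have "?w \<in> span B" unfolding span by (rule sum_edge_zero_sum)
    then have "(\<Sum>b\<in>B. representation B ?w b *\<^sub>R b) = ?w"
      using ind fin by (intro sum_representation_eq) auto
    then have "(\<Sum>b\<in>B. S z b *\<^sub>R b) = ?w" unfolding S_def rep_sum by simp
    then have "(\<Sum>b\<in>B. S z b *\<^sub>R b) $ i = z i" if "i \<in> ?E" for i using sum_edge_nth[OF that] by simp
    then show ?thesis using z by (auto simp: T_def fun_eq_iff PiE_def extensional_def)
  qed
  have add: "T (\<lambda>i\<in>B. c i + w i) = (\<lambda>i\<in>?E. T c i + T w i)" for c w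
    by (auto simp: T_def fun_eq_iff sum.distrib distrib_right)
  obtain \<kappa> where \<kappa>: "\<kappa> > 0" "\<And>A. A \<in> sets ?ME \<Longrightarrow> measure ?MB (T -` A \<inter> (B \<rightarrow>\<^sub>E UNIV)) = \<kappa> * measure ?ME A"
    using PiM_linear_image[OF fin finite T S ST TS add] by blast
  show thesis
  proof (rule that[OF \<kappa>(1)])
    fix x :: "nat \<Rightarrow> real" assume x: "\<And>k. x (Suc k) < x k"
    then have anti: "antimono x" by (simp add: decseq_Suc_iff less_imp_le)
    let ?F = "perm_face x (weak_order u)"
    define p where "p = (SOME p. p \<in> ?F)"
    obtain \<sigma> where "sorts u \<sigma>" by (rule ex_sorts)
    then have "\<exists>p. p \<in> ?F" using arrangement_in_perm_face[OF anti] by blast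
    then have p: "p \<in> ?F" unfolding p_def by (rule someI_ex)
    \<comment> \<open>The base point \<open>p\<close> merely translates the region, so it does not
      affect the measure.\<close>
    define A where "A = {z \<in> ?E \<rightarrow>\<^sub>E UNIV. (\<lambda>i\<in>?E. z i + p $ i) \<in> face_coords x u}"
    have "{c \<in> B \<rightarrow>\<^sub>E UNIV. p + (\<Sum>b\<in>B. c b *\<^sub>R b) \<in> ?F} = T -` A \<inter> (B \<rightarrow>\<^sub>E UNIV)"
    proof -
      have "p + (\<Sum>b\<in>B. c b *\<^sub>R b) \<in> ?F \<longleftrightarrow> T c \<in> A" for c
      proof -
        let ?q = "p + (\<Sum>b\<in>B. c b *\<^sub>R b)"
        have "(\<Sum>i\<in>level u d. ?q $ i) = psum (segment x u d) (card (level u d))" if "d \<in> level_values u" for d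
        proof -
          have "(\<Sum>i\<in>level u d. p $ i) = psum (segment x u d) (card (level u d))"
            using p that unfolding perm_face_iff_levels[OF anti] by blast
          moreover have "(\<Sum>i\<in>level u d. (\<Sum>b\<in>B. c b *\<^sub>R b) $ i) = 0"
            using zs[of c] unfolding zero_sum_def by blast
          ultimately show ?thesis unfolding vector_add_component sum.distrib by simp
        qed
        from perm_face_iff_coords[OF anti this]
        have "?q \<in> ?F \<longleftrightarrow> restrict (($) ?q) ?E \<in> face_coords x u" by blast
        moreover have "restrict (($) ?q) ?E = (\<lambda>i\<in>?E. T c i + p $ i)"
          by (auto simp: T_def fun_eq_iff)
        moreover have "T c \<in> ?E \<rightarrow>\<^sub>E UNIV" by (auto simp: T_def)
        ultimately show ?thesis by (simp add: A_def)
      qed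
      then show ?thesis by auto
    qed
    then have "nvol ?F = measure ?MB (T -` A \<inter> (B \<rightarrow>\<^sub>E UNIV))"
      unfolding nvol_def lin_perm_face[of x u, OF x] Let_def B_def[symmetric] p_def[symmetric] by simp
    also have "\<dots> = \<kappa> * measure ?ME A"
      unfolding A_def by (intro \<kappa>(2) measure_PiM_translate face_coords_measure anti) simp
    also have "measure ?ME A = measure ?ME (face_coords x u)"
      unfolding A_def by (intro measure_PiM_translate face_coords_measure anti) simp
    also have "\<dots> = (\<Prod>c\<in>level_values u. perm_vol (card (level u c) - 1) (segment x u c))"
      by (rule face_coords_measure[OF anti])
    finally show "nvol ?F = \<kappa> * (\<Prod>c\<in>level_values u. perm_vol (card (level u c) - 1) (segment x u c))" .
  qed
qed

section \<open>Cut positions and uniqueness\<close>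

text \<open>For a weak order, the whole space is always an up-set and the empty set never is:
  \<open>CARD('d)\<close> is a cut and 0 is not. Hence the segments in \<open>comp_vol\<close> start
  at 0 or at a cut other than the last.\<close>

definition cuts :: "('d \<times> 'd) set \<Rightarrow> nat set"
  where "cuts R = range (\<lambda>j. card (R `` {j}))"

definition next_cut :: "nat set \<Rightarrow> nat \<Rightarrow> nat"
  where "next_cut C p = Min {k \<in> C. p < k}"

definition segment_vol :: "nat \<Rightarrow> nat \<Rightarrow> (nat \<Rightarrow> real) \<Rightarrow> real"
  where "segment_vol p q x = perm_vol (q - p - 1) (\<lambda>i. x (p + i))"

definition comp_vol :: "nat \<Rightarrow> nat set \<Rightarrow> (nat \<Rightarrow> real) \<Rightarrow> real"
  where "comp_vol N C x = (\<Prod>p\<in>insert 0 C - {N}. segment_vol p (next_cut C p) x)"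

lemma cuts_weak_order:
  fixes u :: "real ^ 'd"
  shows "cuts (weak_order u) = (\<lambda>c. card (above u c) + card (level u c)) ` level_values u"
  unfolding cuts_def up_set_level(2) by (auto simp: image_image)

lemma cuts_bounds:
  fixes u :: "real ^ 'd"
  shows "cuts (weak_order u) \<subseteq> {1..CARD('d)}" and "CARD('d) \<in> cuts (weak_order u)"
proof -
  have "card (weak_order u `` {j}) \<ge> 1" for j
  proof -
    have "j \<in> weak_order u `` {j}" by (simp add: weak_order_def)
    then show ?thesis by (metis One_nat_def Suc_leI card_gt_0_iff empty_iff finite)
  qed
  moreover have "card (weak_order u `` {j}) \<le> CARD('d)" for j by (simp add: card_mono)
  ultimately show "cuts (weak_order u) \<subseteq> {1..CARD('d)}" by (auto simp: cuts_def)
  have "Min (range (($) u)) \<in> range (($) u)" by (intro Min_in) auto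
  then obtain j where j: "Min (range (($) u)) = u $ j" by (rule rangeE)
  have "Min (range (($) u)) \<le> u $ i" for i by (intro Min_le) auto
  then have "u $ j \<le> u $ i" for i by (simp only: j)
  then have "weak_order u `` {j} = UNIV" by (auto simp: weak_order_def)
  then show "CARD('d) \<in> cuts (weak_order u)" unfolding cuts_def by (metis rangeI)
qed

text \<open>The number of coordinates above a level is the start of its segment; this is a bijection
  from levels to starts, and the next cut follows after as many entries as the level has
  coordinates.\<close>

lemma prod_levels_eq_comp_vol:
  fixes u :: "real ^ 'd"
  shows "(\<Prod>c\<in>level_values u. perm_vol (card (level u c) - 1) (segment x u c)) =
    comp_vol CARD('d) (cuts (weak_order u)) x"
proof -
  let ?h = "\<lambda>c. card (above u c)" and ?C = "cuts (weak_order u)"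
  have pos: "card (level u c) > 0" if "c \<in> level_values u" for c
    using that by (auto simp: card_gt_0_iff level_def)
  have le: "?h c' + card (level u c') \<le> ?h c" if "c < c'" for c c'
  proof -
    have "?h c' + card (level u c') = card (above u c' \<union> level u c')"
      using disjoint_level_above[of u c'] by (intro card_Un_disjoint[symmetric]) auto
    also have "\<dots> \<le> ?h c" using that by (intro card_mono) (auto simp: above_def level_def)
    finally show ?thesis .
  qed
  have inj: "inj_on ?h (level_values u)"
  proof (rule inj_onI)
    fix c c' assume "c \<in> level_values u" "c' \<in> level_values u" "?h c = ?h c'"
    then show "c = c'" using le[of c c'] le[of c' c] pos[of c] pos[of c'] by (cases c c' rule: linorder_cases) auto
  qed
  have img: "?h ` level_values u = insert 0 ?C - {CARD('d)}"
  proof (intro set_eqI iffI)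
    fix p assume "p \<in> ?h ` level_values u"
    then obtain c where c: "c \<in> level_values u" "p = ?h c" by auto
    then obtain j where j: "c = u $ j" by auto
    then have "j \<notin> above u c" by (simp add: above_def)
    then have "above u c \<subset> UNIV" by auto
    then have "p < CARD('d)" unfolding c(2) by (intro psubset_card_mono) auto
    moreover have "p \<in> insert 0 ?C"
      using above_empty_or_up_set[of u c] unfolding c(2) cuts_def by auto
    ultimately show "p \<in> insert 0 ?C - {CARD('d)}" by simp
  next
    fix p assume p: "p \<in> insert 0 ?C - {CARD('d)}"
    have "\<exists>A. p = card A \<and> A \<noteq> UNIV \<and> (\<forall>i\<in>A. \<forall>k. u $ i \<le> u $ k \<longrightarrow> k \<in> A)"
    proof (cases "p = 0")
      case True
      then show ?thesis by (intro exI[of _ "{}"]) auto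
    next
      case False
      then obtain j where "p = card (weak_order u `` {j})" using p by (auto simp: cuts_def)
      then show ?thesis using p by (intro exI[of _ "weak_order u `` {j}"]) (auto simp: weak_order_def)
    qed
    then obtain A where A: "p = card A" "A \<noteq> UNIV" "\<forall>i\<in>A. \<forall>k. u $ i \<le> u $ k \<longrightarrow> k \<in> A" by blast
    \<comment> \<open>A proper upward closed set is what lies above the largest value attained
      outside it.\<close>
    have "Max (($) u ` (- A)) \<in> ($) u ` (- A)" using A(2) by (intro Max_in) auto
    then obtain j where j: "j \<notin> A" "u $ j = Max (($) u ` (- A))" by auto
    then have max: "u $ i \<le> u $ j" if "i \<notin> A" for i using that by simp
    have "above u (u $ j) = A"
      using A(3) j(1) max by (auto simp: above_def) (meson not_le, metis linorder_not_le)
    then show "p \<in> ?h ` level_values u" using A(1) by auto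
  qed
  have nxt: "next_cut ?C (?h c) = ?h c + card (level u c)" if c: "c \<in> level_values u" for c
    unfolding next_cut_def
  proof (rule Min_eqI)
    have "finite ?C" by (rule finite_subset[OF cuts_bounds(1)]) simp
    then show "finite {k \<in> ?C. ?h c < k}" by simp
    show "?h c + card (level u c) \<in> {k \<in> ?C. ?h c < k}"
      using c pos[OF c] by (auto simp: cuts_weak_order)
    fix k assume "k \<in> {k \<in> ?C. ?h c < k}"
    then obtain c' where c': "c' \<in> level_values u" "k = ?h c' + card (level u c')" "?h c < k"
      by (auto simp: cuts_weak_order)
    then have "c' \<le> c" using le[of c c'] by force
    then show "?h c + card (level u c) \<le> k" using le[of c' c] c'(2) by (cases "c' = c") auto
  qed
  have "comp_vol CARD('d) ?C x = (\<Prod>c\<in>level_values u. segment_vol (?h c) (next_cut ?C (?h c)) x)"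
    unfolding comp_vol_def img[symmetric] by (subst prod.reindex[OF inj]) simp
  also have "\<dots> = (\<Prod>c\<in>level_values u. perm_vol (card (level u c) - 1) (segment x u c))"
    by (intro prod.cong) (simp_all add: nxt segment_vol_def)
  finally show ?thesis by simp
qed

text \<open>On the entries of the segment the weight is constantly 0 or constantly 1, and a constant
  only translates the permutohedron.\<close>

lemma segment_vol_invariant:
  assumes "i \<le> p \<or> q \<le> i" "p < q"
  shows "segment_vol p q (\<lambda>k. x k + weight i k) = segment_vol p q x"
  using assms(1)
proof
  assume "i \<le> p"
  then show ?thesis by (simp add: segment_vol_def weight_def)
next
  assume "q \<le> i"
  then have "segment_vol p q (\<lambda>k. x k + weight i k) = perm_vol (q - p - 1) (\<lambda>k. x (p + k) + 1)"
    unfolding segment_vol_def using assms(2) by (intro perm_vol_cong) (auto simp: weight_def)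
  then show ?thesis by (simp add: perm_vol_add_const segment_vol_def)
qed

lemma diffs_segment_vol:
  assumes "antimono x" "p < q"
  shows "diffs (map weight [Suc p..<q]) (segment_vol p q) x \<ge> 1"
proof -
  define L where "L y = (\<lambda>i. y (p + i))" for y :: "nat \<Rightarrow> real"
  define n where "n = q - p - 1"
  have q: "q = Suc n + p" using assms(2) by (simp add: n_def)
  have "[Suc p..<q] = map (\<lambda>i. i + p) [1..<Suc n]"
    unfolding q by (intro nth_equalityI) (auto simp del: upt_Suc)
  then have "map L (map weight [Suc p..<q]) = map (\<lambda>i. L (weight (i + p))) [1..<Suc n]" by simp
  also have "\<dots> = map weight [1..<Suc n]" by (intro map_cong) (auto simp: L_def weight_def)
  finally have "map L (map weight [Suc p..<q]) = map weight [1..<Suc n]" .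
  moreover have "antimono (L x)" using assms(1) by (auto simp: L_def antimono_def)
  ultimately have "diffs (map L (map weight [Suc p..<q])) (perm_vol n) (L x) \<ge> 1"
    using diffs_weights_perm_vol[of "L x" n] by simp
  moreover have "diffs (map weight [Suc p..<q]) (segment_vol p q) x =
      diffs (map L (map weight [Suc p..<q])) (perm_vol n) (L x)"
    using diffs_compose[of L "map weight [Suc p..<q]" "perm_vol n" x]
    unfolding segment_vol_def[abs_def] n_def[symmetric] by (simp add: L_def)
  ultimately show ?thesis by simp
qed

text \<open>A gap inside one segment leaves the other factors unchanged, so the difference of the
  product is the product of the differences. The list is only asserted to exist, because its order
  depends on the order of the induction and its set is all that matters later.\<close>

lemma diffs_prod_segment_vol:
  fixes q :: "nat \<Rightarrow> nat"
  assumes "finite P" "\<And>p. p \<in> P \<Longrightarrow> p < q p"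
    and "\<And>p p' i. p \<in> P \<Longrightarrow> p' \<in> P \<Longrightarrow> p \<noteq> p' \<Longrightarrow> p < i \<Longrightarrow> i < q p \<Longrightarrow> i \<le> p' \<or> q p' \<le> i"
  shows "\<exists>ks. set ks = (\<Union>p\<in>P. {p<..<q p}) \<and>
    (\<forall>x. antimono x \<longrightarrow> diffs (map weight ks) (\<lambda>x. \<Prod>p\<in>P. segment_vol p (q p) x) x \<ge> 1)"
  using assms
proof (induction P rule: finite_induct)
  case empty
  then show ?case by (intro exI[of _ "[]"]) auto
next
  case (insert p P)
  have "\<exists>ks. set ks = (\<Union>p\<in>P. {p<..<q p}) \<and>
    (\<forall>x. antimono x \<longrightarrow> diffs (map weight ks) (\<lambda>x. \<Prod>p\<in>P. segment_vol p (q p) x) x \<ge> 1)"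
    by (rule insert.IH) (use insert.prems in auto)
  then obtain ks where ks: "set ks = (\<Union>p\<in>P. {p<..<q p})"
    "\<And>x. antimono x \<Longrightarrow> diffs (map weight ks) (\<lambda>x. \<Prod>p\<in>P. segment_vol p (q p) x) x \<ge> 1"
    by blast
  define js where "js = [Suc p..<q p]"
  define G where "G = segment_vol p (q p)"
  define H where "H x = (\<Prod>p\<in>P. segment_vol p (q p) x)" for x
  have H: "H (\<lambda>k. x k + v k) = H x" if "v \<in> set (map weight js)" for v x
  proof -
    from that have "v \<in> weight ` set js" by simp
    then obtain i where "v = weight i" "i \<in> set js" by (rule imageE)
    then have i: "v = weight i" "p < i" "i < q p" by (simp_all add: js_def)
    show ?thesis unfolding H_def i(1)
    proof (intro prod.cong refl segment_vol_invariant)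
      fix p' assume p': "p' \<in> P"
      then have "p \<noteq> p'" using insert.hyps by auto
      then show "i \<le> p' \<or> q p' \<le> i" using insert.prems(2)[of p p' i] p' i by auto
      show "p' < q p'" using insert.prems(1)[of p'] p' by simp
    qed
  qed
  have G: "diffs (map weight js) G (\<lambda>k. x k + v k) = diffs (map weight js) G x"
    if "v \<in> set (map weight ks)" for v x
  proof (rule diffs_invariant)
    fix y
    from that have "v \<in> weight ` (\<Union>p\<in>P. {p<..<q p})" by (simp add: ks(1))
    then obtain i where v: "v = weight i" "i \<in> (\<Union>p\<in>P. {p<..<q p})" by (rule imageE)
    from v(2) obtain p' where "p' \<in> P" "i \<in> {p'<..<q p'}" by (rule UN_E)
    then have i: "v = weight i" "p' \<in> P" "p' < i" "i < q p'" using v(1) by simp_all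
    then have "p' \<noteq> p" using insert.hyps by auto
    then have "i \<le> p \<or> q p \<le> i" using insert.prems(2)[of p' p i] i by auto
    then show "G (\<lambda>k. y k + v k) = G y"
      unfolding G_def i(1) using insert.prems(1)[of p] by (intro segment_vol_invariant) auto
  qed
  have "diffs (map weight (js @ ks)) (\<lambda>x. \<Prod>p\<in>insert p P. segment_vol p (q p) x) x \<ge> 1"
    if x: "antimono x" for x
  proof -
    have "(\<lambda>x. \<Prod>p\<in>insert p P. segment_vol p (q p) x) = (\<lambda>x. H x * G x)"
      using insert.hyps by (simp add: H_def G_def mult.commute)
    then have "diffs (map weight (js @ ks)) (\<lambda>x. \<Prod>p\<in>insert p P. segment_vol p (q p) x) x =
        diffs (map weight ks) (diffs (map weight js) (\<lambda>x. H x * G x)) x"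
      by (simp add: diffs_append)
    \<comment> \<open>First \<open>H\<close> is constant along \<open>js\<close> and comes out; then
      the remaining difference of \<open>G\<close> is constant along \<open>ks\<close> and comes out
      in turn.\<close>
    also have "diffs (map weight js) (\<lambda>x. H x * G x) = (\<lambda>x. diffs (map weight js) G x * H x)"
      using diffs_mult_left[of "map weight js" H G, OF H] by (auto simp: mult.commute)
    also have "diffs (map weight ks) \<dots> x = diffs (map weight js) G x * diffs (map weight ks) H x"
      by (rule diffs_mult_left[OF G])
    also have "\<dots> \<ge> 1 * 1"
    proof (rule mult_mono)
      show "1 \<le> diffs (map weight js) G x"
        unfolding G_def js_def using insert.prems(1)[of p] by (intro diffs_segment_vol x) auto
      then show "0 \<le> diffs (map weight js) G x" by simp
      show "1 \<le> diffs (map weight ks) H x" unfolding H_def[abs_def] by (rule ks(2)[OF x])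
    qed simp
    finally show ?thesis by simp
  qed
  moreover have "set (js @ ks) = (\<Union>p\<in>insert p P. {p<..<q p})"
    unfolding set_append ks(1) by (auto simp: js_def)
  ultimately show ?case by blast
qed

lemma next_cut_bounds:
  assumes "C \<subseteq> {1..N}" "N \<in> C" "p \<in> insert 0 C - {N}"
  shows "next_cut C p \<in> C" "p < next_cut C p" "\<And>i. i \<in> C \<Longrightarrow> i \<le> p \<or> next_cut C p \<le> i"
proof -
  let ?S = "{k \<in> C. p < k}"
  have fin: "finite ?S" using assms(1) finite_subset by fastforce
  have "p < N" using assms by fastforce
  then have "?S \<noteq> {}" using assms(2) by auto
  then have "next_cut C p \<in> ?S" unfolding next_cut_def using fin by (intro Min_in)
  then show "next_cut C p \<in> C" "p < next_cut C p" by auto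
  show "i \<le> p \<or> next_cut C p \<le> i" if "i \<in> C" for i
  proof (cases "i \<le> p")
    case False
    then have "next_cut C p \<le> i" unfolding next_cut_def using that fin by (intro Min_le) auto
    then show ?thesis by simp
  qed simp
qed

text \<open>A cut is never strictly inside a segment.\<close>

lemma comp_vol_invariant:
  assumes "C \<subseteq> {1..N}" "N \<in> C" "i \<in> C"
  shows "comp_vol N C (\<lambda>k. x k + weight i k) = comp_vol N C x"
  unfolding comp_vol_def
  by (intro prod.cong refl segment_vol_invariant next_cut_bounds[OF assms(1,2)] assms(3))

lemma ex_diffs_comp_vol:
  assumes "C \<subseteq> {1..N}" "N \<in> C"
  obtains ks where "set ks = {1..<N} - C"
    "\<And>x. antimono x \<Longrightarrow> diffs (map weight ks) (comp_vol N C) x \<ge> 1"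
proof -
  let ?P = "insert 0 C - {N}" and ?q = "next_cut C"
  note nc = next_cut_bounds[OF assms]
  have fin: "finite ?P" using assms(1) finite_subset by fastforce
  have sep: "i \<le> p' \<or> ?q p' \<le> i"
    if "p \<in> ?P" "p' \<in> ?P" "p \<noteq> p'" "p < i" "i < ?q p" for p p' i
  proof (cases "p' \<le> p")
    case True
    then have "p \<in> C" "p' < p" using that by auto
    then have "?q p' \<le> p" using nc(3)[OF that(2), of p] by auto
    then show ?thesis using that by simp
  next
    case False
    then have "p' \<in> C" using that by auto
    then have "?q p \<le> p'" using nc(3)[OF that(1), of p'] False by auto
    then show ?thesis using that by simp
  qed
  have U: "(\<Union>p\<in>?P. {p<..<?q p}) = {1..<N} - C"
  proof (intro set_eqI iffI)
    fix i assume "i \<in> (\<Union>p\<in>?P. {p<..<?q p})"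
    then obtain p where p: "p \<in> ?P" "p < i" "i < ?q p" by auto
    then have "i \<notin> C" using nc(3)[OF p(1), of i] by auto
    moreover have "?q p \<le> N" using nc(1)[OF p(1)] assms(1) by auto
    ultimately show "i \<in> {1..<N} - C" using p by auto
  next
    fix i assume i: "i \<in> {1..<N} - C"
    \<comment> \<open>The start of the segment that has \<open>i\<close> in its interior.\<close>
    define p where "p = Max {k \<in> insert 0 C. k \<le> i}"
    have fin': "finite {k \<in> insert 0 C. k \<le> i}" by simp
    have "p \<in> {k \<in> insert 0 C. k \<le> i}" unfolding p_def using fin' by (intro Max_in) auto
    then have p: "p \<in> insert 0 C" "p \<le> i" by auto
    then have pP: "p \<in> ?P" "p < i" using i by (auto simp: le_less)
    moreover have "i < ?q p"
    proof (rule ccontr)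
      assume "\<not> i < ?q p"
      then have "?q p \<in> {k \<in> insert 0 C. k \<le> i}" using nc(1)[OF pP(1)] by auto
      then have "?q p \<le> p" unfolding p_def using fin' by (intro Max_ge)
      then show False using nc(2)[OF pP(1)] by simp
    qed
    ultimately show "i \<in> (\<Union>p\<in>?P. {p<..<?q p})" by auto
  qed
  have "\<exists>ks. set ks = (\<Union>p\<in>?P. {p<..<?q p}) \<and>
      (\<forall>x. antimono x \<longrightarrow> diffs (map weight ks) (\<lambda>x. \<Prod>p\<in>?P. segment_vol p (?q p) x) x \<ge> 1)"
  proof (rule diffs_prod_segment_vol[OF fin])
    show "p < ?q p" if "p \<in> ?P" for p by (rule nc(2)[OF that])
    show "i \<le> p' \<or> ?q p' \<le> i" if "p \<in> ?P" "p' \<in> ?P" "p \<noteq> p'" "p < i" "i < ?q p" for p p' i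
      by (rule sep[OF that])
  qed
  then obtain ks where "set ks = (\<Union>p\<in>?P. {p<..<?q p})"
    "\<forall>x. antimono x \<longrightarrow> diffs (map weight ks) (\<lambda>x. \<Prod>p\<in>?P. segment_vol p (?q p) x) x \<ge> 1"
    by (elim exE conjE)
  then show thesis by (intro that[of ks]) (simp_all only: U comp_vol_def[abs_def])
qed

text \<open>Up-sets are initial segments of positions whose lengths are the cuts. So the cuts
  together with one sorting determine the weak order.\<close>

lemma weak_order_iff_cuts:
  fixes v :: "real ^ 'd"
  assumes "sorts v \<sigma>"
  shows "(i, j) \<in> weak_order v \<longleftrightarrow> (\<forall>k\<in>cuts (weak_order v). \<sigma> i < k \<longrightarrow> \<sigma> j < k)"
proof -
  have lt: "\<sigma> i < card (weak_order v `` {l}) \<longleftrightarrow> v $ l \<le> v $ i" for i l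
  proof -
    have "i \<in> weak_order v `` {l} \<longleftrightarrow> \<sigma> i < card (weak_order v `` {l})"
      by (subst up_set_eq[OF assms]) simp
    then show ?thesis by (simp add: weak_order_def)
  qed
  have "(\<forall>k\<in>cuts (weak_order v). \<sigma> i < k \<longrightarrow> \<sigma> j < k) \<longleftrightarrow> (\<forall>l. v $ l \<le> v $ i \<longrightarrow> v $ l \<le> v $ j)"
    unfolding cuts_def by (simp add: lt)
  also have "\<dots> \<longleftrightarrow> v $ i \<le> v $ j" by (meson order_refl order_trans)
  finally show ?thesis by (simp add: weak_order_def)
qed

text \<open>Coordinates in equal positions are matched. This is where the cut set becomes a complete
  invariant under permutation of coordinates.\<close>

lemma same_cuts_permutation:
  fixes v w :: "real ^ 'd"
  assumes "cuts (weak_order v) = cuts (weak_order w)"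
  obtains \<sigma> where "bij \<sigma>" "\<And>i j. (i, j) \<in> weak_order w \<longleftrightarrow> (\<sigma> i, \<sigma> j) \<in> weak_order v"
proof -
  obtain \<rho> where \<rho>: "sorts v \<rho>" by (rule ex_sorts)
  obtain \<tau> where \<tau>: "sorts w \<tau>" by (rule ex_sorts)
  have b: "bij_betw \<rho> UNIV {..<CARD('d)}" "bij_betw \<tau> UNIV {..<CARD('d)}"
    using \<rho> \<tau> by (auto simp: sorts_def)
  define \<sigma> where "\<sigma> = the_inv \<rho> \<circ> \<tau>"
  have "bij \<sigma>" unfolding \<sigma>_def using bij_betw_trans[OF b(2) bij_betw_the_inv_into[OF b(1)]] .
  moreover have "\<rho> (\<sigma> i) = \<tau> i" for i
    using the_inv_bij[OF b(1), of "\<tau> i"] b(2) by (auto simp: \<sigma>_def bij_betw_def)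
  ultimately show thesis
    using that[of \<sigma>] weak_order_iff_cuts[OF \<rho>] weak_order_iff_cuts[OF \<tau>] assms by simp
qed

text \<open>A permutation of coordinates is linear and preserves the inner product, hence commutes
  with spans and polars.\<close>

lemma polar_in_span_permute_coords:
  fixes K :: "(real ^ 'd) set"
  assumes "bij \<sigma>"
  shows "polar_in_span (permute_coords \<sigma> K) = permute_coords \<sigma> (polar_in_span K)"
proof -
  define \<phi> where "\<phi> x = (\<chi> i. x $ \<sigma> i)" for x :: "real ^ 'd"
  have perm: "permute_coords \<sigma> T = \<phi> ` T" for T by (auto simp: permute_coords_def \<phi>_def)
  have lin: "linear \<phi>" by (rule linearI) (auto simp: \<phi>_def vec_eq_iff)
  have inner: "\<phi> x \<bullet> \<phi> y = x \<bullet> y" for x y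
    unfolding inner_vec_def \<phi>_def using sum.reindex_bij_betw[OF assms, of "\<lambda>i. x $ i \<bullet> y $ i"] by simp
  show ?thesis unfolding perm polar_in_span_def linear_span_image[OF lin] by (auto simp: inner)
qed

lemma cone_permute_coords:
  fixes v w :: "real ^ 'd"
  assumes "bij \<sigma>" "\<And>i j. (i, j) \<in> weak_order w \<longleftrightarrow> (\<sigma> i, \<sigma> j) \<in> weak_order v"
  shows "{y. weak_order w \<subseteq> weak_order y} = permute_coords \<sigma> {y. weak_order v \<subseteq> weak_order y}"
proof (intro set_eqI iffI)
  fix y assume y: "y \<in> {y. weak_order w \<subseteq> weak_order y}"
  define z where "z = (\<chi> i. y $ the_inv \<sigma> i)"
  have inj: "inj \<sigma>" and surj: "surj \<sigma>" using assms(1) by (auto simp: bij_def)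
  have "y = (\<chi> i. z $ \<sigma> i)" by (simp add: z_def vec_eq_iff the_inv_f_f[OF inj])
  moreover have "weak_order v \<subseteq> weak_order z"
  proof clarify
    fix a b assume ab: "(a, b) \<in> weak_order v"
    obtain i j where "a = \<sigma> i" "b = \<sigma> j" using surj by (metis surjD)
    then show "(a, b) \<in> weak_order z"
      using ab assms(2)[of i j] y by (auto simp: z_def weak_order_def the_inv_f_f[OF inj])
  qed
  ultimately show "y \<in> permute_coords \<sigma> {y. weak_order v \<subseteq> weak_order y}"
    unfolding permute_coords_def by blast
next
  fix y assume "y \<in> permute_coords \<sigma> {y. weak_order v \<subseteq> weak_order y}"
  then obtain z where z: "weak_order v \<subseteq> weak_order z" "y = (\<chi> i. z $ \<sigma> i)"
    by (auto simp: permute_coords_def)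
  have "(i, j) \<in> weak_order y" if "(i, j) \<in> weak_order w" for i j
  proof -
    have "(\<sigma> i, \<sigma> j) \<in> weak_order z" using assms(2) that z(1) by blast
    then show ?thesis by (simp add: z(2) weak_order_def)
  qed
  then show "y \<in> {y. weak_order w \<subseteq> weak_order y}" by auto
qed

text \<open>Strictness fixes the normal fan, and integrality makes McMullen's formula applicable;
  both survive the addition of a weight.\<close>

definition strict_int :: "(nat \<Rightarrow> real) \<Rightarrow> bool"
  where "strict_int x \<longleftrightarrow> (\<forall>k. x (Suc k) < x k \<and> x k \<in> \<int>)"

lemma strict_int_antimono: "strict_int x \<Longrightarrow> antimono x"
  by (simp add: strict_int_def decseq_Suc_iff less_imp_le)

lemma strict_int_add_weight:
  assumes "strict_int x"
  shows "strict_int (\<lambda>k. x k + weight i k)"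
proof -
  have "weight i (Suc k) \<le> weight i k" "weight i k \<in> \<int>" for k by (auto simp: weight_def)
  then show ?thesis using assms unfolding strict_int_def by (auto intro: add_less_le_mono)
qed

lemma construction_indep:
  fixes \<alpha> :: "(real ^ 'd) set \<Rightarrow> (real ^ 'd) set \<Rightarrow> real"
  assumes "mcmullen_construction \<alpha>" "strict_int x" "strict_int y" "R \<in> range weak_order"
  shows "\<alpha> (perm_face x R) (perm_polytope x) = \<alpha> (perm_face y R) (perm_polytope y)"
proof -
  obtain v where R: "R = weak_order v" using assms(4) by auto
  have "integral_polytope (perm_polytope x :: (real ^ 'd) set)" "integral_polytope (perm_polytope y :: (real ^ 'd) set)"
    using assms(2,3) by (auto simp: strict_int_def intro: integral_perm_polytope)
  moreover have "nonempty_face (perm_face x R) (perm_polytope x)" "nonempty_face (perm_face y R) (perm_polytope y)"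
    using assms by (simp_all add: nonempty_face_perm_polytope_iff strict_int_antimono)
  moreover have "ncone (perm_face x R) (perm_polytope x) = ncone (perm_face y R) (perm_polytope y)"
    unfolding R using assms(2,3) by (simp add: strict_int_def ncone_perm_face)
  ultimately show ?thesis using assms(1) unfolding mcmullen_construction_def by blast
qed

lemma construction_sym:
  fixes \<alpha> :: "(real ^ 'd) set \<Rightarrow> (real ^ 'd) set \<Rightarrow> real"
  assumes "symmetric_about_coords \<alpha>" "strict_int x" "cuts (weak_order v) = cuts (weak_order w)"
  shows "\<alpha> (perm_face x (weak_order v)) (perm_polytope x) = \<alpha> (perm_face x (weak_order w)) (perm_polytope x)"
proof -
  obtain \<sigma> where \<sigma>: "bij \<sigma>" "\<And>i j. (i, j) \<in> weak_order w \<longleftrightarrow> (\<sigma> i, \<sigma> j) \<in> weak_order v"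
    using same_cuts_permutation[OF assms(3)] by blast
  have nc: "ncone (perm_face x (weak_order u)) (perm_polytope x) = {y. weak_order u \<subseteq> weak_order y}" for u :: "real ^ 'd"
    using assms(2) by (intro ncone_perm_face) (simp add: strict_int_def)
  have "integral_polytope (perm_polytope x :: (real ^ 'd) set)"
    using assms(2) by (auto simp: strict_int_def intro: integral_perm_polytope)
  moreover have "nonempty_face (perm_face x (weak_order u)) (perm_polytope x)" for u :: "real ^ 'd"
    using assms(2) by (simp add: nonempty_face_perm_polytope_iff strict_int_antimono)
  moreover have "polar_in_span (ncone (perm_face x (weak_order w)) (perm_polytope x)) =
      permute_coords \<sigma> (polar_in_span (ncone (perm_face x (weak_order v)) (perm_polytope x)))"
    unfolding nc cone_permute_coords[OF \<sigma>] by (rule polar_in_span_permute_coords[OF \<sigma>(1)])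
  ultimately have "\<alpha> (perm_face x (weak_order w)) (perm_polytope x) = \<alpha> (perm_face x (weak_order v)) (perm_polytope x)"
    using assms(1) \<sigma>(1) unfolding symmetric_about_coords_def by blast
  then show ?thesis by simp
qed

lemma construction_sum:
  fixes \<alpha> :: "(real ^ 'd) set \<Rightarrow> (real ^ 'd) set \<Rightarrow> real"
  assumes "mcmullen_construction \<alpha>" "strict_int x"
  shows "real (card (perm_polytope x \<inter> (int_lattice :: (real ^ 'd) set))) =
    (\<Sum>R\<in>range weak_order. \<alpha> (perm_face x R) (perm_polytope x) * nvol (perm_face x R))"
proof -
  have faces: "{F. nonempty_face F (perm_polytope x)} = perm_face x ` range (weak_order :: real ^ 'd \<Rightarrow> _)"
    using nonempty_face_perm_polytope_iff[OF strict_int_antimono[OF assms(2)]] by blast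
  have inj: "inj_on (perm_face x) (range (weak_order :: real ^ 'd \<Rightarrow> _))"
    using assms(2) by (intro inj_on_perm_face) (simp add: strict_int_def)
  have "integral_polytope (perm_polytope x :: (real ^ 'd) set)"
    using assms(2) by (auto simp: strict_int_def intro: integral_perm_polytope)
  then have "real (card (perm_polytope x \<inter> (int_lattice :: (real ^ 'd) set))) =
      (\<Sum>F\<in>{F. nonempty_face F (perm_polytope x)}. \<alpha> F (perm_polytope x) * nvol F)"
    using assms(1) unfolding mcmullen_construction_def by blast
  then show ?thesis unfolding faces sum.reindex[OF inj] by simp
qed

theorem theorem1p6:
  fixes \<alpha> \<alpha>' :: "(real ^ 'd) set \<Rightarrow> (real ^ 'd) set \<Rightarrow> real"
  assumes "mcmullen_construction \<alpha>" and "symmetric_about_coords \<alpha>"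
    and "mcmullen_construction \<alpha>'" and "symmetric_about_coords \<alpha>'"
  shows "\<forall>F. nonempty_face F (permutohedron :: (real ^ 'd) set) \<longrightarrow>
    \<alpha> F permutohedron = \<alpha>' F permutohedron"
proof -
  let ?N = "CARD('d)"
  define W where "W = range (weak_order :: real ^ 'd \<Rightarrow> _)"
  define x0 where "x0 = (\<lambda>k. real ?N - real k)"
  have x0: "strict_int x0" by (auto simp: strict_int_def x0_def)
  define \<beta> where "\<beta> R = \<alpha> (perm_face x0 R) (perm_polytope x0) - \<alpha>' (perm_face x0 R) (perm_polytope x0)" for R
  have "\<exists>\<kappa>>0. \<forall>x. strict_int x \<longrightarrow> nvol (perm_face x R) = \<kappa> * comp_vol ?N (cuts R) x" if "R \<in> W" for R
  proof -
    obtain u where R: "R = weak_order u" using \<open>R \<in> W\<close> by (auto simp: W_def)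
    obtain \<kappa> where "\<kappa> > 0" "\<And>x. (\<And>k. x (Suc k) < x k) \<Longrightarrow> nvol (perm_face x (weak_order u)) =
      \<kappa> * (\<Prod>c\<in>level_values u. perm_vol (card (level u c) - 1) (segment x u c))"
      using nvol_perm_face[of u] by blast
    then show ?thesis unfolding R prod_levels_eq_comp_vol strict_int_def by blast
  qed
  then obtain \<kappa> where \<kappa>: "\<And>R. R \<in> W \<Longrightarrow> \<kappa> R > 0"
    "\<And>R x. R \<in> W \<Longrightarrow> strict_int x \<Longrightarrow> nvol (perm_face x R) = \<kappa> R * comp_vol ?N (cuts R) x"
    by metis
  have zero: "(\<Sum>R\<in>W. (\<beta> R * \<kappa> R) * comp_vol ?N (cuts R) x) = 0" if x: "strict_int x" for x
  proof -
    have "(\<Sum>R\<in>W. \<alpha> (perm_face x R) (perm_polytope x) * nvol (perm_face x R)) =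
        (\<Sum>R\<in>W. \<alpha>' (perm_face x R) (perm_polytope x) * nvol (perm_face x R))"
      unfolding W_def using construction_sum[OF assms(1) x] construction_sum[OF assms(3) x] by simp
    then have "(\<Sum>R\<in>W. (\<alpha> (perm_face x R) (perm_polytope x) - \<alpha>' (perm_face x R) (perm_polytope x)) * nvol (perm_face x R)) = 0"
      by (simp add: left_diff_distrib sum_subtractf)
    moreover have "(\<alpha> (perm_face x R) (perm_polytope x) - \<alpha>' (perm_face x R) (perm_polytope x)) * nvol (perm_face x R)
        = (\<beta> R * \<kappa> R) * comp_vol ?N (cuts R) x" if "R \<in> W" for R
      using construction_indep[OF assms(1) x x0, of R] construction_indep[OF assms(3) x x0, of R] that \<kappa>(2)[OF that x]
      by (simp add: \<beta>_def W_def)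
    ultimately show ?thesis by simp
  qed
  have \<beta>_zero: "\<beta> R = 0" if R_in: "R \<in> W" for R
  proof (rule ccontr)
    assume "\<beta> R \<noteq> 0"
    \<comment> \<open>Minimality is by the number of cuts: a weak order with nonzero
      \<open>\<beta>\<close> whose cuts lie among those of \<open>R0\<close> must then have exactly
      the same cuts.\<close>
    then obtain R0 where R0: "R0 \<in> W" "\<beta> R0 \<noteq> 0"
      and min: "\<And>R. R \<in> W \<Longrightarrow> \<beta> R \<noteq> 0 \<Longrightarrow> card (cuts R0) \<le> card (cuts R)"
      using ex_has_least_nat[of "\<lambda>R. R \<in> W \<and> \<beta> R \<noteq> 0" R "\<lambda>R. card (cuts R)"] R_in by blast
    have bounds: "cuts R \<subseteq> {1..?N}" "?N \<in> cuts R" if "R \<in> W" for R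
      using that cuts_bounds by (auto simp: W_def)
    obtain ks where ks: "set ks = {1..<?N} - cuts R0"
      "\<And>x. antimono x \<Longrightarrow> diffs (map weight ks) (comp_vol ?N (cuts R0)) x \<ge> 1"
      using ex_diffs_comp_vol[OF bounds[OF R0(1)]] by blast
    let ?D = "\<lambda>R. diffs (map weight ks) (comp_vol ?N (cuts R)) x0"
    have D0: "?D R0 \<ge> 1" by (rule ks(2)[OF strict_int_antimono[OF x0]])
    define W0 where "W0 = {R \<in> W. cuts R = cuts R0}"
    have other: "\<beta> R * \<kappa> R * ?D R = 0" if R: "R \<in> W - W0" for R
    proof (cases "\<beta> R = 0")
      case False
      have "\<not> cuts R \<subseteq> cuts R0"
      proof
        assume sub: "cuts R \<subseteq> cuts R0"
        have "finite (cuts R0)" using bounds(1)[OF R0(1)] finite_subset by blast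
        then have "cuts R = cuts R0" using sub min[of R] R False by (intro card_seteq) auto
        then show False using R by (simp add: W0_def)
      qed
      then obtain i where i: "i \<in> cuts R" "i \<notin> cuts R0" by auto
      have "i \<in> {1..?N}" "i \<noteq> ?N" using i bounds(1)[of R] bounds(2)[OF R0(1)] R by auto
      \<comment> \<open>A cut of \<open>R\<close> that is not a cut of \<open>R0\<close> is one of
        the directions, and \<open>comp_vol\<close> for \<open>R\<close> is invariant along
        it.\<close>
      then have "i \<in> set ks" unfolding ks(1) using i(2) by simp
      then have "?D R = 0"
        using i(1) R bounds[of R] by (intro diffs_eq_0[of "weight i"] comp_vol_invariant) auto
      then show ?thesis by simp
    qed simp
    have same: "\<beta> R = \<beta> R0" if "R \<in> W0" for R
    proof -
      have "R \<in> range weak_order" "R0 \<in> range weak_order" using that R0(1) by (simp_all add: W0_def W_def)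
      then obtain v w where v: "R = weak_order v" and w: "R0 = weak_order w" by (elim rangeE)
      have "cuts (weak_order v) = cuts (weak_order w)" using that unfolding W0_def v w by simp
      then show ?thesis
        unfolding v w \<beta>_def using construction_sym[OF assms(2) x0, of v w] construction_sym[OF assms(4) x0, of v w] by simp
    qed
    have "0 = diffs (map weight ks) (\<lambda>x. 0) x0" by (simp add: diffs_zero)
    also have "\<dots> = diffs (map weight ks) (\<lambda>x. \<Sum>R\<in>W. (\<beta> R * \<kappa> R) * comp_vol ?N (cuts R) x) x0"
      \<comment> \<open>The relation holds only on \<open>strict_int\<close>, which is closed under
        adding weights.\<close>
      by (rule diffs_cong[of strict_int]) (auto simp: zero strict_int_add_weight x0)
    also have "\<dots> = (\<Sum>R\<in>W. \<beta> R * \<kappa> R * ?D R)"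
      by (simp add: diffs_sum diffs_cmult)
    also have "\<dots> = (\<Sum>R\<in>W0. \<beta> R * \<kappa> R * ?D R)"
      by (rule sum.mono_neutral_right) (auto simp: W0_def other[unfolded W0_def])
    \<comment> \<open>On \<open>W0\<close> both \<open>\<beta>\<close> and the difference are
      constant, so the factors \<open>\<kappa>\<close> add up to a positive number and nothing
      cancels.\<close>
    also have "\<dots> = \<beta> R0 * ?D R0 * (\<Sum>R\<in>W0. \<kappa> R)"
      unfolding sum_distrib_left by (intro sum.cong) (auto simp: same W0_def)
    finally have "\<beta> R0 * ?D R0 * (\<Sum>R\<in>W0. \<kappa> R) = 0" by simp
    moreover have "(\<Sum>R\<in>W0. \<kappa> R) > 0"
      using R0(1) \<kappa>(1) by (intro sum_pos) (auto simp: W0_def)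
    ultimately show False using R0(2) D0 by simp
  qed
  show ?thesis
  proof (intro allI impI)
    fix F assume "nonempty_face F (permutohedron :: (real ^ 'd) set)"
    then obtain R where R: "R \<in> W" "F = perm_face x0 R"
      unfolding permutohedron_eq_perm_polytope x0_def[symmetric]
        nonempty_face_perm_polytope_iff[OF strict_int_antimono[OF x0]] W_def by blast
    then show "\<alpha> F permutohedron = \<alpha>' F permutohedron"
      using \<beta>_zero[OF R(1)] unfolding permutohedron_eq_perm_polytope x0_def[symmetric] \<beta>_def by simp
  qed
qed

end
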